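(* For $a\in\mathbb{R}$ let $E(a)\subset\mathbb{C}^3$ be the real ellipsoid of revolution defined by $$\varrho(z_1,z_2,w):=|z_1|^2+|z_2|^2+|w|^2+\mathrm{Re}(aw^2)-1=0 .$$ Then, unless $a=0$, the CR invariant one-form $X_\alpha$ is nontrivial (i.e. not identically zero) on $E(a)$.
   Context: $E(a)$ is a strictly pseudoconvex real hypersurface in $\mathbb{C}^3$, hence a CR manifold of dimension $2n+1=5$ with $n=2$. Greek indices run over $1,2$ and repeated indices are summed. Let $\theta$ be a pseudohermitian structure on $E(a)$ (a real one-form annihilating $T^{1,0}\oplus T^{0,1}$ whose Levi form is positive definite; e.g. the pullback of $i\bar\partial\varrho$ to $E(a)$). Let $\{Z_\alpha\}$ be a local frame of $T^{1,0}$, $Z_{\bar\alpha}=\overline{Z_\alpha}$, and $h_{\alpha\bar\beta}=-i\,d\theta(Z_\alpha,Z_{\bar\beta})$, with inverse $h^{\alpha\bar\beta}$, used to raise and lower indices. $T$ is the real vector field with $\theta(T)=1$, $T\,\rfloor\,d\theta=0$. The Tanaka--Webster connection $\nabla$ is the unique linear connection that preserves $T^{1,0}$, has $\theta$ and $d\theta$ parallel, and whose torsion $\mathbb{T}_\nabla(X,Y)=\nabla_XY-\nabla_YX-[X,Y]$ satisfies $\mathbb{T}_\nabla(Z_\alpha,Z_\beta)=0$, $\mathbb{T}_\nabla(Z_\alpha,Z_{\bar\beta})=ih_{\alpha\bar\beta}T$ and $\mathbb{T}_\nabla(T,Z_\alpha)\in T^{0,1}$. With $R(X,Y)Z=\nabla_X\nabla_YZ-\nabla_Y\nabla_XZ-\nabla_{[X,Y]}Z$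 put $R_{\alpha\bar\beta\gamma\bar\sigma}=\langle R(Z_\alpha,Z_{\bar\beta})Z_\gamma,Z_{\bar\sigma}\rangle$ (where $\langle Z_\alpha,Z_{\bar\beta}\rangle=h_{\alpha\bar\beta}$, complex bilinear), $R_{\gamma\bar\sigma}=h^{\alpha\bar\beta}R_{\alpha\bar\beta\gamma\bar\sigma}$, $R=h^{\gamma\bar\sigma}R_{\gamma\bar\sigma}$. The Chern--Moser--Weyl tensor is $$S_{\alpha\bar\beta\gamma\bar\sigma}=R_{\alpha\bar\beta\gamma\bar\sigma}-\frac{R_{\alpha\bar\beta}h_{\gamma\bar\sigma}+R_{\gamma\bar\beta}h_{\alpha\bar\sigma}+R_{\alpha\bar\sigma}h_{\gamma\bar\beta}+R_{\gamma\bar\sigma}h_{\alpha\bar\beta}}{n+2}+\frac{R\,(h_{\alpha\bar\beta}h_{\gamma\bar\sigma}+h_{\alpha\bar\sigma}h_{\gamma\bar\beta})}{(n+1)(n+2)},\qquad n=2,$$ and $|S|^2=|S_{\epsilon\bar\beta\gamma\bar\sigma}|^2=S_{\epsilon\bar\beta\gamma\bar\sigma}S^{\epsilon\bar\beta\gamma\bar\sigma}$. The one-form $X_\alpha$ (Case--Gover) is $$X_\alpha=\frac12\,S_{\alpha\bar\beta\gamma\bar\sigma}\,S^{\bar\beta\gamma\bar\sigma}{}_{\bar\epsilon,}{}^{\bar\epsilon}+\frac14\nabla_\alpha|S_{\epsilon\bar\beta\gamma\bar\sigma}|^2 ,$$ where indices after a comma denote covariant derivatives with respect to $\nabla$; explicitly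 the first term is $\frac12 S_{\alpha\bar\beta\gamma\bar\sigma}\,h^{\mu\bar\beta}h^{\gamma\bar\nu}h^{\lambda\bar\sigma}h^{\kappa\bar\epsilon}\,\nabla_\kappa S_{\mu\bar\nu\lambda\bar\epsilon}$. It is known (Case--Gover) to be CR invariant: when $\theta$ is replaced by $e^{\Upsilon}\theta$ with the frame $Z_\alpha$ kept fixed, $X_\alpha$ is multiplied by $e^{-2\Upsilon}$. Hence whether $X_\alpha$ vanishes identically depends only on the CR structure and not on the choice of $\theta$. *)

theory Defs
  imports "HOL-Analysis.Analysis"
begin

section \<open>Smooth functions\<close>

primrec Ck_on :: "nat \<Rightarrow> 'a::real_normed_vector set \<Rightarrow> ('a \<Rightarrow> 'b::real_normed_vector) \<Rightarrow> bool" where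
  "Ck_on 0 U f \<longleftrightarrow> continuous_on U f"
| "Ck_on (Suc k) U f \<longleftrightarrow>
     (\<forall>p\<in>U. f differentiable (at p)) \<and> (\<forall>v. Ck_on k U (\<lambda>p. frechet_derivative f (at p) v))"

text \<open>To be used on open sets \<open>U\<close> of a finite-dimensional space.\<close>

definition smooth_on :: "'a::real_normed_vector set \<Rightarrow> ('a \<Rightarrow> 'b::real_normed_vector) \<Rightarrow> bool" where
  "smooth_on U f \<longleftrightarrow> (\<forall>k. Ck_on k U f)"


section \<open>Complexified vectors on complex 3-space\<close>

text \<open>The pair \<open>(u, v)\<close> is the complexified tangent vector
  \<open>\<Sum>j. u\<^sub>j \<partial>/\<partial>z\<^sub>j + v\<^sub>j \<partial>/\<partial>(cnj z\<^sub>j)\<close>; the real tangent vectors are the pairs fixed by \<open>cconj\<close>.\<close>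

type_synonym cvec = "(complex^3) \<times> (complex^3)"

definition cconj :: "cvec \<Rightarrow> cvec" where
  "cconj X = ((\<chi> j. cnj (snd X $ j)), (\<chi> j. cnj (fst X $ j)))"

definition cscale :: "complex \<Rightarrow> cvec \<Rightarrow> cvec" where
  "cscale c X = (c *s fst X, c *s snd X)"

definition wirtinger :: "3 \<Rightarrow> (complex^3 \<Rightarrow> complex) \<Rightarrow> complex^3 \<Rightarrow> complex" where
  "wirtinger j f p =
     (frechet_derivative f (at p) (axis j 1) - \<i> * frechet_derivative f (at p) (axis j \<i>)) / 2"

definition wirtinger_bar :: "3 \<Rightarrow> (complex^3 \<Rightarrow> complex) \<Rightarrow> complex^3 \<Rightarrow> complex" where
  "wirtinger_bar j f p =
     (frechet_derivative f (at p) (axis j 1) + \<i> * frechet_derivative f (at p) (axis j \<i>)) / 2"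

definition dir :: "cvec \<Rightarrow> (complex^3 \<Rightarrow> complex) \<Rightarrow> complex^3 \<Rightarrow> complex" where
  "dir X f p = (\<Sum>j\<in>UNIV. fst X $ j * wirtinger j f p + snd X $ j * wirtinger_bar j f p)"

definition dir_field :: "cvec \<Rightarrow> (complex^3 \<Rightarrow> cvec) \<Rightarrow> complex^3 \<Rightarrow> cvec" where
  "dir_field X Y p =
     ((\<chi> j. dir X (\<lambda>q. fst (Y q) $ j) p), (\<chi> j. dir X (\<lambda>q. snd (Y q) $ j) p))"

definition bracket :: "(complex^3 \<Rightarrow> cvec) \<Rightarrow> (complex^3 \<Rightarrow> cvec) \<Rightarrow> complex^3 \<Rightarrow> cvec" where
  "bracket X Y p = dir_field (X p) Y p - dir_field (Y p) X p"


section \<open>Real hypersurfaces and their CR structure\<close>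

text \<open>A hypersurface \<open>M\<close> is the zero set of a smooth real function \<open>\<rho>\<close> with \<open>d\<rho> \<noteq> 0\<close> on \<open>M\<close>.
  Functions, vector fields and forms on (an open part \<open>M \<inter> U\<close> of) \<open>M\<close> are represented by smooth
  extensions to an open set of the ambient space. All conditions are imposed at points of \<open>M\<close> only
  and all derivatives there are taken along tangent vectors of \<open>M\<close>, so that the choice of the
  extensions is immaterial.\<close>

definition hypersurface :: "(complex^3 \<Rightarrow> real) \<Rightarrow> (complex^3) set" where
  "hypersurface \<rho> = {p. \<rho> p = 0}"

definition CT :: "(complex^3 \<Rightarrow> real) \<Rightarrow> complex^3 \<Rightarrow> cvec set" where
  "CT \<rho> p = {X. dir X (\<lambda>q. complex_of_real (\<rho> q)) p = 0}"

definition T10 :: "(complex^3 \<Rightarrow> real) \<Rightarrow> complex^3 \<Rightarrow> cvec set" where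
  "T10 \<rho> p = {X \<in> CT \<rho> p. snd X = 0}"

definition T01 :: "(complex^3 \<Rightarrow> real) \<Rightarrow> complex^3 \<Rightarrow> cvec set" where
  "T01 \<rho> p = {X \<in> CT \<rho> p. fst X = 0}"

definition tangent_field :: "(complex^3 \<Rightarrow> real) \<Rightarrow> (complex^3) set \<Rightarrow> (complex^3 \<Rightarrow> cvec) \<Rightarrow> bool" where
  "tangent_field \<rho> U X \<longleftrightarrow> open U \<and> smooth_on U X \<and> (\<forall>p \<in> hypersurface \<rho> \<inter> U. X p \<in> CT \<rho> p)"

definition CR_frame :: "(complex^3 \<Rightarrow> real) \<Rightarrow> (complex^3) set \<Rightarrow> (2 \<Rightarrow> complex^3 \<Rightarrow> cvec) \<Rightarrow> bool" where
  "CR_frame \<rho> U Z \<longleftrightarrow> open U \<and> (\<forall>\<alpha>. smooth_on U (Z \<alpha>)) \<and>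
     (\<forall>p \<in> hypersurface \<rho> \<inter> U. (\<forall>\<alpha>. Z \<alpha> p \<in> T10 \<rho> p) \<and>
        (\<forall>X \<in> T10 \<rho> p. \<exists>!c::complex^2. X = (\<Sum>\<alpha>\<in>UNIV. cscale (c $ \<alpha>) (Z \<alpha> p))))"

definition bar :: "(2 \<Rightarrow> complex^3 \<Rightarrow> cvec) \<Rightarrow> 2 \<Rightarrow> complex^3 \<Rightarrow> cvec" where
  "bar Z \<beta> p = cconj (Z \<beta> p)"


section \<open>Pseudohermitian structures\<close>

text \<open>A real one-form \<open>\<Sum>j. t\<^sub>j dz\<^sub>j + cnj t\<^sub>j d(cnj z\<^sub>j)\<close> is given by its coefficients \<open>t\<close>.
  In the exterior derivative below the vectors \<open>X\<close>, \<open>Y\<close> are extended as constant fields, so it is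
  normalised by \<open>d\<theta>(X,Y) = X \<theta>(Y) - Y \<theta>(X) - \<theta>([X,Y])\<close>.\<close>

definition form :: "complex^3 \<Rightarrow> cvec \<Rightarrow> complex" where
  "form t X = (\<Sum>j\<in>UNIV. t $ j * fst X $ j + cnj (t $ j) * snd X $ j)"

definition dform :: "(complex^3 \<Rightarrow> complex^3) \<Rightarrow> complex^3 \<Rightarrow> cvec \<Rightarrow> cvec \<Rightarrow> complex" where
  "dform \<theta> p X Y = dir X (\<lambda>q. form (\<theta> q) Y) p - dir Y (\<lambda>q. form (\<theta> q) X) p"

definition levi :: "(complex^3 \<Rightarrow> complex^3) \<Rightarrow> complex^3 \<Rightarrow> cvec \<Rightarrow> cvec \<Rightarrow> complex" where
  "levi \<theta> p X Y = - \<i> * dform \<theta> p X Y"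

text \<open>\<open>levi \<theta> p X (cconj X)\<close> is automatically real, since \<open>\<theta>\<close> is.\<close>

definition pseudohermitian :: "(complex^3 \<Rightarrow> real) \<Rightarrow> (complex^3 \<Rightarrow> complex^3) \<Rightarrow> bool" where
  "pseudohermitian \<rho> \<theta> \<longleftrightarrow>
     (\<exists>W. open W \<and> hypersurface \<rho> \<subseteq> W \<and> smooth_on W \<theta>) \<and>
     (\<forall>p \<in> hypersurface \<rho>.
        (\<forall>X \<in> T10 \<rho> p \<union> T01 \<rho> p. form (\<theta> p) X = 0) \<and>
        (\<forall>X \<in> T10 \<rho> p. X \<noteq> 0 \<longrightarrow> 0 < Re (levi \<theta> p X (cconj X))))"

definition reeb_field ::
  "(complex^3 \<Rightarrow> real) \<Rightarrow> (complex^3 \<Rightarrow> complex^3) \<Rightarrow> (complex^3) set \<Rightarrow> (complex^3 \<Rightarrow> cvec) \<Rightarrow> bool" where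
  "reeb_field \<rho> \<theta> U T \<longleftrightarrow> tangent_field \<rho> U T \<and>
     (\<forall>p \<in> hypersurface \<rho> \<inter> U. cconj (T p) = T p \<and> form (\<theta> p) (T p) = 1 \<and>
        (\<forall>X \<in> CT \<rho> p. dform \<theta> p (T p) X = 0))"


section \<open>The Tanaka-Webster connection\<close>

text \<open>Two connections differ by a tensor. Hence every linear connection on \<open>M\<close>, extended complex
  linearly, has the form \<open>\<nabla>\<^sub>X Y = D\<^sub>X Y + \<Gamma>(X,Y)\<close>, where \<open>D\<close> is the flat derivative of the ambient
  space and \<open>\<Gamma>\<close> is a smooth, real field of bilinear maps such that \<open>\<nabla>\<^sub>X Y\<close> is tangent
  to \<open>M\<close> whenever \<open>X\<close> and \<open>Y\<close> are. Only the values of \<open>\<Gamma>\<close> on tangent vectors of \<open>M\<close> matter.\<close>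

definition cov :: "(complex^3 \<Rightarrow> cvec \<Rightarrow> cvec \<Rightarrow> cvec) \<Rightarrow>
    (complex^3 \<Rightarrow> cvec) \<Rightarrow> (complex^3 \<Rightarrow> cvec) \<Rightarrow> complex^3 \<Rightarrow> cvec" where
  "cov \<Gamma> X Y p = dir_field (X p) Y p + \<Gamma> p (X p) (Y p)"

definition cbilinear :: "(cvec \<Rightarrow> cvec \<Rightarrow> cvec) \<Rightarrow> bool" where
  "cbilinear B \<longleftrightarrow>
     (\<forall>X X' Y. B (X + X') Y = B X Y + B X' Y) \<and> (\<forall>X Y Y'. B X (Y + Y') = B X Y + B X Y') \<and>
     (\<forall>c X Y. B (cscale c X) Y = cscale c (B X Y) \<and> B X (cscale c Y) = cscale c (B X Y))"

definition linear_connection ::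
  "(complex^3 \<Rightarrow> real) \<Rightarrow> (complex^3 \<Rightarrow> cvec \<Rightarrow> cvec \<Rightarrow> cvec) \<Rightarrow> bool" where
  "linear_connection \<rho> \<Gamma> \<longleftrightarrow>
     (\<exists>W. open W \<and> hypersurface \<rho> \<subseteq> W \<and> (\<forall>X Y. smooth_on W (\<lambda>p. \<Gamma> p X Y)) \<and>
        (\<forall>p\<in>W. cbilinear (\<Gamma> p) \<and> (\<forall>X Y. \<Gamma> p (cconj X) (cconj Y) = cconj (\<Gamma> p X Y)))) \<and>
     (\<forall>U X Y. tangent_field \<rho> U X \<and> tangent_field \<rho> U Y \<longrightarrow>
        (\<forall>p \<in> hypersurface \<rho> \<inter> U. cov \<Gamma> X Y p \<in> CT \<rho> p))"

definition torsion :: "(complex^3 \<Rightarrow> cvec \<Rightarrow> cvec \<Rightarrow> cvec) \<Rightarrow>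
    (complex^3 \<Rightarrow> cvec) \<Rightarrow> (complex^3 \<Rightarrow> cvec) \<Rightarrow> complex^3 \<Rightarrow> cvec" where
  "torsion \<Gamma> X Y p = cov \<Gamma> X Y p - cov \<Gamma> Y X p - bracket X Y p"

definition curvature :: "(complex^3 \<Rightarrow> cvec \<Rightarrow> cvec \<Rightarrow> cvec) \<Rightarrow>
    (complex^3 \<Rightarrow> cvec) \<Rightarrow> (complex^3 \<Rightarrow> cvec) \<Rightarrow> (complex^3 \<Rightarrow> cvec) \<Rightarrow> complex^3 \<Rightarrow> cvec" where
  "curvature \<Gamma> X Y V p =
     cov \<Gamma> X (cov \<Gamma> Y V) p - cov \<Gamma> Y (cov \<Gamma> X V) p - cov \<Gamma> (bracket X Y) V p"

definition tanaka_webster :: "(complex^3 \<Rightarrow> real) \<Rightarrow> (complex^3 \<Rightarrow> complex^3) \<Rightarrow>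
    (complex^3 \<Rightarrow> cvec \<Rightarrow> cvec \<Rightarrow> cvec) \<Rightarrow> bool" where
  "tanaka_webster \<rho> \<theta> \<Gamma> \<longleftrightarrow> linear_connection \<rho> \<Gamma> \<and>
     \<comment> \<open>the connection preserves the (1,0)-bundle\<close>
     (\<forall>U X Y. tangent_field \<rho> U X \<and> tangent_field \<rho> U Y \<and>
        (\<forall>p \<in> hypersurface \<rho> \<inter> U. Y p \<in> T10 \<rho> p) \<longrightarrow>
        (\<forall>p \<in> hypersurface \<rho> \<inter> U. cov \<Gamma> X Y p \<in> T10 \<rho> p)) \<and>
     \<comment> \<open>\<open>\<theta>\<close> and \<open>d\<theta>\<close> are parallel\<close>
     (\<forall>U X Y. tangent_field \<rho> U X \<and> tangent_field \<rho> U Y \<longrightarrow>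
        (\<forall>p \<in> hypersurface \<rho> \<inter> U.
           dir (X p) (\<lambda>q. form (\<theta> q) (Y q)) p = form (\<theta> p) (cov \<Gamma> X Y p))) \<and>
     (\<forall>U X Y V. tangent_field \<rho> U X \<and> tangent_field \<rho> U Y \<and> tangent_field \<rho> U V \<longrightarrow>
        (\<forall>p \<in> hypersurface \<rho> \<inter> U.
           dir (X p) (\<lambda>q. dform \<theta> q (Y q) (V q)) p =
           dform \<theta> p (cov \<Gamma> X Y p) (V p) + dform \<theta> p (Y p) (cov \<Gamma> X V p))) \<and>
     \<comment> \<open>torsion\<close>
     (\<forall>U Z T. CR_frame \<rho> U Z \<and> reeb_field \<rho> \<theta> U T \<longrightarrow>
        (\<forall>p \<in> hypersurface \<rho> \<inter> U. \<forall>\<alpha> \<beta>.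
           torsion \<Gamma> (Z \<alpha>) (Z \<beta>) p = 0 \<and>
           torsion \<Gamma> (Z \<alpha>) (bar Z \<beta>) p = cscale (\<i> * levi \<theta> p (Z \<alpha> p) (bar Z \<beta> p)) (T p) \<and>
           torsion \<Gamma> T (Z \<alpha>) p \<in> T01 \<rho> p))"


section \<open>The Chern-Moser-Weyl tensor and the one-form of Case and Gover\<close>

text \<open>All index arguments below range over the frame indices 1, 2; which of them are barred is
  determined by their position as in the formulas for \<open>h\<close>, \<open>R\<close>, \<open>S\<close>.\<close>

definition h_low :: "(complex^3 \<Rightarrow> complex^3) \<Rightarrow> (2 \<Rightarrow> complex^3 \<Rightarrow> cvec) \<Rightarrow> 2 \<Rightarrow> 2 \<Rightarrow> complex^3 \<Rightarrow> complex" where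
  "h_low \<theta> Z \<alpha> \<beta> p = levi \<theta> p (Z \<alpha> p) (bar Z \<beta> p)"

text \<open>The inverse is normalised by \<open>\<Sum>\<beta>. h\<^sub>\<gamma>\<^sub>\<beta> h\<^sup>\<alpha>\<^sup>\<beta> = \<delta>\<^sub>\<gamma>\<^sup>\<alpha>\<close> (the index \<open>\<beta>\<close> being barred), so
  \<open>h\<^sup>\<alpha>\<^sup>\<beta>\<close> is the \<open>(\<beta>, \<alpha>)\<close> entry of the inverse matrix.\<close>

definition h_up :: "(complex^3 \<Rightarrow> complex^3) \<Rightarrow> (2 \<Rightarrow> complex^3 \<Rightarrow> cvec) \<Rightarrow> 2 \<Rightarrow> 2 \<Rightarrow> complex^3 \<Rightarrow> complex" where
  "h_up \<theta> Z \<alpha> \<beta> p = matrix_inv (\<chi> \<mu> \<nu>. h_low \<theta> Z \<mu> \<nu> p) $ \<beta> $ \<alpha>"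

definition Rm :: "(complex^3 \<Rightarrow> complex^3) \<Rightarrow> (complex^3 \<Rightarrow> cvec \<Rightarrow> cvec \<Rightarrow> cvec) \<Rightarrow>
    (2 \<Rightarrow> complex^3 \<Rightarrow> cvec) \<Rightarrow> 2 \<Rightarrow> 2 \<Rightarrow> 2 \<Rightarrow> 2 \<Rightarrow> complex^3 \<Rightarrow> complex" where
  "Rm \<theta> \<Gamma> Z \<alpha> \<beta> \<gamma> \<sigma> p = levi \<theta> p (curvature \<Gamma> (Z \<alpha>) (bar Z \<beta>) (Z \<gamma>) p) (bar Z \<sigma> p)"

definition Ric :: "(complex^3 \<Rightarrow> complex^3) \<Rightarrow> (complex^3 \<Rightarrow> cvec \<Rightarrow> cvec \<Rightarrow> cvec) \<Rightarrow>
    (2 \<Rightarrow> complex^3 \<Rightarrow> cvec) \<Rightarrow> 2 \<Rightarrow> 2 \<Rightarrow> complex^3 \<Rightarrow> complex" where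
  "Ric \<theta> \<Gamma> Z \<gamma> \<sigma> p = (\<Sum>\<alpha>\<in>UNIV. \<Sum>\<beta>\<in>UNIV. h_up \<theta> Z \<alpha> \<beta> p * Rm \<theta> \<Gamma> Z \<alpha> \<beta> \<gamma> \<sigma> p)"

definition Scal :: "(complex^3 \<Rightarrow> complex^3) \<Rightarrow> (complex^3 \<Rightarrow> cvec \<Rightarrow> cvec \<Rightarrow> cvec) \<Rightarrow>
    (2 \<Rightarrow> complex^3 \<Rightarrow> cvec) \<Rightarrow> complex^3 \<Rightarrow> complex" where
  "Scal \<theta> \<Gamma> Z p = (\<Sum>\<gamma>\<in>UNIV. \<Sum>\<sigma>\<in>UNIV. h_up \<theta> Z \<gamma> \<sigma> p * Ric \<theta> \<Gamma> Z \<gamma> \<sigma> p)"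

text \<open>The denominators are \<open>n + 2\<close> and \<open>(n + 1) (n + 2)\<close> for \<open>n = 2\<close>.\<close>

definition S_low :: "(complex^3 \<Rightarrow> complex^3) \<Rightarrow> (complex^3 \<Rightarrow> cvec \<Rightarrow> cvec \<Rightarrow> cvec) \<Rightarrow>
    (2 \<Rightarrow> complex^3 \<Rightarrow> cvec) \<Rightarrow> 2 \<Rightarrow> 2 \<Rightarrow> 2 \<Rightarrow> 2 \<Rightarrow> complex^3 \<Rightarrow> complex" where
  "S_low \<theta> \<Gamma> Z \<alpha> \<beta> \<gamma> \<sigma> p = Rm \<theta> \<Gamma> Z \<alpha> \<beta> \<gamma> \<sigma> p
     - (Ric \<theta> \<Gamma> Z \<alpha> \<beta> p * h_low \<theta> Z \<gamma> \<sigma> p + Ric \<theta> \<Gamma> Z \<gamma> \<beta> p * h_low \<theta> Z \<alpha> \<sigma> p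
        + Ric \<theta> \<Gamma> Z \<alpha> \<sigma> p * h_low \<theta> Z \<gamma> \<beta> p + Ric \<theta> \<Gamma> Z \<gamma> \<sigma> p * h_low \<theta> Z \<alpha> \<beta> p) / 4
     + Scal \<theta> \<Gamma> Z p * (h_low \<theta> Z \<alpha> \<beta> p * h_low \<theta> Z \<gamma> \<sigma> p
        + h_low \<theta> Z \<alpha> \<sigma> p * h_low \<theta> Z \<gamma> \<beta> p) / 12"

text \<open>\<open>|S|\<^sup>2 = S\<^sub>\<epsilon>\<^sub>\<beta>\<^sub>\<gamma>\<^sub>\<sigma> S\<^sup>\<epsilon>\<^sup>\<beta>\<^sup>\<gamma>\<^sup>\<sigma>\<close> with the second factor obtained by raising the
  indices of \<open>S\<^sub>\<mu>\<^sub>\<nu>\<^sub>\<kappa>\<^sub>\<eta>\<close> (\<open>\<beta>, \<sigma>, \<nu>, \<eta>\<close> are barred).\<close>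

definition S_norm2 :: "(complex^3 \<Rightarrow> complex^3) \<Rightarrow> (complex^3 \<Rightarrow> cvec \<Rightarrow> cvec \<Rightarrow> cvec) \<Rightarrow>
    (2 \<Rightarrow> complex^3 \<Rightarrow> cvec) \<Rightarrow> complex^3 \<Rightarrow> complex" where
  "S_norm2 \<theta> \<Gamma> Z p =
     (\<Sum>\<epsilon>\<in>UNIV. \<Sum>\<beta>\<in>UNIV. \<Sum>\<gamma>\<in>UNIV. \<Sum>\<sigma>\<in>UNIV. \<Sum>\<mu>\<in>UNIV. \<Sum>\<nu>\<in>UNIV. \<Sum>\<kappa>\<in>UNIV. \<Sum>\<eta>\<in>UNIV.
        S_low \<theta> \<Gamma> Z \<epsilon> \<beta> \<gamma> \<sigma> p * h_up \<theta> Z \<epsilon> \<nu> p * h_up \<theta> Z \<mu> \<beta> p * h_up \<theta> Z \<gamma> \<eta> p *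
        h_up \<theta> Z \<kappa> \<sigma> p * S_low \<theta> \<Gamma> Z \<mu> \<nu> \<kappa> \<eta> p)"

text \<open>Connection coefficients: \<open>\<nabla>\<^sub>\<kappa> Z\<^sub>\<mu> = \<Sum>\<tau>. conn \<kappa> \<mu> \<tau> Z\<^sub>\<tau>\<close>, and \<open>\<nabla>\<^sub>\<kappa>\<close> applied to the conjugate
  of \<open>Z\<^sub>\<nu>\<close> is \<open>\<Sum>\<tau>. conn_bar \<kappa> \<nu> \<tau>\<close> times the conjugate of \<open>Z\<^sub>\<tau>\<close>.\<close>

definition conn :: "(complex^3 \<Rightarrow> complex^3) \<Rightarrow> (complex^3 \<Rightarrow> cvec \<Rightarrow> cvec \<Rightarrow> cvec) \<Rightarrow>
    (2 \<Rightarrow> complex^3 \<Rightarrow> cvec) \<Rightarrow> 2 \<Rightarrow> 2 \<Rightarrow> 2 \<Rightarrow> complex^3 \<Rightarrow> complex" where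
  "conn \<theta> \<Gamma> Z \<kappa> \<mu> \<tau> p =
     (\<Sum>\<sigma>\<in>UNIV. h_up \<theta> Z \<tau> \<sigma> p * levi \<theta> p (cov \<Gamma> (Z \<kappa>) (Z \<mu>) p) (bar Z \<sigma> p))"

definition conn_bar :: "(complex^3 \<Rightarrow> complex^3) \<Rightarrow> (complex^3 \<Rightarrow> cvec \<Rightarrow> cvec \<Rightarrow> cvec) \<Rightarrow>
    (2 \<Rightarrow> complex^3 \<Rightarrow> cvec) \<Rightarrow> 2 \<Rightarrow> 2 \<Rightarrow> 2 \<Rightarrow> complex^3 \<Rightarrow> complex" where
  "conn_bar \<theta> \<Gamma> Z \<kappa> \<nu> \<tau> p =
     (\<Sum>\<sigma>\<in>UNIV. h_up \<theta> Z \<sigma> \<tau> p * levi \<theta> p (Z \<sigma> p) (cov \<Gamma> (Z \<kappa>) (bar Z \<nu>) p))"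

text \<open>\<open>\<nabla>\<^sub>\<kappa> S\<^sub>\<mu>\<^sub>\<nu>\<^sub>\<eta>\<^sub>\<epsilon>\<close>, with \<open>\<nu>\<close> and \<open>\<epsilon>\<close> barred.\<close>

definition nabla_S :: "(complex^3 \<Rightarrow> complex^3) \<Rightarrow> (complex^3 \<Rightarrow> cvec \<Rightarrow> cvec \<Rightarrow> cvec) \<Rightarrow>
    (2 \<Rightarrow> complex^3 \<Rightarrow> cvec) \<Rightarrow> 2 \<Rightarrow> 2 \<Rightarrow> 2 \<Rightarrow> 2 \<Rightarrow> 2 \<Rightarrow> complex^3 \<Rightarrow> complex" where
  "nabla_S \<theta> \<Gamma> Z \<kappa> \<mu> \<nu> \<eta> \<epsilon> p = dir (Z \<kappa> p) (S_low \<theta> \<Gamma> Z \<mu> \<nu> \<eta> \<epsilon>) p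
     - (\<Sum>\<tau>\<in>UNIV. conn \<theta> \<Gamma> Z \<kappa> \<mu> \<tau> p * S_low \<theta> \<Gamma> Z \<tau> \<nu> \<eta> \<epsilon> p
          + conn_bar \<theta> \<Gamma> Z \<kappa> \<nu> \<tau> p * S_low \<theta> \<Gamma> Z \<mu> \<tau> \<eta> \<epsilon> p
          + conn \<theta> \<Gamma> Z \<kappa> \<eta> \<tau> p * S_low \<theta> \<Gamma> Z \<mu> \<nu> \<tau> \<epsilon> p
          + conn_bar \<theta> \<Gamma> Z \<kappa> \<epsilon> \<tau> p * S_low \<theta> \<Gamma> Z \<mu> \<nu> \<eta> \<tau> p)"

definition X_form :: "(complex^3 \<Rightarrow> complex^3) \<Rightarrow> (complex^3 \<Rightarrow> cvec \<Rightarrow> cvec \<Rightarrow> cvec) \<Rightarrow>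
    (2 \<Rightarrow> complex^3 \<Rightarrow> cvec) \<Rightarrow> 2 \<Rightarrow> complex^3 \<Rightarrow> complex" where
  "X_form \<theta> \<Gamma> Z \<alpha> p =
     1/2 * (\<Sum>\<beta>\<in>UNIV. \<Sum>\<gamma>\<in>UNIV. \<Sum>\<sigma>\<in>UNIV. \<Sum>\<mu>\<in>UNIV. \<Sum>\<nu>\<in>UNIV. \<Sum>\<eta>\<in>UNIV. \<Sum>\<kappa>\<in>UNIV. \<Sum>\<epsilon>\<in>UNIV.
        S_low \<theta> \<Gamma> Z \<alpha> \<beta> \<gamma> \<sigma> p * h_up \<theta> Z \<mu> \<beta> p * h_up \<theta> Z \<gamma> \<nu> p * h_up \<theta> Z \<eta> \<sigma> p *
        h_up \<theta> Z \<kappa> \<epsilon> p * nabla_S \<theta> \<Gamma> Z \<kappa> \<mu> \<nu> \<eta> \<epsilon> p)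
     + 1/4 * dir (Z \<alpha> p) (S_norm2 \<theta> \<Gamma> Z) p"


section \<open>Ellipsoids of revolution\<close>

definition ellipsoid_fun :: "real \<Rightarrow> complex^3 \<Rightarrow> real" where
  "ellipsoid_fun a p =
     (cmod (p $ 1))\<^sup>2 + (cmod (p $ 2))\<^sup>2 + (cmod (p $ 3))\<^sup>2 + Re (of_real a * (p $ 3)\<^sup>2) - 1"

end

theory Submission
  imports Defs
begin

text \<open>Where \<open>z\<^sub>1 \<noteq> 0\<close>, the ellipsoid is \<open>|z\<^sub>1|\<^sup>2 = q\<close> with
  \<open>q = 1 - |z\<^sub>2|\<^sup>2 - |w|\<^sup>2 - Re (a w\<^sup>2)\<close>, and in the coordinate \<open>log z\<^sub>1\<close> it is a rigid hypersurface over
  the \<open>(w, z\<^sub>2)\<close>-plane. Put \<open>\<psi> = - log q\<close>, let the index 1 stand for \<open>w\<close> and 2 for \<open>z\<^sub>2\<close>, and write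
  bars for conjugates. The fields \<open>Z\<^sub>\<alpha> = \<partial>\<^sub>\<alpha> - \<psi>\<^sub>\<alpha> z\<^sub>1 \<partial>/\<partial>z\<^sub>1\<close> frame the (1,0)-bundle, commute with each
  other and with the rotation field \<open>T\<^sub>0 = \<i> z\<^sub>1 \<partial>/\<partial>z\<^sub>1 + conjugate\<close>, and satisfy
  \<open>[Z\<^sub>\<alpha>, bar Z\<^sub>\<beta>] = - \<i> P\<^sub>\<alpha>\<^sub>\<beta> T\<^sub>0\<close>, where \<open>P\<close> is the complex Hessian of \<open>\<psi>\<close>. An arbitrary pseudohermitian
  structure \<open>\<theta>\<close> is described by the single real function \<open>\<lambda> = \<theta> T\<^sub>0\<close>: its Levi form is \<open>\<lambda> P\<close>. Torsion,
  parallelism of \<open>d\<theta>\<close> and the brackets above determine the Tanaka-Webster connection through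
  \<open>\<psi>\<close> and \<open>\<lambda>\<close>.

  The (2,0)-derivatives of the potential are \<open>\<psi>\<^sub>\<alpha>\<^sub>\<gamma> = \<psi>\<^sub>\<alpha> \<psi>\<^sub>\<gamma> + (a/q) \<xi>\<^sub>\<alpha> \<xi>\<^sub>\<gamma>\<close> with \<open>\<xi>\<^sub>\<alpha> = dw Z\<^sub>\<alpha>\<close>. For
  \<open>a = 0\<close> the second term is absent and \<open>\<psi>\<close> is the potential of the complex hyperbolic metric. In
  general this term is the only source of curvature that is not a symmetrised product with
  \<open>P\<close> (\<open>Rm_eq\<close>): modulo such products the curvature is \<open>- \<lambda> \<kappa> \<xi>\<^sub>\<alpha> \<xi>\<^sub>\<beta> \<xi>\<^sub>\<gamma> \<xi>\<^sub>\<sigma>\<close> with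
  \<open>\<kappa> = a\<^sup>2 / (q g)\<close>, \<open>g = q + |\<partial>q|\<^sup>2\<close>. The Chern-Moser-Weyl tensor is therefore the trace-free part of
  this fourth power, and it sees \<open>\<theta>\<close> only through the factor \<open>\<lambda>\<close> (\<open>S_low_eq\<close>).

  At points with \<open>z\<^sub>2 = 0\<close> the Levi form is diagonal in the frame and the one-form can be evaluated
  (\<open>X_form_slice\<close>):
  \<open>X\<^sub>1 = - (3/8) \<kappa>\<^sup>2 |dw|\<^sup>8 \<lambda>\<^sup>-\<^sup>2 (r/q + a (cnj r)/g)\<close> with \<open>r = cnj w + a w\<close>. The derivatives of \<open>\<lambda>\<close> have
  cancelled, which is the CR invariance of \<open>X\<close> at such a point, so that the vanishing of this number
  does not depend on \<open>\<theta>\<close>. For \<open>w = 1/(1+|a|)\<close> if \<open>a > 0\<close> and \<open>w = \<i>/(1+|a|)\<close> if \<open>a < 0\<close> the last factor is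
  \<open>r (1/q + |a|/(q+1))\<close> with \<open>|r| = 1\<close> and \<open>q = |a|/(1+|a|)\<close>, and \<open>q\<close> is positive because
  \<open>a \<noteq> 0\<close> (\<open>ellipsoid_point\<close>).

  Functions and fields live on open sets of the ambient space, but most identities
  between them hold on the hypersurface only. They may be differentiated in tangential directions by
  \<open>dir_cong_on_ellipsoid\<close>, which rests on a retraction onto the ellipsoid.\<close>

section \<open>Smooth functions on open sets\<close>

lemma Ck_on_SucD: "Ck_on (Suc k) U f \<Longrightarrow> Ck_on k U f"
proof (induction k arbitrary: f)
  case 0
  then show ?case
    by (auto intro!: continuous_at_imp_continuous_on differentiable_imp_continuous_within)
next
  case (Suc k)
  from Suc.prems have "\<forall>p\<in>U. f differentiable (at p)" "\<forall>v. Ck_on (Suc k) U (\<lambda>p. frechet_derivative f (at p) v)"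
    using Ck_on.simps(2)[of "Suc k" U f] by blast+
  with Suc.IH show ?case using Ck_on.simps(2)[of k U f] by blast
qed

lemma Ck_on_cong:
  assumes "open U" "\<And>p. p \<in> U \<Longrightarrow> f p = g p" "Ck_on k U f"
  shows "Ck_on k U g"
  using assms(2,3)
proof (induction k arbitrary: f g)
  case 0
  then show ?case using continuous_on_cong[of U U f g] by simp
next
  case (Suc k)
  have d: "f differentiable (at p)" if "p \<in> U" for p
    using Suc.prems(2) that by simp
  have gd: "g differentiable (at p)" if "p \<in> U" for p
    using d[OF that] assms(1) that Suc.prems(1)
    by (metis frechet_derivative_works has_derivative_transform_within_open differentiable_def)
  have "frechet_derivative f (at p) = frechet_derivative g (at p)" if "p \<in> U" for p
    using frechet_derivative_transform_within_open[OF d[OF that] assms(1) that] Suc.prems(1) by blast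
  then have "Ck_on k U (\<lambda>p. frechet_derivative g (at p) v)" for v
    using Suc.IH[of "\<lambda>p. frechet_derivative f (at p) v" "\<lambda>p. frechet_derivative g (at p) v"] Suc.prems(2)
    by simp
  with gd show ?case by simp
qed

text \<open>With a derivative known in closed form, smoothness becomes smoothness of that formula; all
  closure properties below are proved by induction on the order through this rule.\<close>
lemma Ck_on_SucI:
  assumes "open U" "\<And>p. p \<in> U \<Longrightarrow> (f has_derivative F p) (at p)"
    and "\<And>v. Ck_on k U (\<lambda>p. F p v)"
  shows "Ck_on (Suc k) U f"
proof -
  have "frechet_derivative f (at p) = F p" if "p \<in> U" for p
    using frechet_derivative_at[OF assms(2)[OF that]] by simp
  then have "Ck_on k U (\<lambda>p. frechet_derivative f (at p) v)" for v
    using Ck_on_cong[OF assms(1) _ assms(3)[of v]] by simp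
  moreover have "\<forall>p\<in>U. f differentiable (at p)"
    using assms(2) by (auto simp: differentiable_def)
  ultimately show ?thesis by simp
qed

lemma Ck_on_Suc_has_derivative:
  "Ck_on (Suc k) U f \<Longrightarrow> p \<in> U \<Longrightarrow> (f has_derivative frechet_derivative f (at p)) (at p)"
  using frechet_derivative_works by auto

lemma Ck_on_const: "open U \<Longrightarrow> Ck_on k U (\<lambda>p. c)"
  by (induction k arbitrary: c) (auto intro!: Ck_on_SucI[where F = "\<lambda>_ _. 0"])

lemma Ck_on_ident: "open U \<Longrightarrow> Ck_on k U (\<lambda>p. p)"
  by (cases k) (auto intro!: Ck_on_SucI[where F = "\<lambda>_ v. v"] Ck_on_const simp del: Ck_on.simps(2))

lemma Ck_on_bounded_linear:
  assumes "open U" "bounded_linear L"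
  shows "Ck_on k U f \<Longrightarrow> Ck_on k U (\<lambda>p. L (f p))"
proof (induction k arbitrary: f)
  case 0
  then show ?case using assms(2) by (simp add: bounded_linear.continuous_on)
next
  case (Suc k)
  show ?case
    by (rule Ck_on_SucI[OF assms(1) bounded_linear.has_derivative[OF assms(2)
            Ck_on_Suc_has_derivative[OF Suc.prems]]], assumption)
       (use Suc in simp)
qed

lemma Ck_on_add:
  assumes "open U"
  shows "Ck_on k U f \<Longrightarrow> Ck_on k U g \<Longrightarrow> Ck_on k U (\<lambda>p. f p + g p)"
proof (induction k arbitrary: f g)
  case 0
  then show ?case by (simp add: continuous_on_add)
next
  case (Suc k)
  show ?case
    by (rule Ck_on_SucI[OF assms has_derivative_add[OF
            Ck_on_Suc_has_derivative[OF Suc.prems(1)] Ck_on_Suc_has_derivative[OF Suc.prems(2)]]],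
        assumption, assumption) (use Suc in simp)
qed

lemma Ck_on_bilinear:
  assumes "open U" "bounded_bilinear B"
  shows "Ck_on k U f \<Longrightarrow> Ck_on k U g \<Longrightarrow> Ck_on k U (\<lambda>p. B (f p) (g p))"
proof (induction k arbitrary: f g)
  case 0
  then show ?case using assms(2) by (simp add: bounded_bilinear.continuous_on)
next
  case (Suc k)
  show ?case
    by (rule Ck_on_SucI[OF assms(1) bounded_bilinear.FDERIV[OF assms(2)
            Ck_on_Suc_has_derivative[OF Suc.prems(1)] Ck_on_Suc_has_derivative[OF Suc.prems(2)]]],
        assumption, assumption)
       (use Suc.IH Suc.prems Ck_on_SucD[OF Suc.prems(1)] Ck_on_SucD[OF Suc.prems(2)]
        in \<open>simp add: Ck_on_add[OF assms(1)]\<close>)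
qed

lemma Ck_on_inverse:
  fixes f :: "'a::real_normed_vector \<Rightarrow> complex"
  assumes "open U" "\<And>p. p \<in> U \<Longrightarrow> f p \<noteq> 0"
  shows "Ck_on k U f \<Longrightarrow> Ck_on k U (\<lambda>p. inverse (f p))"
proof (induction k)
  case 0
  then show ?case using assms(2) by (simp add: continuous_on_inverse)
next
  case (Suc k)
  have inv: "Ck_on k U (\<lambda>p. inverse (f p))"
    using Suc.IH Ck_on_SucD[OF Suc.prems] by blast
  have "Ck_on k U (\<lambda>p. - (inverse (f p) * frechet_derivative f (at p) v * inverse (f p)))" for v
    using Suc.prems
    by (intro Ck_on_bounded_linear[OF assms(1) bounded_linear_minus[OF bounded_linear_ident]]
        Ck_on_bilinear[OF assms(1) bounded_bilinear_mult] inv) simp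
  then show ?case
    using Deriv.has_derivative_inverse[OF assms(2) Ck_on_Suc_has_derivative[OF Suc.prems]]
    by (intro Ck_on_SucI[OF assms(1)]) auto
qed

lemma smooth_on_imp_differentiable: "smooth_on U f \<Longrightarrow> p \<in> U \<Longrightarrow> f differentiable (at p)"
  unfolding smooth_on_def using Ck_on.simps(2)[of 0 U f] by blast

lemma smooth_on_cong: "open U \<Longrightarrow> (\<And>p. p \<in> U \<Longrightarrow> f p = g p) \<Longrightarrow> smooth_on U f \<Longrightarrow> smooth_on U g"
  unfolding smooth_on_def using Ck_on_cong by blast

lemma smooth_on_subset: "smooth_on U f \<Longrightarrow> V \<subseteq> U \<Longrightarrow> smooth_on V f"
proof -
  have "Ck_on k U f \<Longrightarrow> V \<subseteq> U \<Longrightarrow> Ck_on k V f" for k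
    by (induction k arbitrary: f) (auto intro: continuous_on_subset)
  then show "smooth_on U f \<Longrightarrow> V \<subseteq> U \<Longrightarrow> smooth_on V f"
    unfolding smooth_on_def by blast
qed

named_theorems smooth_intros

lemma smooth_on_const [smooth_intros]: "open U \<Longrightarrow> smooth_on U (\<lambda>p. c)"
  by (simp add: smooth_on_def Ck_on_const)

lemma smooth_on_ident: "open U \<Longrightarrow> smooth_on U (\<lambda>p. p)"
  by (simp add: smooth_on_def Ck_on_ident)

lemma smooth_on_bounded_linear:
  "bounded_linear L \<Longrightarrow> open U \<Longrightarrow> smooth_on U f \<Longrightarrow> smooth_on U (\<lambda>p. L (f p))"
  by (simp add: smooth_on_def Ck_on_bounded_linear)

lemma smooth_on_bilinear:
  "bounded_bilinear B \<Longrightarrow> open U \<Longrightarrow> smooth_on U f \<Longrightarrow> smooth_on U g \<Longrightarrow> smooth_on U (\<lambda>p. B (f p) (g p))"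
  by (simp add: smooth_on_def Ck_on_bilinear)

lemma smooth_on_add [smooth_intros]:
  "open U \<Longrightarrow> smooth_on U f \<Longrightarrow> smooth_on U g \<Longrightarrow> smooth_on U (\<lambda>p. f p + g p)"
  by (simp add: smooth_on_def Ck_on_add)

lemma smooth_on_mult [smooth_intros]:
  fixes f g :: "'a::real_normed_vector \<Rightarrow> complex"
  shows "open U \<Longrightarrow> smooth_on U f \<Longrightarrow> smooth_on U g \<Longrightarrow> smooth_on U (\<lambda>p. f p * g p)"
  by (rule smooth_on_bilinear[OF bounded_bilinear_mult])

lemma smooth_on_uminus [smooth_intros]:
  "open U \<Longrightarrow> smooth_on U f \<Longrightarrow> smooth_on U (\<lambda>p. - f p)"
  by (rule smooth_on_bounded_linear[OF bounded_linear_minus[OF bounded_linear_ident]])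

lemma smooth_on_diff [smooth_intros]:
  "open U \<Longrightarrow> smooth_on U f \<Longrightarrow> smooth_on U g \<Longrightarrow> smooth_on U (\<lambda>p. f p - g p)"
  using smooth_on_add[OF _ _ smooth_on_uminus, of U f g] by simp

lemma smooth_on_inverse [smooth_intros]:
  fixes f :: "'a::real_normed_vector \<Rightarrow> complex"
  shows "open U \<Longrightarrow> smooth_on U f \<Longrightarrow> (\<And>p. p \<in> U \<Longrightarrow> f p \<noteq> 0) \<Longrightarrow> smooth_on U (\<lambda>p. inverse (f p))"
  by (simp add: smooth_on_def Ck_on_inverse)

lemma smooth_on_divide [smooth_intros]:
  fixes f g :: "'a::real_normed_vector \<Rightarrow> complex"
  shows "open U \<Longrightarrow> smooth_on U f \<Longrightarrow> smooth_on U g \<Longrightarrow> (\<And>p. p \<in> U \<Longrightarrow> g p \<noteq> 0) \<Longrightarrow>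
    smooth_on U (\<lambda>p. f p / g p)"
  unfolding divide_inverse by (intro smooth_intros)

lemma smooth_on_cnj [smooth_intros]:
  "open U \<Longrightarrow> smooth_on U f \<Longrightarrow> smooth_on U (\<lambda>p. cnj (f p))"
  by (rule smooth_on_bounded_linear[OF bounded_linear_cnj])

lemma smooth_on_nth [smooth_intros]:
  "open U \<Longrightarrow> smooth_on U f \<Longrightarrow> smooth_on U (\<lambda>p. f p $ j)"
  by (rule smooth_on_bounded_linear[OF bounded_linear_vec_nth])

lemma smooth_on_coordinate [smooth_intros]: "open U \<Longrightarrow> smooth_on U (\<lambda>p. p $ j)"
  by (intro smooth_on_nth smooth_on_ident)

lemma smooth_on_fst [smooth_intros]: "open U \<Longrightarrow> smooth_on U f \<Longrightarrow> smooth_on U (\<lambda>p. fst (f p))"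
  by (rule smooth_on_bounded_linear[OF bounded_linear_fst])

lemma smooth_on_snd [smooth_intros]: "open U \<Longrightarrow> smooth_on U f \<Longrightarrow> smooth_on U (\<lambda>p. snd (f p))"
  by (rule smooth_on_bounded_linear[OF bounded_linear_snd])

lemma smooth_on_sum [smooth_intros]:
  assumes "open U" shows "(\<And>i. i \<in> I \<Longrightarrow> smooth_on U (f i)) \<Longrightarrow> smooth_on U (\<lambda>p. \<Sum>i\<in>I. f i p)"
  by (induction I rule: infinite_finite_induct) (use assms in \<open>auto intro!: smooth_intros\<close>)

lemma smooth_on_Pair [smooth_intros]:
  assumes "open U" "smooth_on U f" "smooth_on U g"
  shows "smooth_on U (\<lambda>p. (f p, g p))"
proof -
  have "smooth_on U (\<lambda>p. (f p, 0) + (0, g p))"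
    using assms
    by (intro smooth_on_add smooth_on_bounded_linear[of "\<lambda>x. (x, 0)"]
        smooth_on_bounded_linear[of "\<lambda>x. (0, x)"] bounded_linear_Pair bounded_linear_ident bounded_linear_zero)
  then show ?thesis by simp
qed

lemma smooth_on_vec_lambda [smooth_intros]:
  fixes f :: "'n::finite \<Rightarrow> 'a::real_normed_vector \<Rightarrow> complex"
  assumes "open U" "\<And>j. smooth_on U (f j)"
  shows "smooth_on U (\<lambda>p. \<chi> j. f j p)"
proof -
  have "bounded_linear (\<lambda>x::complex. axis j x :: complex^'n)" for j
    by (rule linear_conv_bounded_linear[THEN iffD1], rule linearI) (auto simp: axis_def vec_eq_iff)
  then have "smooth_on U (\<lambda>p. \<Sum>j\<in>UNIV. axis j (f j p))"
    using assms by (intro smooth_on_sum smooth_on_bounded_linear[of "axis _"]) auto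
  moreover have "(\<Sum>j\<in>UNIV. axis j (f j p)) = (\<chi> j. f j p)" for p
    by (simp add: vec_eq_iff axis_def if_distrib sum.delta cong: if_cong)
  ultimately show ?thesis by simp
qed

lemma smooth_on_frechet_derivative [smooth_intros]:
  "smooth_on U f \<Longrightarrow> smooth_on U (\<lambda>p. frechet_derivative f (at p) v)"
  unfolding smooth_on_def using Ck_on.simps(2) by blast

lemma smooth_on_cscale [smooth_intros]:
  assumes "open U" "smooth_on U c" "smooth_on U X"
  shows "smooth_on U (\<lambda>p. cscale (c p) (X p))"
  unfolding cscale_def vector_scalar_mult_def using assms by (intro smooth_intros)

lemma smooth_on_cconj [smooth_intros]:
  assumes "open U" "smooth_on U X"
  shows "smooth_on U (\<lambda>p. cconj (X p))"
  unfolding cconj_def using assms by (intro smooth_intros)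

lemma smooth_on_dir [smooth_intros]:
  assumes "open U" "smooth_on U X" "smooth_on U f"
  shows "smooth_on U (\<lambda>p. dir (X p) f p)"
  unfolding dir_def wirtinger_def wirtinger_bar_def using assms by (intro smooth_intros) auto

lemma smooth_on_dir_field [smooth_intros]:
  assumes "open U" "smooth_on U X" "smooth_on U Y"
  shows "smooth_on U (\<lambda>p. dir_field (X p) Y p)"
  unfolding dir_field_def using assms by (intro smooth_intros)

section \<open>Differentiation along complexified vectors\<close>

text \<open>The complex-linear extension of a real-linear map \<open>F\<close> to complexified vectors; for the derivative
  of \<open>f\<close> it is \<open>dir\<close> (\<open>dir_eq_complexified\<close>).\<close>
definition complexified :: "cvec \<Rightarrow> (complex^3 \<Rightarrow> complex) \<Rightarrow> complex" where
  "complexified X F = (\<Sum>j\<in>UNIV. fst X $ j * ((F (axis j 1) - \<i> * F (axis j \<i>)) / 2) +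
     snd X $ j * ((F (axis j 1) + \<i> * F (axis j \<i>)) / 2))"

text \<open>A complexified vector is \<open>A + \<i> B\<close> for unique real vectors \<open>A\<close> and \<open>B\<close>; \<open>re_vec\<close> and \<open>im_vec\<close> are their
  (1,0)-components, that is, \<open>A\<close> and \<open>B\<close> as vectors of the real space \<open>complex^3\<close>.\<close>
definition re_vec :: "cvec \<Rightarrow> complex^3" where
  "re_vec X = (\<chi> j. (fst X $ j + cnj (snd X $ j)) / 2)"

definition im_vec :: "cvec \<Rightarrow> complex^3" where
  "im_vec X = (\<chi> j. (fst X $ j - cnj (snd X $ j)) / (2 * \<i>))"

lemma dir_eq_complexified:
  "(f has_derivative F) (at p) \<Longrightarrow> dir X f p = complexified X F"
  using frechet_derivative_at[of f F p]
  by (simp add: dir_def complexified_def wirtinger_def wirtinger_bar_def)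

lemma complexified_add: "complexified X (\<lambda>v. F v + G v) = complexified X F + complexified X G"
  unfolding complexified_def sum.distrib[symmetric]
  by (rule sum.cong) (simp_all add: algebra_simps add_divide_distrib diff_divide_distrib)

lemma complexified_mult_left: "complexified X (\<lambda>v. c * F v) = c * complexified X F"
  unfolding complexified_def sum_distrib_left
  by (rule sum.cong) (simp_all add: algebra_simps add_divide_distrib diff_divide_distrib)

lemma linear_on_vec3:
  fixes F :: "complex^3 \<Rightarrow> complex"
  assumes "linear F"
  shows "F v = (\<Sum>j\<in>UNIV. of_real (Re (v $ j)) * F (axis j 1) + of_real (Im (v $ j)) * F (axis j \<i>))"
proof -
  have v: "v = (\<Sum>j\<in>UNIV. Re (v $ j) *\<^sub>R axis j 1 + Im (v $ j) *\<^sub>R axis j \<i>)"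
    by (auto simp: vec_eq_iff axis_def sum_3 forall_3 complex_eq_iff)
  have "F v = (\<Sum>j\<in>UNIV. F (Re (v $ j) *\<^sub>R axis j 1 + Im (v $ j) *\<^sub>R axis j \<i>))"
    by (subst v) (simp add: linear_sum[OF assms])
  also have "\<dots> = (\<Sum>j\<in>UNIV. of_real (Re (v $ j)) * F (axis j 1) + of_real (Im (v $ j)) * F (axis j \<i>))"
    by (simp only: linear_add[OF assms] linear_scale[OF assms]) (simp add: scaleR_conv_of_real)
  finally show ?thesis .
qed

lemma complexified_real:
  assumes "linear F"
  shows "complexified X F = F (re_vec X) + \<i> * F (im_vec X)"
proof -
  have 1: "a * ((A - \<i> * B) / 2) + b * ((A + \<i> * B) / 2) =
      of_real (Re ((a + cnj b) / 2)) * A + of_real (Im ((a + cnj b) / 2)) * B +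
      \<i> * (of_real (Re ((a - cnj b) / (2 * \<i>))) * A + of_real (Im ((a - cnj b) / (2 * \<i>))) * B)"
    for a b A B :: complex
  proof -
    have i: "(a - cnj b) / (2 * \<i>) = - \<i> * (a - cnj b) / 2"
      by (simp add: field_simps)
    have A: "of_real (Re ((a + cnj b) / 2)) + \<i> * of_real (Re ((a - cnj b) / (2 * \<i>))) = (a + b) / 2"
      unfolding i by (simp add: complex_eq_iff field_simps)
    have B: "of_real (Im ((a + cnj b) / 2)) + \<i> * of_real (Im ((a - cnj b) / (2 * \<i>))) = \<i> * (b - a) / 2"
      unfolding i by (simp add: complex_eq_iff field_simps)
    have "a * ((A - \<i> * B) / 2) + b * ((A + \<i> * B) / 2) = (a + b) / 2 * A + \<i> * (b - a) / 2 * B"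
      by (simp add: algebra_simps add_divide_distrib diff_divide_distrib)
    then show ?thesis unfolding A[symmetric] B[symmetric] by (simp add: algebra_simps)
  qed
  show ?thesis
    unfolding linear_on_vec3[OF assms, of "re_vec X"] linear_on_vec3[OF assms, of "im_vec X"] complexified_def
    by (simp only: sum_distrib_left sum.distrib[symmetric] 1 re_vec_def im_vec_def vec_lambda_beta)
qed

text \<open>Differentiability is bundled with the value so that a rational expression can be differentiated
  by resolution with the rules \<open>dir_intros\<close> alone.\<close>
definition has_dir :: "cvec \<Rightarrow> complex^3 \<Rightarrow> (complex^3 \<Rightarrow> complex) \<Rightarrow> complex \<Rightarrow> bool" where
  "has_dir X p f d \<longleftrightarrow> f differentiable (at p) \<and> dir X f p = d"

lemma has_dirI: "(f has_derivative F) (at p) \<Longrightarrow> complexified X F = d \<Longrightarrow> has_dir X p f d"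
  by (auto simp: has_dir_def dir_eq_complexified differentiable_def)

lemma has_dirE:
  assumes "has_dir X p f d"
  obtains F where "(f has_derivative F) (at p)" "complexified X F = d"
  using assms unfolding has_dir_def differentiable_def by (metis dir_eq_complexified)

lemma has_dir_dir: "f differentiable (at p) \<Longrightarrow> has_dir X p f (dir X f p)"
  by (simp add: has_dir_def)

lemma has_dir_eq: "has_dir X p f d \<Longrightarrow> d = e \<Longrightarrow> has_dir X p f e"
  by simp

named_theorems dir_intros

lemma has_dir_const [dir_intros]: "has_dir X p (\<lambda>z. c) 0"
  by (rule has_dirI[OF has_derivative_const]) (simp add: complexified_def)

lemma has_dir_coordinate [dir_intros]: "has_dir X p (\<lambda>z. z $ j) (fst X $ j)"
proof (rule has_dirI)
  show "((\<lambda>z. z $ j) has_derivative (\<lambda>v. v $ j)) (at p)"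
    by (rule bounded_linear_imp_has_derivative) (rule bounded_linear_vec_nth)
  show "complexified X (\<lambda>v. v $ j) = fst X $ j"
    using exhaust_3[of j] by (auto simp: complexified_def axis_def sum_3)
qed

lemma has_dir_add [dir_intros]:
  assumes "has_dir X p f d" "has_dir X p g e" shows "has_dir X p (\<lambda>z. f z + g z) (d + e)"
proof -
  obtain F G where F: "(f has_derivative F) (at p)" "complexified X F = d"
    and G: "(g has_derivative G) (at p)" "complexified X G = e"
    using assms by (metis has_dirE)
  show ?thesis
    by (rule has_dirI[OF has_derivative_add[OF F(1) G(1)]])
       (simp add: complexified_add F(2) G(2))
qed

lemma has_dir_mult [dir_intros]:
  assumes "has_dir X p f d" "has_dir X p g e" shows "has_dir X p (\<lambda>z. f z * g z) (f p * e + d * g p)"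
proof -
  obtain F G where F: "(f has_derivative F) (at p)" "complexified X F = d"
    and G: "(g has_derivative G) (at p)" "complexified X G = e"
    using assms by (metis has_dirE)
  show ?thesis
    by (rule has_dirI[OF has_derivative_mult[OF F(1) G(1)]])
       (simp add: complexified_add complexified_mult_left F(2) G(2) mult.commute[of _ "g p"])
qed

lemma has_dir_uminus [dir_intros]:
  assumes "has_dir X p f d" shows "has_dir X p (\<lambda>z. - f z) (- d)"
  using has_dir_mult[OF has_dir_const[of X p "-1"] assms] by simp

lemma has_dir_diff [dir_intros]:
  assumes "has_dir X p f d" "has_dir X p g e" shows "has_dir X p (\<lambda>z. f z - g z) (d - e)"
  using has_dir_add[OF assms(1) has_dir_uminus[OF assms(2)]] by simp

lemma has_dir_inverse [dir_intros]:
  assumes "has_dir X p f d" "f p \<noteq> 0"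
  shows "has_dir X p (\<lambda>z. inverse (f z)) (- d / (f p)\<^sup>2)"
proof -
  obtain F where F: "(f has_derivative F) (at p)" "complexified X F = d"
    using assms by (metis has_dirE)
  show ?thesis
    using complexified_mult_left[of X "- (inverse (f p))\<^sup>2" F] Deriv.has_derivative_inverse[OF assms(2) F(1)]
    by (intro has_dirI) (auto simp: F(2) power2_eq_square field_simps)
qed

lemma has_dir_divide [dir_intros]:
  assumes "has_dir X p f d" "has_dir X p g e" "g p \<noteq> 0"
  shows "has_dir X p (\<lambda>z. f z / g z) ((d * g p - f p * e) / (g p)\<^sup>2)"
  unfolding divide_inverse[of "f _" "g _"]
  by (rule has_dir_eq[OF has_dir_mult[OF assms(1) has_dir_inverse[OF assms(2) assms(3)]]])
     (use assms(3) in \<open>simp add: power2_eq_square field_simps\<close>)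

lemma has_dir_power2 [dir_intros]:
  assumes "has_dir X p f d" shows "has_dir X p (\<lambda>z. (f z)\<^sup>2) (2 * f p * d)"
  unfolding power2_eq_square by (rule has_dir_eq[OF has_dir_mult[OF assms assms]]) simp

text \<open>\<open>dir X\<close> is complex linear in \<open>X\<close> but not compatible with conjugation: a conjugated function is
  differentiated along the conjugate vector.\<close>
lemma has_dir_cnj [dir_intros]:
  assumes "has_dir (cconj X) p f d" shows "has_dir X p (\<lambda>z. cnj (f z)) (cnj d)"
proof -
  obtain F where F: "(f has_derivative F) (at p)" "complexified (cconj X) F = d"
    using assms by (metis has_dirE)
  show ?thesis
    by (rule has_dirI[OF bounded_linear.has_derivative[OF bounded_linear_cnj F(1)]])
       (simp add: complexified_def cconj_def add_ac flip: F(2))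
qed

lemma has_dir_sum [dir_intros]:
  assumes "\<And>i. i \<in> I \<Longrightarrow> has_dir X p (f i) (d i)"
  shows "has_dir X p (\<lambda>z. \<Sum>i\<in>I. f i z) (\<Sum>i\<in>I. d i)"
  using assms
  by (induction I rule: infinite_finite_induct) (simp_all add: has_dir_const has_dir_add)

lemma has_dir_cong:
  assumes "open U" "p \<in> U" "\<And>z. z \<in> U \<Longrightarrow> f z = g z" "has_dir X p f d"
  shows "has_dir X p g d"
proof -
  obtain F where F: "(f has_derivative F) (at p)" "complexified X F = d"
    using assms(4) by (metis has_dirE)
  show ?thesis
    by (rule has_dirI[OF has_derivative_transform_within_open[OF F(1) assms(1,2,3)] F(2)])
qed

lemma dir_cnj: "f differentiable (at p) \<Longrightarrow> dir X (\<lambda>z. cnj (f z)) p = cnj (dir (cconj X) f p)"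
  using has_dir_cnj[OF has_dir_dir[of f p "cconj X"]] by (simp add: has_dir_def)

lemma cconj_cconj [simp]: "cconj (cconj X) = X"
  by (simp add: cconj_def vec_eq_iff prod_eq_iff)

lemma cconj_sum: "cconj (\<Sum>i\<in>I. X i) = (\<Sum>i\<in>I. cconj (X i))"
proof -
  have 0: "cconj 0 = 0" by (simp add: cconj_def vec_eq_iff prod_eq_iff)
  have "cconj (X + Y) = cconj X + cconj Y" for X Y
    by (simp add: cconj_def vec_eq_iff prod_eq_iff)
  with 0 show ?thesis by (induction I rule: infinite_finite_induct) auto
qed

lemma cconj_add: "cconj (X + Y) = cconj X + cconj Y"
  by (simp add: cconj_def vec_eq_iff prod_eq_iff)

lemma cconj_cscale: "cconj (cscale c X) = cscale (cnj c) (cconj X)"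
  by (simp add: cconj_def cscale_def vec_eq_iff prod_eq_iff)

lemma cscale_simps [simp]:
  "fst (cscale c X) $ j = c * fst X $ j" "snd (cscale c X) $ j = c * snd X $ j"
  by (simp_all add: cscale_def)

lemma cconj_simps [simp]:
  "fst (cconj X) $ j = cnj (snd X $ j)" "snd (cconj X) $ j = cnj (fst X $ j)"
  by (simp_all add: cconj_def)

lemma dir_add_vec: "dir (X + Y) f p = dir X f p + dir Y f p"
  by (simp add: dir_def sum.distrib[symmetric] algebra_simps)

lemma dir_cscale_vec: "dir (cscale c X) f p = c * dir X f p"
  by (simp add: dir_def sum_distrib_left algebra_simps)

lemma dir_zero_vec [simp]: "dir 0 f p = 0"
  by (simp add: dir_def)

lemma dir_sum_vec: "dir (\<Sum>i\<in>I. X i) f p = (\<Sum>i\<in>I. dir (X i) f p)"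
  by (induction I rule: infinite_finite_induct) (auto simp: dir_add_vec)

lemma form_add: "form t (X + Y) = form t X + form t Y"
  by (simp add: form_def sum.distrib[symmetric] algebra_simps)

lemma form_cscale: "form t (cscale c X) = c * form t X"
  by (simp add: form_def sum_distrib_left algebra_simps)

lemma form_cconj: "form t (cconj X) = cnj (form t X)"
  by (simp add: form_def algebra_simps)

text \<open>Splits off the constant extension of \<open>Y p\<close> that is used in the definition of \<open>dform\<close>.\<close>
lemma has_dir_form:
  assumes "\<theta> differentiable (at p)" "Y differentiable (at p)"
  shows "has_dir V p (\<lambda>q. form (\<theta> q) (Y q)) (dir V (\<lambda>q. form (\<theta> q) (Y p)) p + form (\<theta> p) (dir_field V Y p))"
proof -
  have t: "(\<lambda>q. \<theta> q $ j) differentiable (at p)" for j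
    using assms(1) bounded_linear.has_derivative[OF bounded_linear_vec_nth] unfolding differentiable_def by blast
  have y1: "(\<lambda>q. fst (Y q) $ j) differentiable (at p)" and y2: "(\<lambda>q. snd (Y q) $ j) differentiable (at p)" for j
    using assms(2) bounded_linear.has_derivative[OF bounded_linear_compose[OF bounded_linear_vec_nth bounded_linear_fst]]
      bounded_linear.has_derivative[OF bounded_linear_compose[OF bounded_linear_vec_nth bounded_linear_snd]]
    unfolding differentiable_def by blast+
  have a: "has_dir V p (\<lambda>q. form (\<theta> q) (Y p)) (\<Sum>j\<in>UNIV. dir V (\<lambda>q. \<theta> q $ j) p * fst (Y p) $ j
      + cnj (dir (cconj V) (\<lambda>q. \<theta> q $ j) p) * snd (Y p) $ j)"
    unfolding form_def
    by (rule has_dir_eq, (rule dir_intros has_dir_dir t)+) simp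
  have b: "has_dir V p (\<lambda>q. form (\<theta> q) (Y q)) (\<Sum>j\<in>UNIV. (\<theta> p $ j * dir V (\<lambda>q. fst (Y q) $ j) p
      + dir V (\<lambda>q. \<theta> q $ j) p * fst (Y p) $ j) + (cnj (\<theta> p $ j) * dir V (\<lambda>q. snd (Y q) $ j) p
      + cnj (dir (cconj V) (\<lambda>q. \<theta> q $ j) p) * snd (Y p) $ j))"
    unfolding form_def
    by (rule dir_intros has_dir_dir t y1 y2)+
  have c: "dir V (\<lambda>q. form (\<theta> q) (Y p)) p = (\<Sum>j\<in>UNIV. dir V (\<lambda>q. \<theta> q $ j) p * fst (Y p) $ j
      + cnj (dir (cconj V) (\<lambda>q. \<theta> q $ j) p) * snd (Y p) $ j)"
    using a by (simp add: has_dir_def)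
  have d: "form (\<theta> p) (dir_field V Y p) =
      (\<Sum>j\<in>UNIV. \<theta> p $ j * dir V (\<lambda>q. fst (Y q) $ j) p + cnj (\<theta> p $ j) * dir V (\<lambda>q. snd (Y q) $ j) p)"
    by (simp add: form_def dir_field_def)
  show ?thesis
    unfolding c d sum.distrib[symmetric] by (rule has_dir_eq[OF b], rule sum.cong) simp_all
qed

text \<open>Cartan's formula: for constant fields the bracket vanishes, and the derivatives of varying fields
  add up to the bracket term.\<close>
lemma dform_fields:
  assumes "\<theta> differentiable (at p)" "X differentiable (at p)" "Y differentiable (at p)"
  shows "dform \<theta> p (X p) (Y p) = dir (X p) (\<lambda>q. form (\<theta> q) (Y q)) p
     - dir (Y p) (\<lambda>q. form (\<theta> q) (X q)) p - form (\<theta> p) (bracket X Y p)"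
proof -
  have m: "form t (V - W) = form t V - form t W" for t V W
    by (simp add: form_def sum_subtractf[symmetric] algebra_simps)
  show ?thesis
    using has_dir_form[OF assms(1) assms(3), of "X p"] has_dir_form[OF assms(1) assms(2), of "Y p"]
    by (simp add: has_dir_def dform_def bracket_def m)
qed

lemma form_differentiable:
  fixes \<theta> :: "complex^3 \<Rightarrow> complex^3"
  assumes "\<theta> differentiable (at p)" "Y differentiable (at p)"
  shows "(\<lambda>q. form (\<theta> q) (Y q)) differentiable (at p)"
  using has_dir_form[OF assms] by (simp add: has_dir_def)

lemma dform_antisym: "dform \<theta> p X Y = - dform \<theta> p Y X"
  by (simp add: dform_def)

lemma dform_add_left:
  assumes "\<theta> differentiable (at p)"
  shows "dform \<theta> p (X + X') Y = dform \<theta> p X Y + dform \<theta> p X' Y"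
proof -
  have "has_dir Y p (\<lambda>q. form (\<theta> q) X + form (\<theta> q) X') (dir Y (\<lambda>q. form (\<theta> q) X) p + dir Y (\<lambda>q. form (\<theta> q) X') p)"
    by (intro dir_intros has_dir_dir form_differentiable assms differentiable_const)
  then show ?thesis by (simp add: dform_def dir_add_vec form_add has_dir_def)
qed

lemma dform_cscale_left:
  assumes "\<theta> differentiable (at p)"
  shows "dform \<theta> p (cscale c X) Y = c * dform \<theta> p X Y"
proof -
  have "has_dir Y p (\<lambda>q. c * form (\<theta> q) X) (c * dir Y (\<lambda>q. form (\<theta> q) X) p + 0 * form (\<theta> p) X)"
    by (intro dir_intros has_dir_dir form_differentiable assms differentiable_const)
  then show ?thesis by (simp add: dform_def dir_cscale_vec form_cscale has_dir_def algebra_simps)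
qed

lemma dform_zero_left: "dform \<theta> p 0 Y = 0"
  using has_dir_const[of Y p 0] by (simp add: dform_def form_def has_dir_def)

lemma levi_add_left: "\<theta> differentiable (at p) \<Longrightarrow> levi \<theta> p (X + X') Y = levi \<theta> p X Y + levi \<theta> p X' Y"
  by (simp add: levi_def dform_add_left algebra_simps)

lemma levi_cscale_left: "\<theta> differentiable (at p) \<Longrightarrow> levi \<theta> p (cscale c X) Y = c * levi \<theta> p X Y"
  by (simp add: levi_def dform_cscale_left)

lemma levi_antisym: "levi \<theta> p X Y = - levi \<theta> p Y X"
  using dform_antisym[of \<theta> p X Y] by (simp add: levi_def)

lemma levi_add_right: "\<theta> differentiable (at p) \<Longrightarrow> levi \<theta> p Y (X + X') = levi \<theta> p Y X + levi \<theta> p Y X'"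
  using levi_antisym[of \<theta> p Y] by (simp add: levi_add_left)

lemma levi_cscale_right: "\<theta> differentiable (at p) \<Longrightarrow> levi \<theta> p Y (cscale c X) = c * levi \<theta> p Y X"
  using levi_antisym[of \<theta> p Y] by (simp add: levi_cscale_left)

lemma levi_zero_left: "levi \<theta> p 0 Y = 0"
  by (simp add: levi_def dform_zero_left)

lemma levi_sum_left:
  "\<theta> differentiable (at p) \<Longrightarrow> levi \<theta> p (\<Sum>i\<in>I. X i) Y = (\<Sum>i\<in>I. levi \<theta> p (X i) Y)"
  by (induction I rule: infinite_finite_induct) (auto simp: levi_add_left levi_zero_left)

lemma levi_sum_right:
  "\<theta> differentiable (at p) \<Longrightarrow> levi \<theta> p Y (\<Sum>i\<in>I. X i) = (\<Sum>i\<in>I. levi \<theta> p Y (X i))"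
  using levi_antisym[of \<theta> p Y] by (simp add: levi_sum_left sum_negf)

text \<open>The form \<open>d\<theta>\<close> is real; the sign comes from the factor \<open>- \<i>\<close> in the Levi form.\<close>
lemma levi_cconj:
  assumes "\<theta> differentiable (at p)"
  shows "levi \<theta> p (cconj X) (cconj Y) = - cnj (levi \<theta> p X Y)"
proof -
  have *: "dir (cconj A) (\<lambda>q. form (\<theta> q) (cconj B)) p = cnj (dir A (\<lambda>q. form (\<theta> q) B) p)" for A B
    using dir_cnj[OF form_differentiable[OF assms differentiable_const], of "cconj A" B] by (simp add: form_cconj)
  show ?thesis by (simp add: levi_def dform_def *)
qed

section \<open>The ellipsoid as a rigid hypersurface\<close>

definition delta :: "2 \<Rightarrow> 2 \<Rightarrow> complex" where
  "delta \<alpha> \<beta> = (if \<alpha> = \<beta> then 1 else 0)"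

text \<open>The components \<open>dw Z\<^sub>\<alpha>\<close> of the form \<open>dw\<close> in the frame defined below, in which the index 1 belongs to
  the coordinate \<open>w = z\<^sub>3\<close> and the index 2 to \<open>z\<^sub>2\<close>.\<close>
definition dw :: "2 \<Rightarrow> complex" where
  "dw \<alpha> = (if \<alpha> = 1 then 1 else 0)"

text \<open>The function \<open>q\<close>: its value is \<open>|z\<^sub>1|\<^sup>2\<close> at the points of the ellipsoid. It is complex valued, although
  real, because the derivatives \<open>dir\<close> act on complex functions.\<close>
definition rad2 :: "real \<Rightarrow> complex^3 \<Rightarrow> complex" where
  "rad2 a p = 1 - p $ 2 * cnj (p $ 2) - p $ 3 * cnj (p $ 3) - of_real a * ((p $ 3)\<^sup>2 + (cnj (p $ 3))\<^sup>2) / 2"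

text \<open>The derivative of the defining function, equivalently of \<open>- q\<close>, in the variable of index \<open>\<alpha>\<close>.\<close>
definition drho :: "real \<Rightarrow> 2 \<Rightarrow> complex^3 \<Rightarrow> complex" where
  "drho a \<alpha> p = (if \<alpha> = 1 then cnj (p $ 3) + of_real a * p $ 3 else cnj (p $ 2))"

text \<open>On the ellipsoid this is the square length of the complex gradient of the defining function, since
  \<open>|\<partial>\<^sub>1 \<rho>|\<^sup>2 = |z\<^sub>1|\<^sup>2 = q\<close> there.\<close>
definition drho_norm2 :: "real \<Rightarrow> complex^3 \<Rightarrow> complex" where
  "drho_norm2 a p = rad2 a p + (\<Sum>\<alpha>\<in>UNIV. drho a \<alpha> p * cnj (drho a \<alpha> p))"

text \<open>The first derivatives of the potential \<open>\<psi> = - log q\<close>.\<close>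
definition dpot :: "real \<Rightarrow> 2 \<Rightarrow> complex^3 \<Rightarrow> complex" where
  "dpot a \<alpha> p = drho a \<alpha> p / rad2 a p"

text \<open>The complex Hessian \<open>\<partial>\<^sub>\<alpha> (bar \<partial>)\<^sub>\<beta> \<psi>\<close>, which by \<open>\<partial>\<^sub>\<alpha> (bar \<partial>)\<^sub>\<beta> q = - \<delta>\<^sub>\<alpha>\<^sub>\<beta>\<close> is a rank one perturbation of a
  multiple of the identity; its inverse, with the index convention of \<open>h_up\<close>, is \<open>hess_inv\<close>.\<close>
definition hess :: "real \<Rightarrow> 2 \<Rightarrow> 2 \<Rightarrow> complex^3 \<Rightarrow> complex" where
  "hess a \<alpha> \<beta> p = delta \<alpha> \<beta> / rad2 a p + dpot a \<alpha> p * cnj (dpot a \<beta> p)"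

definition hess_inv :: "real \<Rightarrow> 2 \<Rightarrow> 2 \<Rightarrow> complex^3 \<Rightarrow> complex" where
  "hess_inv a \<alpha> \<beta> p = rad2 a p * (delta \<alpha> \<beta> - cnj (drho a \<alpha> p) * drho a \<beta> p / drho_norm2 a p)"

text \<open>The defect \<open>\<psi>\<^sub>\<alpha>\<^sub>\<gamma> - \<psi>\<^sub>\<alpha> \<psi>\<^sub>\<gamma>\<close>, which vanishes for the sphere and carries the whole Chern-Moser-Weyl
  tensor.\<close>
definition pot20 :: "real \<Rightarrow> 2 \<Rightarrow> 2 \<Rightarrow> complex^3 \<Rightarrow> complex" where
  "pot20 a \<alpha> \<gamma> p = of_real a * dw \<alpha> * dw \<gamma> / rad2 a p"

text \<open>\<open>Z\<^sub>\<alpha> = \<partial>\<^sub>\<alpha> - \<psi>\<^sub>\<alpha> z\<^sub>1 \<partial>/\<partial>z\<^sub>1\<close>. Writing \<open>\<psi>\<^sub>\<alpha>\<close> in terms of \<open>q\<close> instead of \<open>|z\<^sub>1|\<^sup>2\<close> makes the coefficients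
  invariant under rotations of \<open>z\<^sub>1\<close>, and the bracket relations hold off the ellipsoid as well.\<close>
definition frame :: "real \<Rightarrow> 2 \<Rightarrow> complex^3 \<Rightarrow> cvec" where
  "frame a \<alpha> p = ((\<chi> j. if j = 1 then - dpot a \<alpha> p * p $ 1 else if j = 3 then dw \<alpha> else 1 - dw \<alpha>), 0)"

text \<open>The real field \<open>\<i> z\<^sub>1 \<partial>/\<partial>z\<^sub>1 - \<i> (cnj z\<^sub>1) \<partial>/\<partial>(cnj z\<^sub>1)\<close> generating the rotations of \<open>z\<^sub>1\<close>.\<close>
definition rot :: "complex^3 \<Rightarrow> cvec" where
  "rot p = ((\<chi> j. if j = 1 then \<i> * p $ 1 else 0), (\<chi> j. if j = 1 then - \<i> * cnj (p $ 1) else 0))"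

lemma dw_simps [simp]: "dw 1 = 1" "dw 2 = 0"
  by (simp_all add: dw_def)

lemma delta_simps [simp]: "delta \<alpha> \<alpha> = 1" "delta 1 2 = 0" "delta 2 1 = 0"
  by (simp_all add: delta_def)

lemma delta_sym: "delta \<alpha> \<beta> = delta \<beta> \<alpha>"
  by (simp add: delta_def)

lemma cnj_dw [simp]: "cnj (dw \<alpha>) = dw \<alpha>"
  by (simp add: dw_def)

lemma cnj_delta [simp]: "cnj (delta \<alpha> \<beta>) = delta \<alpha> \<beta>"
  by (simp add: delta_def)

lemma frame_simps [simp]:
  "fst (frame a \<alpha> p) $ 1 = - dpot a \<alpha> p * p $ 1" "fst (frame a \<alpha> p) $ 2 = 1 - dw \<alpha>"
  "fst (frame a \<alpha> p) $ 3 = dw \<alpha>" "snd (frame a \<alpha> p) = 0"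
  by (simp_all add: frame_def)

lemma rot_simps [simp]:
  "fst (rot p) $ 1 = \<i> * p $ 1" "fst (rot p) $ 2 = 0" "fst (rot p) $ 3 = 0"
  "snd (rot p) $ 1 = - \<i> * cnj (p $ 1)" "snd (rot p) $ 2 = 0" "snd (rot p) $ 3 = 0"
  by (simp_all add: rot_def)

lemma cconj_rot [simp]: "cconj (rot p) = rot p"
  by (simp add: prod_eq_iff vec_eq_iff forall_3)

lemma cnj_rad2 [simp]: "cnj (rad2 a p) = rad2 a p"
  by (simp add: rad2_def algebra_simps)

lemma cnj_drho_norm2 [simp]: "cnj (drho_norm2 a p) = drho_norm2 a p"
  by (simp add: drho_norm2_def sum_2 algebra_simps)

lemma cnj_hess: "cnj (hess a \<alpha> \<beta> p) = hess a \<beta> \<alpha> p"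
  by (simp add: hess_def delta_sym algebra_simps)

lemma cnj_pot20 [simp]: "cnj (pot20 a \<alpha> \<beta> p) = pot20 a \<alpha> \<beta> p"
  by (simp add: pot20_def)

lemma pot20_sym: "pot20 a \<alpha> \<beta> p = pot20 a \<beta> \<alpha> p"
  by (simp add: pot20_def)

lemma hess_hess_inv:
  assumes "rad2 a p \<noteq> 0" "drho_norm2 a p \<noteq> 0"
  shows "(\<Sum>\<beta>\<in>UNIV. hess a \<gamma> \<beta> p * hess_inv a \<alpha> \<beta> p) = delta \<gamma> \<alpha>"
proof -
  define q where "q = rad2 a p"
  define x where "x = drho a 1 p" define y where "y = drho a 2 p"
  have g: "drho_norm2 a p = q + x * cnj x + y * cnj y" by (simp add: drho_norm2_def q_def x_def y_def sum_2)
  have nz: "q \<noteq> 0" "q + x * cnj x + y * cnj y \<noteq> 0" using assms by (simp_all add: g q_def)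
  have "cnj q = q" by (simp add: q_def)
  then show ?thesis
    unfolding hess_def hess_inv_def dpot_def g q_def[symmetric] using nz exhaust_2[of \<alpha>] exhaust_2[of \<gamma>]
    by (auto simp: sum_2 g simp flip: q_def x_def y_def) (simp add: divide_simps, simp add: algebra_simps)+
qed

lemma hess_inv_hess:
  assumes "rad2 a p \<noteq> 0" "drho_norm2 a p \<noteq> 0"
  shows "(\<Sum>\<alpha>\<in>UNIV. hess_inv a \<alpha> \<beta> p * hess a \<alpha> \<gamma> p) = delta \<beta> \<gamma>"
proof -
  have "cnj (hess_inv a \<alpha> \<beta> p) = hess_inv a \<beta> \<alpha> p" for \<alpha> \<beta>
    by (simp add: hess_inv_def delta_sym algebra_simps)
  then have "(\<Sum>\<alpha>\<in>UNIV. hess_inv a \<alpha> \<beta> p * hess a \<alpha> \<gamma> p) = cnj (\<Sum>\<alpha>\<in>UNIV. hess a \<gamma> \<alpha> p * hess_inv a \<beta> \<alpha> p)"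
    by (simp add: cnj_hess mult.commute)
  then show ?thesis by (simp add: hess_hess_inv[OF assms] delta_sym)
qed

section \<open>Tangent vectors\<close>

lemma of_real_ellipsoid:
  "complex_of_real (ellipsoid_fun a p) = p $ 1 * cnj (p $ 1) - rad2 a p"
proof -
  have "complex_of_real (Re (of_real a * (p $ 3)\<^sup>2)) = of_real a * ((p $ 3)\<^sup>2 + (cnj (p $ 3))\<^sup>2) / 2"
    by (simp add: complex_eq_iff power2_eq_square field_simps)
  then show ?thesis
    by (simp add: ellipsoid_fun_def rad2_def complex_norm_square algebra_simps flip: of_real_power)
qed

lemma hypersurface_iff: "p \<in> hypersurface (ellipsoid_fun a) \<longleftrightarrow> p $ 1 * cnj (p $ 1) = rad2 a p"
  using of_real_ellipsoid[of a p] by (auto simp: hypersurface_def)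

lemma has_dir_rad2: "has_dir X p (rad2 a)
   (- (fst X $ 2 * drho a 2 p + snd X $ 2 * cnj (drho a 2 p)) - (fst X $ 3 * drho a 1 p + snd X $ 3 * cnj (drho a 1 p)))"
  unfolding rad2_def by (rule has_dir_eq, (rule dir_intros)+) (auto simp: drho_def field_simps)

lemma has_dir_ellipsoid: "has_dir X p (\<lambda>z. complex_of_real (ellipsoid_fun a z))
   (fst X $ 1 * cnj (p $ 1) + snd X $ 1 * p $ 1 + (fst X $ 2 * drho a 2 p + snd X $ 2 * cnj (drho a 2 p))
     + (fst X $ 3 * drho a 1 p + snd X $ 3 * cnj (drho a 1 p)))"
  unfolding of_real_ellipsoid
  by (rule has_dir_eq, (rule dir_intros has_dir_rad2)+) (auto simp: algebra_simps)

lemma CT_iff: "X \<in> CT (ellipsoid_fun a) p \<longleftrightarrow>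
   fst X $ 1 * cnj (p $ 1) + snd X $ 1 * p $ 1 + (fst X $ 2 * drho a 2 p + snd X $ 2 * cnj (drho a 2 p))
     + (fst X $ 3 * drho a 1 p + snd X $ 3 * cnj (drho a 1 p)) = 0"
  using has_dir_ellipsoid[of X p a] by (simp add: CT_def has_dir_def)

lemma CT_cconj: "X \<in> CT (ellipsoid_fun a) p \<Longrightarrow> cconj X \<in> CT (ellipsoid_fun a) p"
  unfolding CT_iff by (drule arg_cong[where f = cnj]) (simp add: algebra_simps)

lemma ellipsoid_has_derivative:
  obtains D where "(ellipsoid_fun a has_derivative D) (at p)"
    "\<And>X. X \<in> CT (ellipsoid_fun a) p \<Longrightarrow> D (re_vec X) = 0 \<and> D (im_vec X) = 0"
proof -
  obtain F where F: "((\<lambda>z. complex_of_real (ellipsoid_fun a z)) has_derivative F) (at p)"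
    using has_dir_ellipsoid[of 0 p a] by (auto simp: has_dir_def differentiable_def)
  have D: "(ellipsoid_fun a has_derivative (\<lambda>v. Re (F v))) (at p)"
    using bounded_linear.has_derivative[OF bounded_linear_Re F] by simp
  then have "((\<lambda>z. complex_of_real (ellipsoid_fun a z)) has_derivative (\<lambda>v. of_real (Re (F v)))) (at p)"
    by (rule bounded_linear.has_derivative[OF bounded_linear_of_real])
  then have c: "dir X (\<lambda>z. complex_of_real (ellipsoid_fun a z)) p =
      complexified X (\<lambda>v. of_real (Re (F v)))" for X
    by (rule dir_eq_complexified)
  have l: "linear (\<lambda>v. complex_of_real (Re (F v)))"
    using has_derivative_linear[OF D] by (simp add: linear_iff scaleR_conv_of_real)
  show ?thesis
  proof (rule that[OF D])
    fix X assume "X \<in> CT (ellipsoid_fun a) p"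
    then show "Re (F (re_vec X)) = 0 \<and> Re (F (im_vec X)) = 0"
      using c[of X] by (simp add: CT_def complexified_real[OF l] complex_eq_iff)
  qed
qed

text \<open>Derivatives in directions tangent to the hypersurface see only the values on it. Rescaling \<open>z\<^sub>1\<close> to the
  modulus prescribed by the other coordinates is a retraction \<open>\<pi>\<close> of a neighbourhood of \<open>p\<close>
  onto the ellipsoid whose derivative fixes the tangent vectors at \<open>p\<close>, so that \<open>f\<close> and
  \<open>f \<circ> \<pi>\<close> have the same tangential derivatives. Precomposing with a linear projection \<open>s\<close> that respects
  \<open>z\<^sub>1\<close> weakens the requirement further, to agreement on a slice of the ellipsoid.\<close>
lemma dir_cong_on_ellipsoid_slice:
  assumes X: "X \<in> CT (ellipsoid_fun a) p" and p: "p \<in> hypersurface (ellipsoid_fun a)" "p $ 1 \<noteq> 0"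
    and U: "open U" "p \<in> U"
    and f: "f differentiable (at p)" "g differentiable (at p)"
    and s: "bounded_linear s" "\<And>c. s (axis 1 c) = axis 1 c" "\<And>z. s (s z) = s z"
      "s p = p" "s (re_vec X) = re_vec X" "s (im_vec X) = im_vec X"
    and eq: "\<And>z. z \<in> hypersurface (ellipsoid_fun a) \<Longrightarrow> z \<in> U \<Longrightarrow> s z = z \<Longrightarrow> f z = g z"
  shows "dir X f p = dir X g p"
proof -
  define \<rho> where "\<rho> = ellipsoid_fun a"
  obtain D where D: "(\<rho> has_derivative D) (at p)" and DX: "D (re_vec X) = 0" "D (im_vec X) = 0"
    using ellipsoid_has_derivative[of a p] X unfolding \<rho>_def by metis
  have \<rho>p: "\<rho> p = 0" using p by (simp add: \<rho>_def hypersurface_def)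
  \<comment> \<open>the factor of the rescaling minus 1; as \<open>\<rho> = |z\<^sub>1|\<^sup>2 - q\<close>, the root is \<open>\<surd>q / |z\<^sub>1|\<close>\<close>
  define k where "k z = sqrt (1 - \<rho> z / (cmod (z $ 1))\<^sup>2) - 1" for z
  define \<pi> where "\<pi> z = s z + axis 1 (s z $ 1 * of_real (k (s z)))" for z
  have n: "((\<lambda>z. (cmod (z $ 1))\<^sup>2) has_derivative (\<lambda>v. 2 * (p $ 1 \<bullet> v $ 1))) (at p)"
  proof -
    have "((\<lambda>z::complex^3. z $ 1) has_derivative (\<lambda>v. v $ 1)) (at p)"
      by (rule bounded_linear_imp_has_derivative[OF bounded_linear_vec_nth])
    from has_derivative_inner[OF this this] show ?thesis
      by (simp add: power2_norm_eq_inner inner_commute algebra_simps)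
  qed
  have k0: "k p = 0" by (simp add: k_def \<rho>p)
  have r: "((\<lambda>z. 1 - \<rho> z / (cmod (z $ 1))\<^sup>2) has_derivative (\<lambda>v. - (D v / (cmod (p $ 1))\<^sup>2))) (at p)"
    using p(2)
    by (intro has_derivative_eq_rhs[OF has_derivative_diff[OF has_derivative_const has_derivative_divide'[OF D n]]])
       (auto simp: \<rho>p fun_eq_iff field_simps)
  have kd: "(k has_derivative (\<lambda>v. - (D v / (2 * (cmod (p $ 1))\<^sup>2)))) (at p)"
    unfolding k_def
    by (rule has_derivative_eq_rhs[OF has_derivative_diff[OF has_derivative_real_sqrt[OF _ r] has_derivative_const]])
       (simp_all add: \<rho>p fun_eq_iff)
  have sd: "(s has_derivative s) (at p)" by (rule bounded_linear_imp_has_derivative[OF s(1)])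
  have ksd: "((\<lambda>z. k (s z)) has_derivative (\<lambda>v. - (D (s v) / (2 * (cmod (p $ 1))\<^sup>2)))) (at p)"
    using has_derivative_compose[OF sd, of k] kd s(4) by simp
  have ax: "bounded_linear (\<lambda>x::complex. axis 1 x :: complex^3)"
    by (rule linear_conv_bounded_linear[THEN iffD1], rule linearI) (auto simp: axis_def vec_eq_iff)
  have m: "((\<lambda>z. s z $ 1 * of_real (k (s z))) has_derivative
      (\<lambda>v. p $ 1 * of_real (- (D (s v) / (2 * (cmod (p $ 1))\<^sup>2))))) (at p)"
    by (rule has_derivative_eq_rhs, rule has_derivative_mult,
        rule bounded_linear.has_derivative[OF bounded_linear_vec_nth sd],
        rule bounded_linear.has_derivative[OF bounded_linear_of_real ksd])
       (simp add: s(4) k0)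
  define \<pi>' where "\<pi>' v = s v + axis 1 (p $ 1 * of_real (- (D (s v) / (2 * (cmod (p $ 1))\<^sup>2))))" for v
  have \<pi>d: "(\<pi> has_derivative \<pi>') (at p)"
    unfolding \<pi>_def \<pi>'_def
    by (rule has_derivative_add[OF sd bounded_linear.has_derivative[OF ax m]])
  have \<pi>p: "\<pi> p = p" by (simp add: \<pi>_def s(4) k0 axis_def vec_eq_iff)
  have \<pi>X: "\<pi>' (re_vec X) = re_vec X" "\<pi>' (im_vec X) = im_vec X"
    by (simp_all add: \<pi>'_def s DX)
  have cont: "isCont \<pi> p" "isCont (\<lambda>z. \<rho> (s z) / (cmod (s z $ 1))\<^sup>2) p" "isCont (\<lambda>z. s z $ 1) p"
  proof -
    show "isCont \<pi> p" using \<pi>d has_derivative_continuous by blast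
    have 1: "isCont s p" using sd has_derivative_continuous by blast
    then show 2: "isCont (\<lambda>z. s z $ 1) p" by (intro continuous_intros)
    have "isCont \<rho> (s p)" using D has_derivative_continuous s(4) by metis
    then have "isCont (\<lambda>z. \<rho> (s z)) p" by (rule isCont_o2[OF 1])
    then show "isCont (\<lambda>z. \<rho> (s z) / (cmod (s z $ 1))\<^sup>2) p"
      by (rule isCont_divide[OF _ isCont_power[OF isCont_norm[OF 2]]]) (simp add: s(4) p(2))
  qed
  have ev: "\<forall>\<^sub>F z in nhds p. \<pi> z \<in> U" "\<forall>\<^sub>F z in nhds p. \<rho> (s z) / (cmod (s z $ 1))\<^sup>2 < 1"
    "\<forall>\<^sub>F z in nhds p. s z $ 1 \<noteq> 0"
  proof -
    have t: "(\<pi> \<longlongrightarrow> \<pi> p) (nhds p)"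
      using cont(1) by (simp add: isCont_def tendsto_at_iff_tendsto_nhds)
    show "\<forall>\<^sub>F z in nhds p. \<pi> z \<in> U"
      by (rule topological_tendstoD[OF t U(1)]) (simp add: \<pi>p U)
    show "\<forall>\<^sub>F z in nhds p. \<rho> (s z) / (cmod (s z $ 1))\<^sup>2 < 1"
      using order_tendstoD(2)[OF iffD1[OF tendsto_at_iff_tendsto_nhds[of "\<lambda>z. \<rho> (s z) / (cmod (s z $ 1))\<^sup>2" p]
            cont(2)[unfolded isCont_def]], of 1]
      by (simp add: s(4) \<rho>p)
    show "\<forall>\<^sub>F z in nhds p. s z $ 1 \<noteq> 0"
      using tendsto_imp_eventually_ne[OF iffD1[OF tendsto_at_iff_tendsto_nhds[of "\<lambda>z. s z $ 1" p]
            cont(3)[unfolded isCont_def]], of 0] p(2)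
      by (simp add: s(4))
  qed
  have on: "f (\<pi> z) = g (\<pi> z)"
    if z: "\<pi> z \<in> U" "\<rho> (s z) / (cmod (s z $ 1))\<^sup>2 < 1" "s z $ 1 \<noteq> 0" for z
  proof (rule eq[OF _ z(1)])
    define y where "y = s z"
    define c where "c = sqrt (1 - \<rho> y / (cmod (y $ 1))\<^sup>2)"
    have y: "\<pi> z $ 1 = y $ 1 * of_real c" "\<pi> z $ 2 = y $ 2" "\<pi> z $ 3 = y $ 3"
      by (simp_all add: \<pi>_def k_def y_def c_def axis_def algebra_simps)
    have c2: "of_real c * of_real c = (1 - \<rho> y / (y $ 1 * cnj (y $ 1)) :: complex)"
    proof -
      have "c * c = 1 - \<rho> y / (cmod (y $ 1))\<^sup>2"
        using z(2) by (simp add: c_def y_def)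
      then show ?thesis
        by (metis of_real_mult of_real_diff of_real_1 of_real_divide complex_norm_square)
    qed
    have "\<pi> z $ 1 * cnj (\<pi> z $ 1) = (y $ 1 * cnj (y $ 1)) * (of_real c * of_real c)"
      by (simp add: y)
    also have "\<dots> = y $ 1 * cnj (y $ 1) - \<rho> y"
      using z(3) unfolding c2 by (simp add: y_def field_simps)
    also have "\<dots> = rad2 a y"
      using of_real_ellipsoid[of a y] by (simp add: \<rho>_def)
    also have "\<dots> = rad2 a (\<pi> z)" by (simp add: rad2_def y)
    finally show "\<pi> z \<in> hypersurface (ellipsoid_fun a)" by (simp add: hypersurface_iff)
    show "s (\<pi> z) = \<pi> z"
      using bounded_linear.linear[OF s(1)] by (simp add: \<pi>_def linear_add s(2,3))
  qed
  obtain F G where F: "(f has_derivative F) (at p)" and G: "(g has_derivative G) (at p)"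
    using f by (auto simp: differentiable_def)
  have "((\<lambda>z. f (\<pi> z) - g (\<pi> z)) has_derivative (\<lambda>v. F (\<pi>' v) - G (\<pi>' v))) (at p)"
    using F G by (intro has_derivative_diff has_derivative_compose[OF \<pi>d]) (simp_all add: \<pi>p)
  moreover have ev0: "\<forall>\<^sub>F z in nhds p. f (\<pi> z) - g (\<pi> z) = 0"
    using ev by eventually_elim (simp add: on)
  have "((\<lambda>z. f (\<pi> z) - g (\<pi> z)) has_derivative (\<lambda>v. 0)) (at p)"
  proof -
    obtain V where V: "open V" "p \<in> V" "\<And>z. z \<in> V \<Longrightarrow> f (\<pi> z) - g (\<pi> z) = 0"
      using ev0 by (auto simp: eventually_nhds)
    show ?thesis
      by (rule has_derivative_transform_within_open[OF has_derivative_const[of 0] V(1,2)]) (simp add: V(3))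
  qed
  ultimately have "(\<lambda>v. F (\<pi>' v) - G (\<pi>' v)) = (\<lambda>v. 0)"
    by (rule has_derivative_unique)
  then have "F (re_vec X) = G (re_vec X)" "F (im_vec X) = G (im_vec X)"
    by (metis \<pi>X eq_iff_diff_eq_0)+
  then show ?thesis
    using complexified_real[OF has_derivative_linear[OF F]] complexified_real[OF has_derivative_linear[OF G]]
    by (simp add: dir_eq_complexified[OF F] dir_eq_complexified[OF G])
qed

lemma dir_cong_on_ellipsoid:
  assumes "X \<in> CT (ellipsoid_fun a) p" "p \<in> hypersurface (ellipsoid_fun a)" "p $ 1 \<noteq> 0"
    and "open U" "p \<in> U" "f differentiable (at p)" "g differentiable (at p)"
    and "\<And>z. z \<in> hypersurface (ellipsoid_fun a) \<inter> U \<Longrightarrow> f z = g z"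
  shows "dir X f p = dir X g p"
  by (rule dir_cong_on_ellipsoid_slice[where s = "\<lambda>z. z", OF assms(1-7)]) (simp_all add: assms(8))

section \<open>The rotation invariant frame\<close>

lemma has_dir_drho: "has_dir X p (drho a 1) (snd X $ 3 + of_real a * fst X $ 3)" "has_dir X p (drho a 2) (snd X $ 2)"
proof -
  have 1: "drho a 1 = (\<lambda>p. cnj (p $ 3) + of_real a * p $ 3)" and 2: "drho a 2 = (\<lambda>p. cnj (p $ 2))"
    by (simp_all add: drho_def fun_eq_iff)
  show "has_dir X p (drho a 1) (snd X $ 3 + of_real a * fst X $ 3)"
    unfolding 1 by (rule has_dir_eq, (rule dir_intros)+) simp
  show "has_dir X p (drho a 2) (snd X $ 2)"
    unfolding 2 by (rule has_dir_eq, (rule dir_intros)+) simp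
qed

lemma has_dir_frame_drho [dir_intros]: "has_dir (frame a \<gamma> p) p (drho b \<alpha>) (of_real b * dw \<alpha> * dw \<gamma>)"
  using has_dir_drho[of "frame a \<gamma> p" p b] exhaust_2[of \<alpha>] by auto

lemma has_dir_framebar_drho [dir_intros]: "has_dir (cconj (frame a \<gamma> p)) p (drho b \<alpha>) (delta \<alpha> \<gamma>)"
  using has_dir_drho[of "cconj (frame a \<gamma> p)" p b] exhaust_2[of \<alpha>] exhaust_2[of \<gamma>] by auto

lemma has_dir_rot_drho [dir_intros]: "has_dir (rot p) p (drho b \<alpha>) 0"
  using has_dir_drho[of "rot p" p b] exhaust_2[of \<alpha>] by auto

lemma has_dir_frame_rad2 [dir_intros]: "has_dir (frame a \<gamma> p) p (rad2 b) (- drho b \<gamma> p)"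
  by (rule has_dir_eq[OF has_dir_rad2]) (use exhaust_2[of \<gamma>] in auto)

lemma has_dir_framebar_rad2 [dir_intros]: "has_dir (cconj (frame a \<gamma> p)) p (rad2 b) (- cnj (drho b \<gamma> p))"
  by (rule has_dir_eq[OF has_dir_rad2]) (use exhaust_2[of \<gamma>] in auto)

lemma has_dir_rot_rad2 [dir_intros]: "has_dir (rot p) p (rad2 b) 0"
  by (rule has_dir_eq[OF has_dir_rad2]) simp

text \<open>This is where \<open>a\<close> enters: the (2,0)-derivatives of \<open>\<psi>\<close> are \<open>\<psi>\<^sub>\<alpha> \<psi>\<^sub>\<gamma>\<close> up to the defect \<open>pot20\<close>.\<close>
lemma has_dir_frame_dpot [dir_intros]:
  "rad2 b p \<noteq> 0 \<Longrightarrow> has_dir (frame a \<gamma> p) p (dpot b \<alpha>) (pot20 b \<alpha> \<gamma> p + dpot b \<alpha> p * dpot b \<gamma> p)"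
  unfolding dpot_def by (rule has_dir_eq, (rule dir_intros | assumption)+) (simp add: pot20_def power2_eq_square field_simps)

lemma has_dir_framebar_dpot [dir_intros]:
  "rad2 b p \<noteq> 0 \<Longrightarrow> has_dir (cconj (frame a \<gamma> p)) p (dpot b \<alpha>) (hess b \<alpha> \<gamma> p)"
  unfolding dpot_def hess_def by (rule has_dir_eq, (rule dir_intros | assumption)+) (simp add: power2_eq_square field_simps)

lemma has_dir_rot_dpot [dir_intros]: "rad2 b p \<noteq> 0 \<Longrightarrow> has_dir (rot p) p (dpot b \<alpha>) 0"
  unfolding dpot_def by (rule has_dir_eq, (rule dir_intros | assumption)+) simp

text \<open>Apart from the defect term this has the form that it takes for the complex hyperbolic metric.\<close>
lemma has_dir_frame_hess [dir_intros]:
  "rad2 b p \<noteq> 0 \<Longrightarrow> has_dir (frame a \<gamma> p) p (hess b \<alpha> \<beta>)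
     (dpot b \<gamma> p * hess b \<alpha> \<beta> p + dpot b \<alpha> p * hess b \<gamma> \<beta> p + pot20 b \<alpha> \<gamma> p * cnj (dpot b \<beta> p))"
  unfolding hess_def
  by (rule has_dir_eq, (rule dir_intros | assumption)+)
     (simp add: cnj_hess, simp add: hess_def dpot_def power2_eq_square field_simps)

lemma has_dir_framebar_hess [dir_intros]:
  "rad2 b p \<noteq> 0 \<Longrightarrow> has_dir (cconj (frame a \<gamma> p)) p (hess b \<alpha> \<beta>)
     (cnj (dpot b \<gamma> p) * hess b \<alpha> \<beta> p + cnj (dpot b \<beta> p) * hess b \<alpha> \<gamma> p + pot20 b \<beta> \<gamma> p * dpot b \<alpha> p)"
  unfolding hess_def
  by (rule has_dir_eq, (rule dir_intros | assumption | simp only: cconj_cconj)+)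
     (simp add: cnj_hess, simp add: hess_def dpot_def power2_eq_square field_simps)

lemma has_dir_rot_hess [dir_intros]: "rad2 b p \<noteq> 0 \<Longrightarrow> has_dir (rot p) p (hess b \<alpha> \<beta>) 0"
  unfolding hess_def
  by (rule has_dir_eq, (rule dir_intros | assumption | simp only: cconj_rot)+) simp

lemma has_dir_framebar_pot20 [dir_intros]:
  "rad2 b p \<noteq> 0 \<Longrightarrow> has_dir (cconj (frame a \<gamma> p)) p (pot20 b \<alpha> \<beta>) (pot20 b \<alpha> \<beta> p * cnj (dpot b \<gamma> p))"
  unfolding pot20_def dpot_def
  by (rule has_dir_eq, (rule dir_intros | assumption)+) (simp add: power2_eq_square field_simps)

lemma cvec_eqI:
  fixes X Y :: cvec
  assumes "fst X $ 1 = fst Y $ 1" "fst X $ 2 = fst Y $ 2" "fst X $ 3 = fst Y $ 3"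
    "snd X $ 1 = snd Y $ 1" "snd X $ 2 = snd Y $ 2" "snd X $ 3 = snd Y $ 3"
  shows "X = Y"
  using assms by (simp add: prod_eq_iff vec_eq_iff forall_3)

lemma i_times_i_times: "\<i> * (\<i> * x) = - x"
  by (simp flip: mult.assoc)

lemma dir_field_simps:
  "fst (dir_field X Y p) $ j = dir X (\<lambda>q. fst (Y q) $ j) p"
  "snd (dir_field X Y p) $ j = dir X (\<lambda>q. snd (Y q) $ j) p"
  by (simp_all add: dir_field_def)

lemma has_dir_imp_dir: "has_dir X p f d \<Longrightarrow> dir X f p = d"
  by (simp add: has_dir_def)

lemma dir_field_frame:
  assumes "has_dir X p (dpot a \<alpha>) d"
  shows "dir_field X (frame a \<alpha>) p = ((\<chi> j. if j = 1 then - (dpot a \<alpha> p * fst X $ 1 + d * p $ 1) else 0), 0)"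
proof -
  have "dir X (\<lambda>q. - dpot a \<alpha> q * q $ 1) p = - (dpot a \<alpha> p * fst X $ 1 + d * p $ 1)"
    by (rule has_dir_imp_dir, rule has_dir_eq, (rule dir_intros assms)+) simp
  then show ?thesis
    by (intro cvec_eqI) (simp_all add: dir_field_simps has_dir_imp_dir[OF has_dir_const])
qed

lemma dir_field_framebar:
  assumes "has_dir (cconj X) p (dpot a \<alpha>) d"
  shows "dir_field X (\<lambda>q. cconj (frame a \<alpha> q)) p = (0, (\<chi> j. if j = 1 then - (cnj (dpot a \<alpha> p) * snd X $ 1 + cnj d * cnj (p $ 1)) else 0))"
proof -
  have "dir X (\<lambda>q. cnj (- dpot a \<alpha> q * q $ 1)) p = - (cnj (dpot a \<alpha> p) * snd X $ 1 + cnj d * cnj (p $ 1))"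
    by (rule has_dir_imp_dir, rule has_dir_eq, (rule dir_intros assms)+) simp
  then show ?thesis
    by (intro cvec_eqI) (simp_all add: dir_field_simps has_dir_imp_dir[OF has_dir_const])
qed

lemma dir_field_rot:
  "dir_field X rot p = ((\<chi> j. if j = 1 then \<i> * fst X $ 1 else 0), (\<chi> j. if j = 1 then - \<i> * snd X $ 1 else 0))"
proof -
  have 1: "dir X (\<lambda>q. \<i> * q $ 1) p = \<i> * fst X $ 1"
    by (rule has_dir_imp_dir, rule has_dir_eq, (rule dir_intros)+) simp
  have 2: "dir X (\<lambda>q. - \<i> * cnj (q $ 1)) p = - \<i> * snd X $ 1"
    by (rule has_dir_imp_dir, rule has_dir_eq, (rule dir_intros)+) simp
  from 1 2 show ?thesis
    by (intro cvec_eqI) (simp_all add: dir_field_simps has_dir_imp_dir[OF has_dir_const])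
qed

text \<open>In \<open>[Z\<^sub>\<alpha>, bar Z\<^sub>\<beta>]\<close> only the coefficients of \<open>z\<^sub>1 \<partial>/\<partial>z\<^sub>1\<close> and of its conjugate get differentiated, and both
  derivatives are the mixed second derivative of the potential.\<close>
lemma bracket_frame_framebar:
  assumes "rad2 a p \<noteq> 0"
  shows "bracket (frame a \<alpha>) (bar (frame a) \<beta>) p = cscale (- \<i> * hess a \<alpha> \<beta> p) (rot p)"
proof -
  have "bar (frame a) \<beta> = (\<lambda>q. cconj (frame a \<beta> q))" by (simp add: bar_def fun_eq_iff)
  then show ?thesis
    using assms
    by (intro cvec_eqI) (simp_all add: bracket_def cnj_hess algebra_simps i_times_i_times
        dir_field_frame[OF has_dir_framebar_dpot] dir_field_framebar[OF has_dir_eq[OF has_dir_framebar_dpot]])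
qed

lemma bracket_frame_frame:
  assumes "rad2 a p \<noteq> 0"
  shows "bracket (frame a \<alpha>) (frame a \<beta>) p = 0"
  using assms
  by (intro cvec_eqI) (simp_all add: bracket_def dir_field_frame[OF has_dir_frame_dpot] pot20_sym algebra_simps)

lemma bracket_rot_frame:
  assumes "rad2 a p \<noteq> 0"
  shows "bracket rot (frame a \<alpha>) p = 0"
  using assms
  by (intro cvec_eqI) (simp_all add: bracket_def dir_field_frame[OF has_dir_rot_dpot] dir_field_rot algebra_simps)

lemma frame_in_T10:
  assumes "p \<in> hypersurface (ellipsoid_fun a)" "rad2 a p \<noteq> 0"
  shows "frame a \<alpha> p \<in> T10 (ellipsoid_fun a) p"
  using assms exhaust_2[of \<alpha>] unfolding T10_def
  by (auto simp: CT_iff hypersurface_iff dpot_def field_simps)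

lemma T10_expand:
  assumes "p \<in> hypersurface (ellipsoid_fun a)" "p $ 1 \<noteq> 0" "X \<in> T10 (ellipsoid_fun a) p"
  shows "X = (\<Sum>\<alpha>\<in>UNIV. cscale (if \<alpha> = 1 then fst X $ 3 else fst X $ 2) (frame a \<alpha> p))"
proof -
  have 1: "p $ 1 * cnj (p $ 1) = rad2 a p" "rad2 a p \<noteq> 0"
    using assms(1,2) by (simp_all add: hypersurface_iff) (metis complex_cnj_zero_iff mult_eq_0_iff)
  have s: "snd X = 0" and c: "fst X $ 1 * cnj (p $ 1) + fst X $ 2 * drho a 2 p + fst X $ 3 * drho a 1 p = 0"
    using assms(3) by (auto simp: T10_def CT_iff)
  have "fst X $ 1 * (p $ 1 * cnj (p $ 1)) = - (fst X $ 2 * drho a 2 p + fst X $ 3 * drho a 1 p) * p $ 1"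
    using c by algebra
  then have f: "fst X $ 1 = - (fst X $ 2 * dpot a 2 p + fst X $ 3 * dpot a 1 p) * p $ 1"
    using 1 by (simp add: dpot_def field_simps)
  show ?thesis
    by (rule cvec_eqI) (simp_all add: sum_2 s f algebra_simps)
qed

lemma CT_expand:
  assumes "p \<in> hypersurface (ellipsoid_fun a)" "p $ 1 \<noteq> 0" "X \<in> CT (ellipsoid_fun a) p"
  obtains c d e where "X = (\<Sum>\<alpha>\<in>UNIV. cscale (c \<alpha>) (frame a \<alpha> p)) + (\<Sum>\<alpha>\<in>UNIV. cscale (d \<alpha>) (bar (frame a) \<alpha> p)) + cscale e (rot p)"
proof -
  have 1: "p $ 1 * cnj (p $ 1) = rad2 a p" "rad2 a p \<noteq> 0"
    using assms(1,2) by (simp_all add: hypersurface_iff) (metis complex_cnj_zero_iff mult_eq_0_iff)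
  define c where "c \<alpha> = (if \<alpha> = 1 then fst X $ 3 else fst X $ 2)" for \<alpha> :: 2
  define d where "d \<alpha> = (if \<alpha> = 1 then snd X $ 3 else snd X $ 2)" for \<alpha> :: 2
  define e where "e = (fst X $ 1 + (c 1 * dpot a 1 p + c 2 * dpot a 2 p) * p $ 1) / (\<i> * p $ 1)"
  have e: "fst X $ 1 = - (c 1 * dpot a 1 p + c 2 * dpot a 2 p) * p $ 1 + e * (\<i> * p $ 1)"
  proof -
    have "e * (\<i> * p $ 1) = fst X $ 1 + (c 1 * dpot a 1 p + c 2 * dpot a 2 p) * p $ 1"
      using assms(2) by (simp add: e_def)
    then show ?thesis by (simp add: algebra_simps)
  qed
  have "fst X $ 1 * cnj (p $ 1) + snd X $ 1 * p $ 1 + (fst X $ 2 * drho a 2 p + snd X $ 2 * cnj (drho a 2 p))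
     + (fst X $ 3 * drho a 1 p + snd X $ 3 * cnj (drho a 1 p)) = 0"
    using assms(3) by (simp add: CT_iff)
  then have "(- (c 1 * dpot a 1 p + c 2 * dpot a 2 p) + e * \<i>) * (p $ 1 * cnj (p $ 1)) + snd X $ 1 * p $ 1
     + (c 2 * drho a 2 p + d 2 * cnj (drho a 2 p)) + (c 1 * drho a 1 p + d 1 * cnj (drho a 1 p)) = 0"
    unfolding e by (simp add: c_def d_def algebra_simps)
  then have "snd X $ 1 * p $ 1 = - e * \<i> * rad2 a p - (d 1 * cnj (drho a 1 p) + d 2 * cnj (drho a 2 p))"
    unfolding 1 using 1(2) by (simp add: dpot_def field_simps) algebra
  then have "snd X $ 1 * rad2 a p = (- e * \<i> * rad2 a p - (d 1 * cnj (drho a 1 p) + d 2 * cnj (drho a 2 p))) * cnj (p $ 1)"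
    unfolding 1(1)[symmetric] by algebra
  then have s: "snd X $ 1 = - (d 1 * cnj (dpot a 1 p) + d 2 * cnj (dpot a 2 p)) * cnj (p $ 1) - e * (\<i> * cnj (p $ 1))"
    using 1(2) by (simp add: dpot_def field_simps) algebra
  have "X = (\<Sum>\<alpha>\<in>UNIV. cscale (c \<alpha>) (frame a \<alpha> p)) + (\<Sum>\<alpha>\<in>UNIV. cscale (d \<alpha>) (bar (frame a) \<alpha> p)) + cscale e (rot p)"
    by (rule cvec_eqI) (simp_all add: sum_2 bar_def e s algebra_simps, simp_all add: c_def d_def)
  then show ?thesis by (rule that)
qed

lemma smooth_rad2 [smooth_intros]: "open U \<Longrightarrow> smooth_on U (rad2 a)"
  unfolding rad2_def power2_eq_square by (intro smooth_intros) auto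

lemma smooth_drho [smooth_intros]: "open U \<Longrightarrow> smooth_on U (drho a \<alpha>)"
  unfolding drho_def by (cases "\<alpha> = 1") (simp_all add: smooth_intros)

lemma smooth_drho_norm2 [smooth_intros]: "open U \<Longrightarrow> smooth_on U (drho_norm2 a)"
  unfolding drho_norm2_def by (intro smooth_intros)

lemma smooth_dpot [smooth_intros]: "open U \<Longrightarrow> (\<And>p. p \<in> U \<Longrightarrow> rad2 a p \<noteq> 0) \<Longrightarrow> smooth_on U (dpot a \<alpha>)"
  unfolding dpot_def by (intro smooth_intros)

lemma smooth_hess [smooth_intros]: "open U \<Longrightarrow> (\<And>p. p \<in> U \<Longrightarrow> rad2 a p \<noteq> 0) \<Longrightarrow> smooth_on U (hess a \<alpha> \<beta>)"
  unfolding hess_def by (intro smooth_intros)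

lemma smooth_hess_inv [smooth_intros]: "open U \<Longrightarrow> (\<And>p. p \<in> U \<Longrightarrow> drho_norm2 a p \<noteq> 0) \<Longrightarrow> smooth_on U (hess_inv a \<alpha> \<beta>)"
  unfolding hess_inv_def by (intro smooth_intros)

lemma smooth_pot20 [smooth_intros]: "open U \<Longrightarrow> (\<And>p. p \<in> U \<Longrightarrow> rad2 a p \<noteq> 0) \<Longrightarrow> smooth_on U (pot20 a \<alpha> \<beta>)"
  unfolding pot20_def by (intro smooth_intros)

lemma smooth_frame [smooth_intros]:
  assumes "open U" "\<And>p. p \<in> U \<Longrightarrow> rad2 a p \<noteq> 0" shows "smooth_on U (frame a \<alpha>)"
proof -
  have "smooth_on U (\<lambda>p. if j = (1::3) then - dpot a \<alpha> p * p $ 1 else if j = 3 then dw \<alpha> else 1 - dw \<alpha>)" for j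
    using assms by (cases "j = 1"; cases "j = 3") (auto intro!: smooth_intros)
  then show ?thesis unfolding frame_def using assms(1) by (intro smooth_intros)
qed

lemma smooth_rot [smooth_intros]:
  assumes "open U" shows "smooth_on U rot"
proof -
  have "smooth_on U (\<lambda>p. if j = (1::3) then \<i> * p $ 1 else 0)" "smooth_on U (\<lambda>p. if j = (1::3) then - \<i> * cnj (p $ 1) else 0)" for j
    using assms by (cases "j = 1"; auto intro!: smooth_intros)+
  then show ?thesis unfolding rot_def using assms(1) by (intro smooth_intros)
qed

lemma rot_in_CT: "rot p \<in> CT (ellipsoid_fun a) p"
  by (simp add: CT_iff)

section \<open>Pseudohermitian structures on the ellipsoid\<close>

lemma CT_add: "X \<in> CT \<rho> p \<Longrightarrow> Y \<in> CT \<rho> p \<Longrightarrow> X + Y \<in> CT \<rho> p"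
  by (simp add: CT_def dir_add_vec)

lemma CT_cscale: "X \<in> CT \<rho> p \<Longrightarrow> cscale c X \<in> CT \<rho> p"
  by (simp add: CT_def dir_cscale_vec)

lemma CT_sum: "(\<And>i. i \<in> I \<Longrightarrow> X i \<in> CT \<rho> p) \<Longrightarrow> (\<Sum>i\<in>I. X i) \<in> CT \<rho> p"
  by (simp add: CT_def dir_sum_vec)

lemma cnj_hess_inv: "cnj (hess_inv a \<alpha> \<beta> p) = hess_inv a \<beta> \<alpha> p"
  by (simp add: hess_inv_def delta_sym algebra_simps)

lemma bar_eq: "bar Z \<beta> = (\<lambda>q. cconj (Z \<beta> q))"
  by (simp add: bar_def fun_eq_iff)

lemma cscale_algebra:
  "cscale c (X + Y) = cscale c X + cscale c Y" "cscale (c + d) X = cscale c X + cscale d X"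
  "cscale c (cscale d X) = cscale (c * d) X" "cscale 1 X = X" "cscale 0 X = 0" "cscale c 0 = 0"
  "cscale (- c) X = - cscale c X"
  by (auto intro!: cvec_eqI simp: algebra_simps)

lemma cscale_sum: "cscale c (\<Sum>i\<in>I. X i) = (\<Sum>i\<in>I. cscale c (X i))"
  by (induction I rule: infinite_finite_induct) (auto simp: cscale_algebra)

lemma smooth_form [smooth_intros]:
  "open U \<Longrightarrow> smooth_on U t \<Longrightarrow> smooth_on U X \<Longrightarrow> smooth_on U (\<lambda>q. form (t q) (X q))"
  unfolding form_def by (intro smooth_intros)

lemma smooth_bracket [smooth_intros]:
  "open U \<Longrightarrow> smooth_on U X \<Longrightarrow> smooth_on U Y \<Longrightarrow> smooth_on U (bracket X Y)"
  unfolding bracket_def[abs_def] by (intro smooth_intros)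

text \<open>The definition freezes the vectors at the point; Cartan's formula replaces it by derivatives
  of smooth functions.\<close>
lemma smooth_levi [smooth_intros]:
  assumes "open U" "smooth_on U t" "smooth_on U X" "smooth_on U Y"
  shows "smooth_on U (\<lambda>q. levi t q (X q) (Y q))"
proof -
  have "smooth_on U (\<lambda>q. - \<i> * (dir (X q) (\<lambda>r. form (t r) (Y r)) q - dir (Y q) (\<lambda>r. form (t r) (X r)) q
      - form (t q) (bracket X Y q)))"
    using assms by (intro smooth_intros)
  moreover have "levi t q (X q) (Y q) = - \<i> * (dir (X q) (\<lambda>r. form (t r) (Y r)) q
      - dir (Y q) (\<lambda>r. form (t r) (X r)) q - form (t q) (bracket X Y q))" if "q \<in> U" for q
    unfolding levi_def using assms that
    by (subst dform_fields) (auto intro: smooth_on_imp_differentiable)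
  ultimately show ?thesis
    using smooth_on_cong[OF assms(1)] by (metis (no_types, lifting))
qed

text \<open>The connection term is smooth for constant arguments only, by hypothesis. Expanding the arguments in
  the six coordinate vectors reduces to that case; the sum type \<open>3 + 3\<close> indexes them.\<close>
lemma smooth_cov:
  assumes "open U" "smooth_on U X" "smooth_on U Y" "\<And>V W. smooth_on U (\<lambda>p. \<Gamma> p V W)"
    and "\<And>p. p \<in> U \<Longrightarrow> cbilinear (\<Gamma> p)"
  shows "smooth_on U (cov \<Gamma> X Y)"
proof -
  define e :: "3 + 3 \<Rightarrow> cvec" where "e = case_sum (\<lambda>j. (axis j 1, 0)) (\<lambda>j. (0, axis j 1))"
  define k :: "cvec \<Rightarrow> 3 + 3 \<Rightarrow> complex" where "k X = case_sum (\<lambda>j. fst X $ j) (\<lambda>j. snd X $ j)" for X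
  have ex: "X = (\<Sum>i\<in>UNIV. cscale (k X i) (e i))" for X
  proof -
    have "(\<Sum>i\<in>UNIV. cscale (k X i) (e i)) = (\<Sum>j\<in>UNIV. cscale (fst X $ j) (axis j 1, 0)) + (\<Sum>j\<in>UNIV. cscale (snd X $ j) (0, axis j 1))"
      by (subst UNIV_Plus_UNIV[symmetric], subst sum.Plus) (simp_all add: e_def k_def)
    also have "\<dots> = X"
      by (rule cvec_eqI) (simp_all add: sum_3 axis_def)
    finally show ?thesis by simp
  qed
  have k: "smooth_on U (\<lambda>p. k (X p) i)" if "smooth_on U X" for X i
    using that assms(1) by (cases i) (auto simp: k_def intro!: smooth_intros)
  have b: "B X Y = (\<Sum>i\<in>UNIV. \<Sum>j\<in>UNIV. cscale (k X i) (cscale (k Y j) (B (e i) (e j))))" if "cbilinear B" for B X Y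
  proof -
    have add: "B (X + X') Y = B X Y + B X' Y" "B X (Y + Y') = B X Y + B X Y'" for X X' Y Y'
      using that unfolding cbilinear_def by blast+
    have scale: "B (cscale c X) Y = cscale c (B X Y)" "B X (cscale c Y) = cscale c (B X Y)" for c X Y
      using that unfolding cbilinear_def by blast+
    have z: "B 0 W = 0" "B W 0 = 0" for W
    proof -
      have "B (0 + 0) W = B 0 W + B 0 W" "B W (0 + 0) = B W 0 + B W 0"
        by (rule add)+
      then show "B 0 W = 0" "B W 0 = 0" by simp_all
    qed
    have sl: "B (\<Sum>i\<in>I. f i) W = (\<Sum>i\<in>I. B (f i) W)" for I :: "(3+3) set" and f W
      by (induction I rule: infinite_finite_induct) (simp_all add: z add)
    have sr: "B W (\<Sum>i\<in>I. f i) = (\<Sum>i\<in>I. B W (f i))" for I :: "(3+3) set" and f W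
      by (induction I rule: infinite_finite_induct) (simp_all add: z add)
    have "B (e i) Y = B (e i) (\<Sum>j\<in>UNIV. cscale (k Y j) (e j))" for i
      by (rule arg_cong[OF ex])
    also have "\<dots> i = (\<Sum>j\<in>UNIV. B (e i) (cscale (k Y j) (e j)))" for i
      by (rule sr)
    also have "\<dots> i = (\<Sum>j\<in>UNIV. cscale (k Y j) (B (e i) (e j)))" for i
      by (rule sum.cong[OF refl scale(2)])
    finally have 1: "B (e i) Y = (\<Sum>j\<in>UNIV. cscale (k Y j) (B (e i) (e j)))" for i .
    have "B X Y = B (\<Sum>i\<in>UNIV. cscale (k X i) (e i)) Y"
      by (rule arg_cong[OF ex])
    also have "\<dots> = (\<Sum>i\<in>UNIV. B (cscale (k X i) (e i)) Y)"
      by (rule sl)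
    also have "\<dots> = (\<Sum>i\<in>UNIV. cscale (k X i) (B (e i) Y))"
      by (rule sum.cong[OF refl scale(1)])
    also have "\<dots> = (\<Sum>i\<in>UNIV. \<Sum>j\<in>UNIV. cscale (k X i) (cscale (k Y j) (B (e i) (e j))))"
      by (rule sum.cong[OF refl]) (subst 1, rule cscale_sum)
    finally show ?thesis .
  qed
  have "smooth_on U (\<lambda>p. dir_field (X p) Y p +
      (\<Sum>i\<in>UNIV. \<Sum>j\<in>UNIV. cscale (k (X p) i) (cscale (k (Y p) j) (\<Gamma> p (e i) (e j)))))"
    using assms k by (intro smooth_intros)
  moreover have "cov \<Gamma> X Y p = dir_field (X p) Y p +
      (\<Sum>i\<in>UNIV. \<Sum>j\<in>UNIV. cscale (k (X p) i) (cscale (k (Y p) j) (\<Gamma> p (e i) (e j))))" if "p \<in> U" for p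
    unfolding cov_def b[OF assms(5)[OF that], of "X p" "Y p"] by (rule refl)
  ultimately show ?thesis
    using smooth_on_cong[OF assms(1)] by (metis (no_types, lifting))
qed

text \<open>An arbitrary pseudohermitian structure with its Tanaka-Webster connection, both defined on a
  common neighbourhood \<open>W\<close> of the ellipsoid.\<close>
locale tw_ellipsoid =
  fixes a :: real and \<theta> :: "complex^3 \<Rightarrow> complex^3" and \<Gamma> :: "complex^3 \<Rightarrow> cvec \<Rightarrow> cvec \<Rightarrow> cvec"
    and W :: "(complex^3) set"
  assumes W: "open W" "hypersurface (ellipsoid_fun a) \<subseteq> W"
    and smooth_theta: "smooth_on W \<theta>"
    and ph: "pseudohermitian (ellipsoid_fun a) \<theta>"
    and smooth_Gamma: "\<And>X Y. smooth_on W (\<lambda>p. \<Gamma> p X Y)"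
    and bilinear_Gamma: "\<And>p. p \<in> W \<Longrightarrow> cbilinear (\<Gamma> p)"
    and real_Gamma: "\<And>p X Y. p \<in> W \<Longrightarrow> \<Gamma> p (cconj X) (cconj Y) = cconj (\<Gamma> p X Y)"
    and tw: "tanaka_webster (ellipsoid_fun a) \<theta> \<Gamma>"
begin

abbreviation M where "M \<equiv> hypersurface (ellipsoid_fun a)"
abbreviation Z where "Z \<equiv> frame a"
abbreviation P where "P \<equiv> hess a"

text \<open>The function \<open>\<lambda>\<close>. Since \<open>\<theta>\<close> annihilates the frame, \<open>\<lambda>\<close> determines \<open>\<theta>\<close> along the ellipsoid.\<close>
definition lam :: "complex^3 \<Rightarrow> complex" where
  "lam q = form (\<theta> q) (rot q)"

text \<open>The Reeb field has the denominator \<open>\<lambda>\<close> and is smooth on \<open>U\<close>, which contains every point of the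
  ellipsoid with \<open>z\<^sub>1 \<noteq> 0\<close> (\<open>M_in_U\<close>). To see this one computes the Levi form in the frame, on the set
  \<open>V\<close> where \<open>\<lambda>\<close> may still have zeros.\<close>
definition V where "V = {q \<in> W. q $ 1 \<noteq> 0 \<and> 0 < Re (rad2 a q)}"
definition U where "U = {q \<in> V. lam q \<noteq> 0}"

lemma cnj_lam [simp]: "cnj (lam q) = lam q"
  using form_cconj[of "\<theta> q" "rot q"] by (simp add: lam_def)

lemma open_V: "open V"
proof -
  have 1: "open {q :: complex^3. q $ 1 \<noteq> 0}"
    by (intro open_Collect_neq continuous_intros)
  have 2: "open {q. 0 < Re (rad2 a q)}"
  proof -
    have "continuous_on UNIV (rad2 a)"
      using smooth_rad2[OF open_UNIV] unfolding smooth_on_def by (metis Ck_on.simps(1))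
    then show ?thesis by (intro open_Collect_less continuous_intros)
  qed
  have "V = W \<inter> {q. q $ 1 \<noteq> 0} \<inter> {q. 0 < Re (rad2 a q)}"
    by (auto simp: V_def)
  then show ?thesis using 1 2 W by (simp add: open_Int)
qed

lemma V_subset_W: "V \<subseteq> W" by (auto simp: V_def)
lemma U_subset_V: "U \<subseteq> V" by (auto simp: U_def)

lemma theta_differentiable: "p \<in> V \<Longrightarrow> \<theta> differentiable (at p)"
  using smooth_on_imp_differentiable[OF smooth_theta] V_subset_W by blast

lemma smooth_lam_V: "smooth_on V lam"
  unfolding lam_def[abs_def]
  using smooth_on_subset[OF smooth_theta V_subset_W] open_V by (intro smooth_intros)

lemma open_U: "open U"
proof -
  have "continuous_on V lam" using smooth_lam_V unfolding smooth_on_def by (metis Ck_on.simps(1))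
  then have "open (lam -` (- {0}) \<inter> V)"
    using continuous_on_open_vimage[OF open_V] by blast
  moreover have "lam -` (- {0}) \<inter> V = U" by (auto simp: U_def)
  ultimately show ?thesis by simp
qed

lemma rad2_nz: "p \<in> V \<Longrightarrow> rad2 a p \<noteq> 0"
  by (auto simp: V_def)

lemma drho_norm2_nz: "p \<in> V \<Longrightarrow> drho_norm2 a p \<noteq> 0"
proof -
  assume "p \<in> V"
  then have "0 < Re (drho_norm2 a p)"
    by (simp add: V_def drho_norm2_def sum_2 add_pos_nonneg)
  then show ?thesis by auto
qed

lemma M_in_V: "p \<in> M \<Longrightarrow> p $ 1 \<noteq> 0 \<Longrightarrow> p \<in> V"
proof -
  assume p: "p \<in> M" "p $ 1 \<noteq> 0"
  have "rad2 a p = of_real ((cmod (p $ 1))\<^sup>2)"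
    using p(1) complex_norm_square[of "p $ 1"] by (simp add: hypersurface_iff)
  then show "p \<in> V" using p W by (auto simp: V_def)
qed

lemma dir_cong:
  assumes "X \<in> CT (ellipsoid_fun a) p" "p \<in> M \<inter> N" "open N" "N \<subseteq> V"
    "f differentiable (at p)" "g differentiable (at p)" "\<And>q. q \<in> M \<inter> N \<Longrightarrow> f q = g q"
  shows "dir X f p = dir X g p"
  using assms by (intro dir_cong_on_ellipsoid[where U = N]) (auto simp: V_def)

lemma Z_T10: "p \<in> M \<inter> V \<Longrightarrow> Z \<alpha> p \<in> T10 (ellipsoid_fun a) p"
  by (auto intro!: frame_in_T10 rad2_nz)

lemma Z_CT: "p \<in> M \<inter> V \<Longrightarrow> Z \<alpha> p \<in> CT (ellipsoid_fun a) p"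
  using Z_T10 by (auto simp: T10_def)

lemma Zbar_CT: "p \<in> M \<inter> V \<Longrightarrow> bar Z \<alpha> p \<in> CT (ellipsoid_fun a) p"
  by (auto intro!: CT_cconj Z_CT simp: bar_def)

lemma smooth_Z: "open N \<Longrightarrow> N \<subseteq> V \<Longrightarrow> smooth_on N (Z \<alpha>)"
  using rad2_nz by (intro smooth_frame) auto

lemma smooth_Zbar: "open N \<Longrightarrow> N \<subseteq> V \<Longrightarrow> smooth_on N (bar Z \<alpha>)"
  unfolding bar_eq by (intro smooth_on_cconj smooth_Z)

lemma Z_differentiable: "p \<in> V \<Longrightarrow> Z \<alpha> differentiable (at p)" "p \<in> V \<Longrightarrow> bar Z \<alpha> differentiable (at p)"
  "rot differentiable (at p)"
  using smooth_on_imp_differentiable[OF smooth_Z[OF open_V]]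
    smooth_on_imp_differentiable[OF smooth_Zbar[OF open_V]]
    smooth_on_imp_differentiable[OF smooth_rot[OF open_UNIV]] by auto

lemma form_Z: "p \<in> M \<inter> V \<Longrightarrow> form (\<theta> p) (Z \<alpha> p) = 0" "p \<in> M \<inter> V \<Longrightarrow> form (\<theta> p) (bar Z \<alpha> p) = 0"
proof -
  assume p: "p \<in> M \<inter> V"
  then show 1: "form (\<theta> p) (Z \<alpha> p) = 0"
    using ph Z_T10[OF p] unfolding pseudohermitian_def by blast
  show "form (\<theta> p) (bar Z \<alpha> p) = 0" by (simp add: bar_def form_cconj 1)
qed

lemma dir_form_Z:
  assumes "p \<in> M \<inter> V" "X \<in> CT (ellipsoid_fun a) p"
  shows "dir X (\<lambda>q. form (\<theta> q) (Z \<alpha> q)) p = 0" "dir X (\<lambda>q. form (\<theta> q) (bar Z \<alpha> q)) p = 0"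
proof -
  have "dir X (\<lambda>q. form (\<theta> q) (Z \<alpha> q)) p = dir X (\<lambda>q. 0) p"
    using assms Z_differentiable theta_differentiable form_Z
    by (intro dir_cong[OF assms(2,1) open_V order_refl] form_differentiable) auto
  then show "dir X (\<lambda>q. form (\<theta> q) (Z \<alpha> q)) p = 0"
    using has_dir_imp_dir[OF has_dir_const] by simp
  have "dir X (\<lambda>q. form (\<theta> q) (bar Z \<alpha> q)) p = dir X (\<lambda>q. 0) p"
    using assms Z_differentiable theta_differentiable form_Z
    by (intro dir_cong[OF assms(2,1) open_V order_refl] form_differentiable) auto
  then show "dir X (\<lambda>q. form (\<theta> q) (bar Z \<alpha> q)) p = 0"
    using has_dir_imp_dir[OF has_dir_const] by simp
qed

lemma form_zero [simp]: "form t 0 = 0"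
  by (simp add: form_def)

text \<open>By Cartan's formula: \<open>\<theta>\<close> vanishes on the frame all along the ellipsoid, so only the bracket term
  contributes.\<close>
lemma levi_Z_Zbar: "p \<in> M \<inter> V \<Longrightarrow> levi \<theta> p (Z \<alpha> p) (bar Z \<beta> p) = lam p * P \<alpha> \<beta> p"
  unfolding levi_def
  by (subst dform_fields)
     (auto simp: theta_differentiable Z_differentiable dir_form_Z Z_CT Zbar_CT bracket_frame_framebar rad2_nz form_cscale lam_def i_times_i_times algebra_simps)

lemma levi_Z_Z: "p \<in> M \<inter> V \<Longrightarrow> levi \<theta> p (Z \<alpha> p) (Z \<beta> p) = 0"
  unfolding levi_def
  by (subst dform_fields)
     (auto simp: theta_differentiable Z_differentiable dir_form_Z Z_CT bracket_frame_frame rad2_nz)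

lemma levi_Zbar_Zbar: "p \<in> M \<inter> V \<Longrightarrow> levi \<theta> p (bar Z \<alpha> p) (bar Z \<beta> p) = 0"
  using levi_cconj[OF theta_differentiable, of p "Z \<alpha> p" "Z \<beta> p"] levi_Z_Z by (simp add: bar_def)

text \<open>Here the bracket vanishes and the derivative of \<open>\<lambda> = \<theta> T\<^sub>0\<close> remains; thus \<open>T\<^sub>0\<close> is a multiple of the
  Reeb field only where \<open>\<lambda>\<close> is stationary along the CR directions.\<close>
lemma levi_rot_Z: "p \<in> M \<inter> V \<Longrightarrow> levi \<theta> p (rot p) (Z \<beta> p) = \<i> * dir (Z \<beta> p) lam p"
  unfolding levi_def
  by (subst dform_fields)
     (auto simp: theta_differentiable Z_differentiable dir_form_Z Z_CT rot_in_CT bracket_rot_frame rad2_nz lam_def[abs_def])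

lemma lam_differentiable: "p \<in> V \<Longrightarrow> lam differentiable (at p)"
  using smooth_lam_V smooth_on_imp_differentiable by blast

lemma dir_Zbar_lam: "p \<in> V \<Longrightarrow> dir (bar Z \<beta> p) lam p = cnj (dir (Z \<beta> p) lam p)"
  using dir_cnj[OF lam_differentiable, of p "bar Z \<beta> p"] by (simp add: bar_def)

lemma levi_rot_Zbar: "p \<in> M \<inter> V \<Longrightarrow> levi \<theta> p (rot p) (bar Z \<beta> p) = \<i> * dir (bar Z \<beta> p) lam p"
  using levi_cconj[OF theta_differentiable, of p "rot p" "Z \<beta> p"] levi_rot_Z
  by (simp add: dir_Zbar_lam) (simp add: bar_def)

lemma levi_rot_rot: "levi \<theta> p (rot p) (rot p) = 0"
  using levi_antisym[of \<theta> p "rot p" "rot p"] by simp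

lemma levi_Z_rot: "p \<in> M \<inter> V \<Longrightarrow> levi \<theta> p (Z \<beta> p) (rot p) = - \<i> * dir (Z \<beta> p) lam p"
  "p \<in> M \<inter> V \<Longrightarrow> levi \<theta> p (bar Z \<beta> p) (rot p) = - \<i> * dir (bar Z \<beta> p) lam p"
  "p \<in> M \<inter> V \<Longrightarrow> levi \<theta> p (bar Z \<beta> p) (Z \<alpha> p) = - lam p * P \<alpha> \<beta> p"
  using levi_antisym[of \<theta> p _ "rot p"] levi_antisym[of \<theta> p _ "Z \<alpha> p"] levi_rot_Z levi_rot_Zbar levi_Z_Zbar by simp_all

text \<open>The Levi form \<open>\<lambda> P\<close> would vanish at a zero of \<open>\<lambda>\<close>, against strict pseudoconvexity.\<close>
lemma lam_nz: "p \<in> M \<inter> V \<Longrightarrow> lam p \<noteq> 0"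
proof
  assume p: "p \<in> M \<inter> V" and l: "lam p = 0"
  have "Z 1 p \<noteq> 0"
    by (metis frame_simps(3) fst_zero dw_simps(1) zero_index zero_neq_one)
  then have "0 < Re (levi \<theta> p (Z 1 p) (cconj (Z 1 p)))"
    using ph p Z_T10[OF p] unfolding pseudohermitian_def by blast
  then show False using levi_Z_Zbar[OF p, of 1 1] l by (simp add: bar_def)
qed

lemma M_in_U: "p \<in> M \<Longrightarrow> p $ 1 \<noteq> 0 \<Longrightarrow> p \<in> U"
  using M_in_V lam_nz by (auto simp: U_def)

lemma in_V: "p \<in> M \<inter> U \<Longrightarrow> p \<in> M \<inter> V" using U_subset_V by auto

lemma CR_frame_Z: "CR_frame (ellipsoid_fun a) U Z"
  unfolding CR_frame_def
proof (intro conjI allI ballI)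
  show "open U" by (rule open_U)
  show "smooth_on U (Z \<alpha>)" for \<alpha> by (rule smooth_Z[OF open_U U_subset_V])
  fix p assume p: "p \<in> M \<inter> U"
  show "Z \<alpha> p \<in> T10 (ellipsoid_fun a) p" for \<alpha> using Z_T10 p U_subset_V by blast
  fix X assume X: "X \<in> T10 (ellipsoid_fun a) p"
  have p1: "p \<in> M" "p $ 1 \<noteq> 0" using p by (auto simp: U_def V_def)
  show "\<exists>!c::complex^2. X = (\<Sum>\<alpha>\<in>UNIV. cscale (c $ \<alpha>) (Z \<alpha> p))"
  proof (rule ex1I[of _ "\<chi> \<alpha>. if \<alpha> = 1 then fst X $ 3 else fst X $ 2"])
    show "X = (\<Sum>\<alpha>\<in>UNIV. cscale ((\<chi> \<alpha>. if \<alpha> = 1 then fst X $ 3 else fst X $ 2) $ \<alpha>) (Z \<alpha> p))"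
      using T10_expand[OF p1 X] by simp
    fix c :: "complex^2" assume c: "X = (\<Sum>\<alpha>\<in>UNIV. cscale (c $ \<alpha>) (Z \<alpha> p))"
    show "c = (\<chi> \<alpha>. if \<alpha> = 1 then fst X $ 3 else fst X $ 2)"
      by (simp add: c vec_eq_iff forall_2 sum_2)
  qed
qed

abbreviation L where "L \<alpha> p \<equiv> dir (Z \<alpha> p) lam p"
abbreviation Lb where "Lb \<alpha> p \<equiv> dir (bar Z \<alpha> p) lam p"

text \<open>The (1,0)-gradient \<open>Y\<close> of \<open>\<lambda>\<close> with respect to the Levi form, characterised by
  \<open>levi Y (bar Z\<^sub>\<sigma>) = bar Z\<^sub>\<sigma> \<lambda>\<close>, and its square length \<open>Y \<lambda>\<close>, which is real. It is the correction that
  turns \<open>T\<^sub>0\<close> into the Reeb field of \<open>\<theta>\<close>.\<close>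
definition gradlam_coeff where "gradlam_coeff \<tau> p = (\<Sum>\<sigma>\<in>UNIV. hess_inv a \<tau> \<sigma> p * Lb \<sigma> p) / lam p"
definition gradlam where "gradlam p = (\<Sum>\<tau>\<in>UNIV. cscale (gradlam_coeff \<tau> p) (Z \<tau> p))"
definition gradlam_norm2 where "gradlam_norm2 p = (\<Sum>\<tau>\<in>UNIV. gradlam_coeff \<tau> p * L \<tau> p)"
definition reeb where "reeb p = cscale (1 / lam p) (rot p + cscale (- \<i>) (gradlam p) + cscale \<i> (cconj (gradlam p)))"

lemma smooth_lam: "smooth_on U lam"
  using smooth_on_subset[OF smooth_lam_V U_subset_V] .

lemma smooth_L: "smooth_on U (L \<alpha>)" "smooth_on U (Lb \<alpha>)"
  using open_U smooth_Z[OF open_U U_subset_V] smooth_Zbar[OF open_U U_subset_V] smooth_lam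
  by (auto intro!: smooth_on_dir)

lemma smooth_gradlam_coeff: "smooth_on U (gradlam_coeff \<tau>)"
  unfolding gradlam_coeff_def[abs_def] using open_U smooth_L smooth_lam drho_norm2_nz U_subset_V
  by (intro smooth_on_divide smooth_on_sum smooth_on_mult smooth_hess_inv) (auto simp: U_def)

lemma smooth_gradlam: "smooth_on U gradlam"
  unfolding gradlam_def[abs_def] using open_U smooth_gradlam_coeff smooth_Z[OF open_U U_subset_V]
  by (intro smooth_on_sum smooth_on_cscale)

lemma smooth_reeb: "smooth_on U reeb"
  unfolding reeb_def[abs_def] using open_U smooth_gradlam smooth_lam
  by (intro smooth_intros) (auto simp: U_def)

lemma gradlam_coeff_P: "p \<in> M \<inter> U \<Longrightarrow> (\<Sum>\<tau>\<in>UNIV. gradlam_coeff \<tau> p * P \<tau> \<sigma> p) = Lb \<sigma> p / lam p"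
proof -
  assume p: "p \<in> M \<inter> U"
  have "(\<Sum>\<tau>\<in>UNIV. gradlam_coeff \<tau> p * P \<tau> \<sigma> p) = (\<Sum>\<beta>\<in>UNIV. (\<Sum>\<tau>\<in>UNIV. hess_inv a \<tau> \<beta> p * P \<tau> \<sigma> p) * Lb \<beta> p) / lam p"
    by (simp add: gradlam_coeff_def sum_2 add_divide_distrib algebra_simps)
  also have "\<dots> = Lb \<sigma> p / lam p"
    using p exhaust_2[of \<sigma>] U_subset_V by (subst hess_inv_hess) (auto simp: rad2_nz drho_norm2_nz sum_2 subset_iff)
  finally show ?thesis .
qed

lemma cnj_gradlam_coeff_P: "p \<in> M \<inter> U \<Longrightarrow> (\<Sum>\<tau>\<in>UNIV. cnj (gradlam_coeff \<tau> p) * P \<sigma> \<tau> p) = L \<sigma> p / lam p"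
  using arg_cong[OF gradlam_coeff_P[of p \<sigma>], of cnj] U_subset_V
  by (auto simp: cnj_hess dir_Zbar_lam subset_iff)

lemma cnj_gradlam_norm2 [simp]: "p \<in> U \<Longrightarrow> cnj (gradlam_norm2 p) = gradlam_norm2 p"
  using U_subset_V by (auto simp: gradlam_norm2_def gradlam_coeff_def sum_2 dir_Zbar_lam cnj_hess_inv subset_iff add_divide_distrib algebra_simps)

lemma gradlam_T10: "p \<in> M \<inter> U \<Longrightarrow> gradlam p \<in> CT (ellipsoid_fun a) p" "snd (gradlam p) = 0"
  unfolding gradlam_def using U_subset_V
  by (auto intro!: CT_sum CT_cscale Z_CT) (simp add: snd_sum cscale_def)

lemma levi_gradlam: "p \<in> M \<inter> U \<Longrightarrow> levi \<theta> p (gradlam p) (bar Z \<sigma> p) = Lb \<sigma> p"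
  "p \<in> M \<inter> U \<Longrightarrow> levi \<theta> p (gradlam p) (Z \<sigma> p) = 0"
  "p \<in> M \<inter> U \<Longrightarrow> levi \<theta> p (gradlam p) (rot p) = - \<i> * gradlam_norm2 p"
proof -
  assume p: "p \<in> M \<inter> U"
  then have d: "\<theta> differentiable (at p)" and l: "lam p \<noteq> 0" using theta_differentiable U_subset_V by (auto simp: U_def)
  show "levi \<theta> p (gradlam p) (bar Z \<sigma> p) = Lb \<sigma> p"
    unfolding gradlam_def using gradlam_coeff_P[OF p, of \<sigma>] l
    by (simp add: levi_sum_left d levi_cscale_left levi_Z_Zbar[OF in_V[OF p]] field_simps sum_distrib_left[symmetric] mult.left_commute[of _ "lam p"])
  show "levi \<theta> p (gradlam p) (Z \<sigma> p) = 0"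
    unfolding gradlam_def by (simp add: levi_sum_left d levi_cscale_left levi_Z_Z[OF in_V[OF p]])
  show "levi \<theta> p (gradlam p) (rot p) = - \<i> * gradlam_norm2 p"
    unfolding gradlam_def gradlam_norm2_def
    by (simp only: levi_sum_left[OF d] levi_cscale_left[OF d] levi_Z_rot[OF in_V[OF p]] sum_distrib_left) (simp add: mult_ac)
qed

lemma levi_cconj_gradlam: 
  "p \<in> M \<inter> U \<Longrightarrow> levi \<theta> p (cconj (gradlam p)) (bar Z \<sigma> p) = 0"
  "p \<in> M \<inter> U \<Longrightarrow> levi \<theta> p (cconj (gradlam p)) (Z \<sigma> p) = - L \<sigma> p"
  "p \<in> M \<inter> U \<Longrightarrow> levi \<theta> p (cconj (gradlam p)) (rot p) = - \<i> * gradlam_norm2 p"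
  "p \<in> M \<inter> U \<Longrightarrow> levi \<theta> p (Z \<sigma> p) (cconj (gradlam p)) = L \<sigma> p"
  "p \<in> M \<inter> U \<Longrightarrow> levi \<theta> p (gradlam p) (cconj (gradlam p)) = gradlam_norm2 p"
  "p \<in> M \<inter> U \<Longrightarrow> levi \<theta> p (rot p) (cconj (gradlam p)) = \<i> * gradlam_norm2 p"
proof -
  assume p: "p \<in> M \<inter> U"
  then have d: "\<theta> differentiable (at p)" and pv: "p \<in> V" using theta_differentiable U_subset_V by auto
  note c = levi_cconj[OF d, of "gradlam p"]
  show "levi \<theta> p (cconj (gradlam p)) (bar Z \<sigma> p) = 0"
    using c[of "Z \<sigma> p"] levi_gradlam(2)[OF p] by (simp add: bar_def)
  show 2: "levi \<theta> p (cconj (gradlam p)) (Z \<sigma> p) = - L \<sigma> p" for \<sigma>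
    using c[of "bar Z \<sigma> p"] levi_gradlam(1)[OF p, of \<sigma>] dir_Zbar_lam[OF pv, of \<sigma>] by (simp add: bar_def)
  show 3: "levi \<theta> p (cconj (gradlam p)) (rot p) = - \<i> * gradlam_norm2 p"
    using c[of "rot p"] levi_gradlam(3)[OF p] p by simp
  show 4: "levi \<theta> p (Z \<sigma> p) (cconj (gradlam p)) = L \<sigma> p" for \<sigma>
    using 2 levi_antisym by (metis minus_minus)
  show "levi \<theta> p (gradlam p) (cconj (gradlam p)) = gradlam_norm2 p"
    by (subst gradlam_def) (simp add: levi_sum_left d levi_cscale_left 4 gradlam_norm2_def)
  show "levi \<theta> p (rot p) (cconj (gradlam p)) = \<i> * gradlam_norm2 p"
    using 3 levi_antisym[of \<theta> p "rot p"] by simp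
qed

text \<open>It suffices to test on the frame, its conjugate and \<open>T\<^sub>0\<close>, which span the tangent space. The
  contributions of \<open>T\<^sub>0\<close> and of the gradient of \<open>\<lambda>\<close> cancel.\<close>
lemma levi_reeb:
  assumes p: "p \<in> M \<inter> U" and X: "X \<in> CT (ellipsoid_fun a) p"
  shows "levi \<theta> p (reeb p) X = 0"
proof -
  have d: "\<theta> differentiable (at p)" and p1: "p \<in> M" "p $ 1 \<noteq> 0" and pv: "p \<in> M \<inter> V"
    using p theta_differentiable U_subset_V by (auto simp: U_def V_def)
  have e: "levi \<theta> p (reeb p) X = 1 / lam p * (levi \<theta> p (rot p) X - \<i> * levi \<theta> p (gradlam p) X + \<i> * levi \<theta> p (cconj (gradlam p)) X)" for X
    unfolding reeb_def by (simp only: levi_cscale_left[OF d] levi_add_left[OF d]) simp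
  have "levi \<theta> p (reeb p) (Z \<alpha> p) = 0" "levi \<theta> p (reeb p) (bar Z \<alpha> p) = 0" "levi \<theta> p (reeb p) (rot p) = 0" for \<alpha>
    unfolding e by (simp_all add: levi_gradlam[OF p] levi_cconj_gradlam[OF p] levi_rot_Z[OF pv] levi_rot_Zbar[OF pv] levi_rot_rot)
  then show ?thesis
    using CT_expand[OF p1 X]
    by (metis (no_types, lifting) add.right_neutral d levi_add_right levi_cscale_right levi_sum_right mult_zero_right sum.neutral)
qed

lemma reeb_in_CT: "p \<in> M \<inter> U \<Longrightarrow> reeb p \<in> CT (ellipsoid_fun a) p"
  unfolding reeb_def by (intro CT_cscale CT_add rot_in_CT gradlam_T10 CT_cconj)

lemma reeb_field_reeb: "reeb_field (ellipsoid_fun a) \<theta> U reeb"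
  unfolding reeb_field_def tangent_field_def
proof (intro conjI ballI)
  show "open U" "smooth_on U reeb" by (rule open_U smooth_reeb)+
  fix p assume p: "p \<in> M \<inter> U"
  show "reeb p \<in> CT (ellipsoid_fun a) p" by (rule reeb_in_CT[OF p])
  show "cconj (reeb p) = reeb p"
    by (simp add: reeb_def cconj_add cconj_cscale add_ac)
  have y: "form (\<theta> p) (gradlam p) = 0"
    using in_V[OF p] by (simp add: gradlam_def sum_2 form_add form_cscale form_Z)
  show "form (\<theta> p) (reeb p) = 1"
    using p by (simp add: reeb_def form_add form_cscale form_cconj y lam_def[symmetric] U_def)
  show "dform \<theta> p (reeb p) X = 0" if "X \<in> CT (ellipsoid_fun a) p" for X
    using levi_reeb[OF p that] by (simp add: levi_def)
qed

end

section \<open>The Tanaka-Webster connection in the frame\<close>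

lemma cbilinearD:
  assumes "cbilinear B"
  shows "B (X + X') Y = B X Y + B X' Y" "B X (Y + Y') = B X Y + B X Y'"
    "B (cscale c X) Y = cscale c (B X Y)" "B X (cscale c Y) = cscale c (B X Y)"
  using assms unfolding cbilinear_def by blast+

lemma cov_cscale_left:
  assumes "cbilinear (\<Gamma> p)" "X p = cscale c (Y p)"
  shows "cov \<Gamma> X V p = cscale c (cov \<Gamma> Y V p)"
  unfolding cov_def assms(2) cbilinearD[OF assms(1)] cscale_algebra
  by (intro cvec_eqI) (simp_all add: dir_field_simps dir_cscale_vec)

text \<open>The flat derivative is torsion free, hence the torsion is algebraic. In particular it may be
  expanded linearly at a single point, without differentiating coefficients.\<close>
lemma torsion_eq: "torsion \<Gamma> X Y p = \<Gamma> p (X p) (Y p) - \<Gamma> p (Y p) (X p)"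
  by (simp add: torsion_def cov_def bracket_def)

lemma dir_field_cconj:
  assumes "Y differentiable (at p)"
  shows "dir_field (cconj X) (\<lambda>q. cconj (Y q)) p = cconj (dir_field X Y p)"
proof -
  have y1: "(\<lambda>q. fst (Y q) $ j) differentiable (at p)" and y2: "(\<lambda>q. snd (Y q) $ j) differentiable (at p)" for j
    using assms(1) bounded_linear.has_derivative[OF bounded_linear_compose[OF bounded_linear_vec_nth bounded_linear_fst]]
      bounded_linear.has_derivative[OF bounded_linear_compose[OF bounded_linear_vec_nth bounded_linear_snd]]
    unfolding differentiable_def by blast+
  show ?thesis
    by (rule cvec_eqI) (simp_all add: dir_field_simps dir_cnj y1 y2)
qed

lemma levi_diff_left:
  assumes "\<theta> differentiable (at p)"
  shows "levi \<theta> p (X - X') Y = levi \<theta> p X Y - levi \<theta> p X' Y"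
  using levi_add_left[OF assms, of "X - X'" X' Y] by simp

context tw_ellipsoid
begin

lemma theta_diff_U: "p \<in> M \<inter> U \<Longrightarrow> \<theta> differentiable (at p)"
  using theta_differentiable U_subset_V by blast

lemma lam_nz_U: "p \<in> M \<inter> U \<Longrightarrow> lam p \<noteq> 0"
  by (simp add: U_def)

lemma U_subset_W: "U \<subseteq> W" using U_subset_V V_subset_W by blast

lemma tangent_Z: "tangent_field (ellipsoid_fun a) U (Z \<alpha>)"
  "tangent_field (ellipsoid_fun a) U (bar Z \<alpha>)" "tangent_field (ellipsoid_fun a) U rot"
  unfolding tangent_field_def
  using open_U smooth_Z[OF open_U U_subset_V] smooth_Zbar[OF open_U U_subset_V] smooth_rot[OF open_U]
    Z_CT Zbar_CT rot_in_CT in_V by blast+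

lemma tangent_cov:
  assumes X: "tangent_field (ellipsoid_fun a) U X" and Y: "tangent_field (ellipsoid_fun a) U Y"
  shows "tangent_field (ellipsoid_fun a) U (cov \<Gamma> X Y)"
  unfolding tangent_field_def
proof (intro conjI ballI)
  show "open U" by (rule open_U)
  show "smooth_on U (cov \<Gamma> X Y)"
    using X Y smooth_on_subset[OF smooth_Gamma U_subset_W] bilinear_Gamma U_subset_W
    by (intro smooth_cov open_U) (auto simp: tangent_field_def)
  show "cov \<Gamma> X Y p \<in> CT (ellipsoid_fun a) p" if "p \<in> M \<inter> U" for p
  proof -
    have "\<forall>U X Y. tangent_field (ellipsoid_fun a) U X \<and> tangent_field (ellipsoid_fun a) U Y \<longrightarrow>
        (\<forall>p \<in> M \<inter> U. cov \<Gamma> X Y p \<in> CT (ellipsoid_fun a) p)"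
      using tw by (simp add: tanaka_webster_def linear_connection_def)
    then show ?thesis using X Y that by blast
  qed
qed

lemma tangent_smooth: "tangent_field (ellipsoid_fun a) U X \<Longrightarrow> smooth_on U X"
  by (simp add: tangent_field_def)

lemma tangent_CT: "tangent_field (ellipsoid_fun a) U X \<Longrightarrow> p \<in> M \<inter> U \<Longrightarrow> X p \<in> CT (ellipsoid_fun a) p"
  by (simp add: tangent_field_def)

lemma tangent_diff: "tangent_field (ellipsoid_fun a) U X \<Longrightarrow> p \<in> M \<inter> U \<Longrightarrow> X differentiable (at p)"
  using tangent_smooth smooth_on_imp_differentiable by blast

lemma cov_T10:
  assumes "tangent_field (ellipsoid_fun a) U X" "p \<in> M \<inter> U"
  shows "cov \<Gamma> X (Z \<gamma>) p \<in> T10 (ellipsoid_fun a) p"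
proof -
  have "\<forall>U X Y. tangent_field (ellipsoid_fun a) U X \<and> tangent_field (ellipsoid_fun a) U Y \<and>
        (\<forall>p \<in> M \<inter> U. Y p \<in> T10 (ellipsoid_fun a) p) \<longrightarrow> (\<forall>p \<in> M \<inter> U. cov \<Gamma> X Y p \<in> T10 (ellipsoid_fun a) p)"
    using tw by (simp add: tanaka_webster_def)
  then show ?thesis using assms tangent_Z Z_T10 in_V by blast
qed

text \<open>The Levi form is parallel. Stated with an arbitrary smooth function \<open>f\<close> that agrees with the Levi form
  of the two fields on the hypersurface, it yields covariant derivatives of fields as soon as their
  Levi products are known explicitly along \<open>M\<close>.\<close>
lemma levi_parallel:
  assumes X: "tangent_field (ellipsoid_fun a) U X" and Y: "tangent_field (ellipsoid_fun a) U Y"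
    and Y': "tangent_field (ellipsoid_fun a) U Y'" and p: "p \<in> M \<inter> U"
    and f: "smooth_on U f" "\<And>q. q \<in> M \<inter> U \<Longrightarrow> levi \<theta> q (Y q) (Y' q) = f q"
  shows "dir (X p) f p = levi \<theta> p (cov \<Gamma> X Y p) (Y' p) + levi \<theta> p (Y p) (cov \<Gamma> X Y' p)"
proof -
  have "\<forall>U X Y V. tangent_field (ellipsoid_fun a) U X \<and> tangent_field (ellipsoid_fun a) U Y \<and> tangent_field (ellipsoid_fun a) U V \<longrightarrow>
        (\<forall>p \<in> M \<inter> U.
           dir (X p) (\<lambda>q. dform \<theta> q (Y q) (V q)) p =
           dform \<theta> p (cov \<Gamma> X Y p) (V p) + dform \<theta> p (Y p) (cov \<Gamma> X V p))"
    using tw by (simp add: tanaka_webster_def)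
  then have d: "dir (X p) (\<lambda>q. dform \<theta> q (Y q) (Y' q)) p =
           dform \<theta> p (cov \<Gamma> X Y p) (Y' p) + dform \<theta> p (Y p) (cov \<Gamma> X Y' p)"
    using X Y Y' p by blast
  have sl: "smooth_on U (\<lambda>q. levi \<theta> q (Y q) (Y' q))"
    using open_U smooth_on_subset[OF smooth_theta U_subset_W] tangent_smooth[OF Y] tangent_smooth[OF Y']
    by (intro smooth_levi)
  have "dir (X p) f p = dir (X p) (\<lambda>q. levi \<theta> q (Y q) (Y' q)) p"
    using dir_cong[OF tangent_CT[OF X p] p open_U U_subset_V, of f] f sl p smooth_on_imp_differentiable
    by (metis (no_types, lifting) IntD2)
  also have "\<dots> = dir (X p) (\<lambda>q. - \<i> * dform \<theta> q (Y q) (Y' q)) p"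
    by (simp add: levi_def)
  also have "\<dots> = - \<i> * dir (X p) (\<lambda>q. dform \<theta> q (Y q) (Y' q)) p"
  proof -
    have "smooth_on U (\<lambda>q. \<i> * levi \<theta> q (Y q) (Y' q))"
      using sl open_U by (intro smooth_on_mult smooth_on_const)
    then have "(\<lambda>q. dform \<theta> q (Y q) (Y' q)) differentiable (at p)"
      using p smooth_on_imp_differentiable by (fastforce simp: levi_def simp flip: mult.assoc)
    then show ?thesis
      by (intro has_dir_imp_dir has_dir_eq[OF has_dir_mult[OF has_dir_const has_dir_dir]]) auto
  qed
  finally show ?thesis by (simp add: d levi_def algebra_simps)
qed

lemma cov_cconj:
  assumes "tangent_field (ellipsoid_fun a) U X" "tangent_field (ellipsoid_fun a) U Y" "p \<in> M \<inter> U"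
  shows "cov \<Gamma> (\<lambda>q. cconj (X q)) (\<lambda>q. cconj (Y q)) p = cconj (cov \<Gamma> X Y p)"
  using assms U_subset_W
  by (auto simp: cov_def dir_field_cconj tangent_diff real_Gamma cconj_add subset_iff)

lemma cov_Zbar:
  assumes "p \<in> M \<inter> U"
  shows "cov \<Gamma> (bar Z \<alpha>) (bar Z \<beta>) p = cconj (cov \<Gamma> (Z \<alpha>) (Z \<beta>) p)"
    "cov \<Gamma> (Z \<alpha>) (bar Z \<beta>) p = cconj (cov \<Gamma> (bar Z \<alpha>) (Z \<beta>) p)"
    "cov \<Gamma> rot (bar Z \<beta>) p = cconj (cov \<Gamma> rot (Z \<beta>) p)"
  using cov_cconj[OF tangent_Z(1) tangent_Z(1) assms, of \<alpha> \<beta>] cov_cconj[OF tangent_Z(2) tangent_Z(1) assms, of \<alpha> \<beta>]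
    cov_cconj[OF tangent_Z(3) tangent_Z(1) assms, of \<beta>]
  by (simp_all add: bar_eq)

lemma torsion_frame:
  assumes "p \<in> M \<inter> U"
  shows "torsion \<Gamma> (Z \<alpha>) (Z \<beta>) p = 0"
    "torsion \<Gamma> (Z \<alpha>) (bar Z \<beta>) p = cscale (\<i> * lam p * P \<alpha> \<beta> p) (reeb p)"
    "torsion \<Gamma> reeb (Z \<alpha>) p \<in> T01 (ellipsoid_fun a) p"
proof -
  have "\<forall>U Z T. CR_frame (ellipsoid_fun a) U Z \<and> reeb_field (ellipsoid_fun a) \<theta> U T \<longrightarrow>
        (\<forall>p \<in> M \<inter> U. \<forall>\<alpha> \<beta>.
           torsion \<Gamma> (Z \<alpha>) (Z \<beta>) p = 0 \<and>
           torsion \<Gamma> (Z \<alpha>) (bar Z \<beta>) p = cscale (\<i> * levi \<theta> p (Z \<alpha> p) (bar Z \<beta> p)) (T p) \<and>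
           torsion \<Gamma> T (Z \<alpha>) p \<in> T01 (ellipsoid_fun a) p)"
    using tw by (simp add: tanaka_webster_def)
  then have *: "\<forall>\<alpha> \<beta>. torsion \<Gamma> (Z \<alpha>) (Z \<beta>) p = 0 \<and>
           torsion \<Gamma> (Z \<alpha>) (bar Z \<beta>) p = cscale (\<i> * levi \<theta> p (Z \<alpha> p) (bar Z \<beta> p)) (reeb p) \<and>
           torsion \<Gamma> reeb (Z \<alpha>) p \<in> T01 (ellipsoid_fun a) p"
    using CR_frame_Z reeb_field_reeb assms by blast
  then show "torsion \<Gamma> (Z \<alpha>) (Z \<beta>) p = 0" "torsion \<Gamma> reeb (Z \<alpha>) p \<in> T01 (ellipsoid_fun a) p" by blast+
  show "torsion \<Gamma> (Z \<alpha>) (bar Z \<beta>) p = cscale (\<i> * lam p * P \<alpha> \<beta> p) (reeb p)"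
    using * levi_Z_Zbar[OF in_V[OF assms]] by (simp add: mult.assoc)
qed

text \<open>The mixed torsion is a multiple of the Reeb field and \<open>\<nabla>\<close> preserves types, so the derivative is minus the
  (1,0)-part of \<open>torsion + bracket\<close>. The multiples of \<open>T\<^sub>0\<close> cancel and the gradient of \<open>\<lambda>\<close> is left.\<close>
lemma cov_Zbar_Z:
  assumes p: "p \<in> M \<inter> U"
  shows "cov \<Gamma> (bar Z \<beta>) (Z \<alpha>) p = cscale (- P \<alpha> \<beta> p) (gradlam p)"
proof -
  have s: "snd (cov \<Gamma> (bar Z \<beta>) (Z \<alpha>) p) = 0" "snd (cov \<Gamma> (bar Z \<alpha>) (Z \<beta>) p) = 0"
    using cov_T10[OF tangent_Z(2) p] by (auto simp: T10_def)
  then have f: "fst (cov \<Gamma> (Z \<alpha>) (bar Z \<beta>) p) = 0"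
    by (simp add: cov_Zbar[OF p] cconj_def vec_eq_iff)
  have "cov \<Gamma> (Z \<alpha>) (bar Z \<beta>) p - cov \<Gamma> (bar Z \<beta>) (Z \<alpha>) p - bracket (Z \<alpha>) (bar Z \<beta>) p
      = cscale (\<i> * lam p * P \<alpha> \<beta> p) (reeb p)"
    using torsion_frame(2)[OF p] by (simp add: torsion_def)
  then have e: "cov \<Gamma> (Z \<alpha>) (bar Z \<beta>) p - cov \<Gamma> (bar Z \<beta>) (Z \<alpha>) p
      = cscale (- \<i> * P \<alpha> \<beta> p) (rot p) + cscale (\<i> * lam p * P \<alpha> \<beta> p) (reeb p)"
    using bracket_frame_framebar[of a p \<alpha> \<beta>] rad2_nz[of p] in_V[OF p] by (simp add: algebra_simps)
  have "cscale (\<i> * lam p * P \<alpha> \<beta> p) (reeb p) =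
      cscale (\<i> * P \<alpha> \<beta> p) (rot p) + cscale (P \<alpha> \<beta> p) (gradlam p) - cscale (P \<alpha> \<beta> p) (cconj (gradlam p))"
    unfolding reeb_def using lam_nz_U[OF p]
    by (intro cvec_eqI) (simp_all add: field_simps i_times_i_times)
  then have "cov \<Gamma> (Z \<alpha>) (bar Z \<beta>) p - cov \<Gamma> (bar Z \<beta>) (Z \<alpha>) p
      = cscale (P \<alpha> \<beta> p) (gradlam p) - cscale (P \<alpha> \<beta> p) (cconj (gradlam p))"
    unfolding e by (simp add: cscale_algebra)
  then have "fst (cov \<Gamma> (bar Z \<beta>) (Z \<alpha>) p) = - fst (cscale (P \<alpha> \<beta> p) (gradlam p) - cscale (P \<alpha> \<beta> p) (cconj (gradlam p)))"
    using f by (metis diff_0 fst_diff minus_minus)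
  then have "fst (cov \<Gamma> (bar Z \<beta>) (Z \<alpha>) p) $ j = - P \<alpha> \<beta> p * fst (gradlam p) $ j" for j
    using gradlam_T10(2)[of p] by simp
  then show ?thesis
    using s gradlam_T10(2)[of p] by (intro cvec_eqI) simp_all
qed

text \<open>The lowered connection coefficients, that is, \<open>Z\<^sub>\<alpha> (\<lambda> P\<^sub>\<gamma>\<^sub>\<sigma>) + P\<^sub>\<alpha>\<^sub>\<sigma> Z\<^sub>\<gamma> \<lambda>\<close> with the derivatives of \<open>P\<close> inserted.\<close>
definition conn_low where "conn_low \<alpha> \<gamma> \<sigma> p = lam p * (dpot a \<alpha> p * P \<gamma> \<sigma> p + dpot a \<gamma> p * P \<alpha> \<sigma> p + pot20 a \<alpha> \<gamma> p * cnj (dpot a \<sigma> p))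
    + L \<alpha> p * P \<gamma> \<sigma> p + L \<gamma> p * P \<alpha> \<sigma> p"

lemma smooth_explicit: "smooth_on U (P \<alpha> \<beta>)" "smooth_on U (dpot a \<alpha>)" "smooth_on U (pot20 a \<alpha> \<beta>)"
  using open_U rad2_nz U_subset_V by (auto intro!: smooth_intros)

lemma smooth_conn_low: "smooth_on U (conn_low \<alpha> \<gamma> \<sigma>)"
  unfolding conn_low_def[abs_def] using open_U smooth_explicit smooth_lam smooth_L
  by (intro smooth_on_add smooth_on_mult smooth_on_cnj)

lemma levi_cov_Z_Z:
  assumes p: "p \<in> M \<inter> U"
  shows "levi \<theta> p (cov \<Gamma> (Z \<alpha>) (Z \<gamma>) p) (bar Z \<sigma> p) = conn_low \<alpha> \<gamma> \<sigma> p"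
proof -
  have s: "smooth_on U (\<lambda>q. lam q * P \<gamma> \<sigma> q)"
    using open_U smooth_explicit smooth_lam by (intro smooth_on_mult)
  have nz: "rad2 a p \<noteq> 0" using p in_V rad2_nz by blast
  have m: "dir (Z \<alpha> p) (\<lambda>q. lam q * P \<gamma> \<sigma> q) p = levi \<theta> p (cov \<Gamma> (Z \<alpha>) (Z \<gamma>) p) (bar Z \<sigma> p) +
      levi \<theta> p (Z \<gamma> p) (cov \<Gamma> (Z \<alpha>) (bar Z \<sigma>) p)"
    using levi_Z_Zbar in_V by (intro levi_parallel[OF tangent_Z(1) tangent_Z(1) tangent_Z(2) p s]) auto
  have c: "cov \<Gamma> (Z \<alpha>) (bar Z \<sigma>) p = cscale (- P \<alpha> \<sigma> p) (cconj (gradlam p))"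
    by (simp add: cov_Zbar[OF p] cov_Zbar_Z[OF p] cconj_cscale cnj_hess)
  have d: "dir (Z \<alpha> p) (\<lambda>q. lam q * P \<gamma> \<sigma> q) p = lam p * (dpot a \<alpha> p * P \<gamma> \<sigma> p + dpot a \<gamma> p * P \<alpha> \<sigma> p + pot20 a \<gamma> \<alpha> p * cnj (dpot a \<sigma> p)) + L \<alpha> p * P \<gamma> \<sigma> p"
    using has_dir_mult[OF has_dir_dir[OF lam_differentiable] has_dir_frame_hess[OF nz]] in_V[OF p]
    by (auto intro!: has_dir_imp_dir)
  show ?thesis
    using m unfolding d c
    by (simp add: levi_cscale_right[OF theta_diff_U[OF p]] levi_cconj_gradlam(4)[OF p] conn_low_def pot20_sym algebra_simps)
qed

lemma levi_T01_Zbar: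
  assumes p: "p \<in> M \<inter> U" and X: "X \<in> T01 (ellipsoid_fun a) p"
  shows "levi \<theta> p X (bar Z \<sigma> p) = 0"
proof -
  have "cconj X \<in> T10 (ellipsoid_fun a) p"
    using X CT_cconj[of X a p] by (auto simp: T10_def T01_def) (simp add: cconj_def vec_eq_iff)
  moreover have "p $ 1 \<noteq> 0" using p by (auto simp: U_def V_def)
  moreover define c where "c \<alpha> = (if \<alpha> = 1 then fst (cconj X) $ 3 else fst (cconj X) $ 2)" for \<alpha> :: 2
  ultimately have "cconj X = (\<Sum>\<alpha>\<in>UNIV. cscale (c \<alpha>) (Z \<alpha> p))"
    using T10_expand[of p a "cconj X"] p by simp
  then have "X = (\<Sum>\<alpha>\<in>UNIV. cscale (cnj (c \<alpha>)) (bar Z \<alpha> p))"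
    by (metis (no_types, lifting) bar_def cconj_cconj cconj_cscale cconj_sum sum.cong)
  then show ?thesis
    using theta_diff_U[OF p] by (simp add: levi_sum_left levi_cscale_left levi_Zbar_Zbar[OF in_V[OF p]])
qed

text \<open>Expand \<open>T\<^sub>0\<close> in the Reeb field, \<open>Y\<close> and \<open>bar Y\<close>. Up to terms that are invisible to the Levi product
  with a conjugate frame vector, the torsion of \<open>T\<^sub>0\<close> and \<open>Z\<^sub>\<gamma>\<close> is zero: its (0,1)-part pairs to zero, and so
  does the Reeb field. Hence \<open>\<nabla>\<close> of \<open>Z\<^sub>\<gamma>\<close> along \<open>T\<^sub>0\<close> may be replaced by \<open>\<nabla>\<close> of \<open>T\<^sub>0\<close> along \<open>Z\<^sub>\<gamma>\<close>,
  to which \<open>levi_parallel\<close> applies.\<close>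
lemma levi_cov_rot_Z:
  assumes p: "p \<in> M \<inter> U"
  shows "levi \<theta> p (cov \<Gamma> rot (Z \<gamma>) p) (bar Z \<sigma> p) = \<i> * dir (Z \<gamma> p) (Lb \<sigma>) p + \<i> * P \<gamma> \<sigma> p * gradlam_norm2 p"
proof -
  note d = theta_diff_U[OF p]
  have b: "cbilinear (\<Gamma> p)" using p U_subset_W bilinear_Gamma by blast
  have rot: "rot p = cscale (lam p) (reeb p) + cscale \<i> (gradlam p) + cscale (- \<i>) (cconj (gradlam p))"
    unfolding reeb_def using lam_nz_U[OF p] by (intro cvec_eqI) simp_all
  have "torsion \<Gamma> rot (Z \<gamma>) p = cscale (lam p) (torsion \<Gamma> reeb (Z \<gamma>) p) + cscale \<i> (torsion \<Gamma> gradlam (Z \<gamma>) p)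
      + cscale (- \<i>) (torsion \<Gamma> (\<lambda>q. cconj (gradlam q)) (Z \<gamma>) p)"
    unfolding torsion_eq rot 
    by (intro cvec_eqI) (simp_all add: cbilinearD[OF b] algebra_simps)
  moreover have "torsion \<Gamma> gradlam (Z \<gamma>) p = (\<Sum>\<tau>\<in>UNIV. cscale (gradlam_coeff \<tau> p) (torsion \<Gamma> (Z \<tau>) (Z \<gamma>) p))"
    unfolding torsion_eq gradlam_def 
    by (intro cvec_eqI) (simp_all add: cbilinearD[OF b] sum_2 algebra_simps)
  moreover have "torsion \<Gamma> (\<lambda>q. cconj (gradlam q)) (Z \<gamma>) p = (\<Sum>\<tau>\<in>UNIV. cscale (- cnj (gradlam_coeff \<tau> p)) (torsion \<Gamma> (Z \<gamma>) (bar Z \<tau>) p))"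
    unfolding torsion_eq gradlam_def bar_eq 
    by (intro cvec_eqI) (simp_all add: cbilinearD[OF b] sum_2 cconj_add cconj_cscale algebra_simps)
  moreover have "(\<Sum>\<tau>\<in>UNIV. cscale (- cnj (gradlam_coeff \<tau> p)) (cscale (\<i> * lam p * P \<gamma> \<tau> p) (reeb p))) = cscale (- \<i> * L \<gamma> p) (reeb p)"
  proof -
    have "(\<Sum>\<tau>\<in>UNIV. - cnj (gradlam_coeff \<tau> p) * (\<i> * lam p * P \<gamma> \<tau> p)) = - \<i> * lam p * (\<Sum>\<tau>\<in>UNIV. cnj (gradlam_coeff \<tau> p) * P \<gamma> \<tau> p)"
      by (simp add: sum_2 algebra_simps)
    also have "\<dots> = - \<i> * L \<gamma> p" using lam_nz_U[OF p] by (simp add: cnj_gradlam_coeff_P[OF p])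
    finally show ?thesis by (simp add: cscale_algebra(3) sum_2 flip: cscale_algebra(2))
  qed
  ultimately have t: "torsion \<Gamma> rot (Z \<gamma>) p = cscale (lam p) (torsion \<Gamma> reeb (Z \<gamma>) p) + cscale (- L \<gamma> p) (reeb p)"
    by (intro cvec_eqI) (simp_all add: torsion_frame[OF p] cscale_algebra(6) i_times_i_times mult.assoc)
  have "torsion \<Gamma> rot (Z \<gamma>) p = cov \<Gamma> rot (Z \<gamma>) p - cov \<Gamma> (Z \<gamma>) rot p"
    using bracket_rot_frame[of a p \<gamma>] rad2_nz[of p] in_V[OF p] by (simp add: torsion_def)
  then have c: "cov \<Gamma> rot (Z \<gamma>) p = cov \<Gamma> (Z \<gamma>) rot p + cscale (lam p) (torsion \<Gamma> reeb (Z \<gamma>) p) + cscale (- L \<gamma> p) (reeb p)"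
    using t by (simp add: algebra_simps)
  have "levi \<theta> p (cov \<Gamma> rot (Z \<gamma>) p) (bar Z \<sigma> p) = levi \<theta> p (cov \<Gamma> (Z \<gamma>) rot p) (bar Z \<sigma> p)"
    unfolding c using levi_T01_Zbar[OF p torsion_frame(3)[OF p]] levi_reeb[OF p Zbar_CT[OF in_V[OF p]]]
    by (simp add: levi_add_left[OF d] levi_cscale_left[OF d])
  moreover have "dir (Z \<gamma> p) (\<lambda>q. \<i> * Lb \<sigma> q) p = levi \<theta> p (cov \<Gamma> (Z \<gamma>) rot p) (bar Z \<sigma> p)
      + levi \<theta> p (rot p) (cov \<Gamma> (Z \<gamma>) (bar Z \<sigma>) p)"
    using levi_rot_Zbar in_V open_U smooth_L(2)
    by (intro levi_parallel[OF tangent_Z(1) tangent_Z(3) tangent_Z(2) p] smooth_on_mult smooth_on_const) auto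
  moreover have "dir (Z \<gamma> p) (\<lambda>q. \<i> * Lb \<sigma> q) p = \<i> * dir (Z \<gamma> p) (Lb \<sigma>) p"
    using smooth_on_imp_differentiable[OF smooth_L(2)] p
    by (intro has_dir_imp_dir has_dir_eq[OF has_dir_mult[OF has_dir_const has_dir_dir]]) auto
  moreover have "cov \<Gamma> (Z \<gamma>) (bar Z \<sigma>) p = cscale (- P \<gamma> \<sigma> p) (cconj (gradlam p))"
    by (simp add: cov_Zbar[OF p] cov_Zbar_Z[OF p] cconj_cscale cnj_hess)
  ultimately show ?thesis
    by (simp add: levi_cscale_right[OF d] levi_cconj_gradlam(6)[OF p] algebra_simps)
qed

lemma cnj_dir_Lb: "p \<in> U \<Longrightarrow> cnj (dir (Z \<gamma> p) (Lb \<sigma>) p) = dir (bar Z \<gamma> p) (L \<sigma>) p"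
proof -
  assume p: "p \<in> U"
  have "has_dir (bar Z \<gamma> p) p (\<lambda>q. cnj (Lb \<sigma> q)) (cnj (dir (Z \<gamma> p) (Lb \<sigma>) p))"
    using has_dir_cnj[OF has_dir_dir[OF smooth_on_imp_differentiable[OF smooth_L(2) p]], of "bar Z \<gamma> p"]
    by (simp add: bar_def)
  then have "has_dir (bar Z \<gamma> p) p (L \<sigma>) (cnj (dir (Z \<gamma> p) (Lb \<sigma>) p))"
    using dir_Zbar_lam U_subset_V by (elim has_dir_cong[OF open_U p, rotated]) auto
  then show ?thesis by (simp add: has_dir_def)
qed

text \<open>Differentiating the Levi form \<open>\<lambda> P\<close> along \<open>T\<^sub>0\<close>, under which \<open>P\<close> is invariant, gives the bracket relation
  \<open>[Z\<^sub>\<gamma>, bar Z\<^sub>\<sigma>] \<lambda> = - \<i> P\<^sub>\<gamma>\<^sub>\<sigma> T\<^sub>0 \<lambda>\<close> from the parallelism of \<open>d\<theta>\<close>, without an appeal to the symmetry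
  of second derivatives.\<close>
lemma commutator_lam:
  assumes p: "p \<in> M \<inter> U"
  shows "dir (Z \<gamma> p) (Lb \<sigma>) p = dir (bar Z \<sigma> p) (L \<gamma>) p - \<i> * P \<gamma> \<sigma> p * dir (rot p) lam p"
proof -
  note d = theta_diff_U[OF p]
  have s: "smooth_on U (\<lambda>q. lam q * P \<gamma> \<sigma> q)"
    using open_U smooth_explicit smooth_lam by (intro smooth_on_mult)
  have nz: "rad2 a p \<noteq> 0" using p in_V rad2_nz by blast
  have m: "dir (rot p) (\<lambda>q. lam q * P \<gamma> \<sigma> q) p = levi \<theta> p (cov \<Gamma> rot (Z \<gamma>) p) (bar Z \<sigma> p) +
      levi \<theta> p (Z \<gamma> p) (cov \<Gamma> rot (bar Z \<sigma>) p)"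
    using levi_Z_Zbar in_V by (intro levi_parallel[OF tangent_Z(3) tangent_Z(1) tangent_Z(2) p s]) auto
  have "dir (rot p) (\<lambda>q. lam q * P \<gamma> \<sigma> q) p = dir (rot p) lam p * P \<gamma> \<sigma> p"
    using has_dir_mult[OF has_dir_dir[OF lam_differentiable] has_dir_rot_hess[OF nz]] in_V[OF p]
    by (auto intro!: has_dir_imp_dir)
  moreover have "levi \<theta> p (Z \<gamma> p) (cov \<Gamma> rot (bar Z \<sigma>) p) = cnj (levi \<theta> p (cov \<Gamma> rot (Z \<sigma>) p) (bar Z \<gamma> p))"
    using levi_cconj[OF d, of "bar Z \<gamma> p" "cov \<Gamma> rot (Z \<sigma>) p"] levi_antisym[of \<theta> p "bar Z \<gamma> p"]
    by (simp add: cov_Zbar[OF p]) (simp add: bar_def)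
  ultimately have "dir (rot p) lam p * P \<gamma> \<sigma> p = \<i> * dir (Z \<gamma> p) (Lb \<sigma>) p - \<i> * dir (bar Z \<sigma> p) (L \<gamma>) p"
    using m p by (simp add: levi_cov_rot_Z[OF p] cnj_dir_Lb cnj_hess algebra_simps)
  then have "\<i> * (dir (rot p) lam p * P \<gamma> \<sigma> p) = - (dir (Z \<gamma> p) (Lb \<sigma>) p) + dir (bar Z \<sigma> p) (L \<gamma>) p"
    by (simp only: right_diff_distrib i_times_i_times) simp
  then show ?thesis by (simp add: algebra_simps)
qed

lemma T10_eqI:
  assumes p: "p \<in> M \<inter> U" and X: "X \<in> T10 (ellipsoid_fun a) p" "Y \<in> T10 (ellipsoid_fun a) p"
    and eq: "\<And>\<sigma>. levi \<theta> p X (bar Z \<sigma> p) = levi \<theta> p Y (bar Z \<sigma> p)"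
  shows "X = Y"
proof -
  note d = theta_diff_U[OF p]
  have "X + cscale (-1) Y \<in> T10 (ellipsoid_fun a) p"
    using X by (auto simp: T10_def intro!: CT_add CT_cscale) (simp add: cscale_def)
  moreover have "p $ 1 \<noteq> 0" using p by (auto simp: U_def V_def)
  moreover define c where "c \<alpha> = (if \<alpha> = 1 then fst (X + cscale (-1) Y) $ 3 else fst (X + cscale (-1) Y) $ 2)" for \<alpha> :: 2
  ultimately have c: "X + cscale (-1) Y = (\<Sum>\<alpha>\<in>UNIV. cscale (c \<alpha>) (Z \<alpha> p))"
    using T10_expand[of p a "X + cscale (-1) Y"] p by simp
  have "levi \<theta> p (X + cscale (-1) Y) (bar Z \<sigma> p) = 0" for \<sigma>
    using eq by (simp add: levi_add_left[OF d] levi_cscale_left[OF d])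
  then have z: "(\<Sum>\<alpha>\<in>UNIV. c \<alpha> * P \<alpha> \<sigma> p) = 0" for \<sigma>
    unfolding c using lam_nz_U[OF p]
    by (auto simp: levi_sum_left[OF d] levi_cscale_left[OF d] levi_Z_Zbar[OF in_V[OF p]] mult.left_commute[of _ "lam p"] simp flip: sum_distrib_left)
  have "c \<tau> = 0" for \<tau>
  proof -
    have "(\<Sum>\<alpha>\<in>UNIV. c \<alpha> * (\<Sum>\<sigma>\<in>UNIV. P \<alpha> \<sigma> p * hess_inv a \<tau> \<sigma> p)) = (\<Sum>\<sigma>\<in>UNIV. (\<Sum>\<alpha>\<in>UNIV. c \<alpha> * P \<alpha> \<sigma> p) * hess_inv a \<tau> \<sigma> p)"
      by (simp add: sum_2 algebra_simps)
    also have "\<dots> = 0" by (simp add: z)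
    finally show ?thesis
      using in_V[OF p] exhaust_2[of \<tau>] by (subst (asm) hess_hess_inv) (auto simp: rad2_nz drho_norm2_nz sum_2)
  qed
  then have "X + cscale (-1) Y = 0" unfolding c by (simp add: cscale_algebra)
  then show ?thesis by (simp add: cscale_algebra)
qed

text \<open>The (1,0)-gradient of the potential with respect to the Hessian \<open>P\<close>.\<close>
definition dpot_up where "dpot_up \<tau> p = rad2 a p * cnj (drho a \<tau> p) / drho_norm2 a p"
definition grad_pot where "grad_pot p = (\<Sum>\<tau>\<in>UNIV. cscale (dpot_up \<tau> p) (Z \<tau> p))"
text \<open>The logarithmic derivative of \<open>\<lambda>/q\<close>, the factor between \<open>\<theta>\<close> and the form induced by the
  standard defining function.\<close>
definition dlog where "dlog \<alpha> p = dpot a \<alpha> p + L \<alpha> p / lam p"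

lemma dpot_up_P:
  assumes "p \<in> V" shows "(\<Sum>\<tau>\<in>UNIV. dpot_up \<tau> p * P \<tau> \<sigma> p) = cnj (dpot a \<sigma> p)"
proof -
  define q where "q = rad2 a p"
  define x where "x = drho a 1 p" define y where "y = drho a 2 p"
  have g: "drho_norm2 a p = q + x * cnj x + y * cnj y" by (simp add: drho_norm2_def q_def x_def y_def sum_2)
  have nz: "q \<noteq> 0" "q + x * cnj x + y * cnj y \<noteq> 0" using rad2_nz[OF assms] drho_norm2_nz[OF assms] by (simp_all add: g q_def)
  have "cnj q = q" by (simp add: q_def)
  then show ?thesis
    unfolding dpot_up_def hess_def dpot_def g q_def[symmetric] using nz exhaust_2[of \<sigma>]
    by (auto simp: sum_2 g simp flip: q_def x_def y_def) (simp add: divide_simps, simp add: algebra_simps)+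
qed

end

section \<open>Curvature\<close>

lemma matrix_inv_eqI:
  fixes A B :: "complex^'n^'n"
  assumes "A ** B = mat 1" "B ** A = mat 1"
  shows "matrix_inv A = B"
proof -
  have "A ** matrix_inv A = mat 1 \<and> matrix_inv A ** A = mat 1"
    unfolding matrix_inv_def by (rule someI[of _ B]) (simp add: assms)
  then show ?thesis by (metis assms(2) matrix_mul_assoc matrix_mul_lid matrix_mul_rid)
qed

context tw_ellipsoid
begin

text \<open>Compare Levi products with the conjugate frame: \<open>conn_low\<close> regroups into these three terms.\<close>
lemma cov_Z_Z:
  assumes p: "p \<in> M \<inter> U"
  shows "cov \<Gamma> (Z \<alpha>) (Z \<gamma>) p =
    cscale (dlog \<alpha> p) (Z \<gamma> p) + cscale (dlog \<gamma> p) (Z \<alpha> p) + cscale (pot20 a \<alpha> \<gamma> p) (grad_pot p)"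
proof (rule T10_eqI[OF p cov_T10[OF tangent_Z(1) p]])
  note d = theta_diff_U[OF p] and pv = in_V[OF p]
  have snd: "snd (grad_pot p) = 0"
    by (simp add: grad_pot_def sum_2 cscale_def)
  have "grad_pot p \<in> CT (ellipsoid_fun a) p"
    unfolding grad_pot_def by (intro CT_sum CT_cscale Z_CT pv)
  then show "cscale (dlog \<alpha> p) (Z \<gamma> p) + cscale (dlog \<gamma> p) (Z \<alpha> p) + cscale (pot20 a \<alpha> \<gamma> p) (grad_pot p)
      \<in> T10 (ellipsoid_fun a) p"
    using Z_CT[OF pv] by (auto simp: T10_def intro!: CT_add CT_cscale) (simp add: cscale_def snd)
  fix \<sigma>
  have "levi \<theta> p (grad_pot p) (bar Z \<sigma> p) = lam p * (\<Sum>\<tau>\<in>UNIV. dpot_up \<tau> p * P \<tau> \<sigma> p)"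
    unfolding grad_pot_def
    by (simp only: levi_sum_left[OF d] levi_cscale_left[OF d] levi_Z_Zbar[OF pv] sum_distrib_left mult.left_commute)
  then have "levi \<theta> p (grad_pot p) (bar Z \<sigma> p) = lam p * cnj (dpot a \<sigma> p)"
    using dpot_up_P pv by simp
  then show "levi \<theta> p (cov \<Gamma> (Z \<alpha>) (Z \<gamma>) p) (bar Z \<sigma> p) =
      levi \<theta> p (cscale (dlog \<alpha> p) (Z \<gamma> p) + cscale (dlog \<gamma> p) (Z \<alpha> p) + cscale (pot20 a \<alpha> \<gamma> p) (grad_pot p)) (bar Z \<sigma> p)"
    unfolding levi_cov_Z_Z[OF p] levi_add_left[OF d] levi_cscale_left[OF d] levi_Z_Zbar[OF pv] conn_low_def dlog_def
    using lam_nz_U[OF p] by (simp add: field_simps)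
qed

lemma cov_Z_Zbar:
  assumes p: "p \<in> M \<inter> U"
  shows "cov \<Gamma> (Z \<alpha>) (bar Z \<sigma>) p = cscale (- P \<alpha> \<sigma> p) (cconj (gradlam p))"
  by (simp add: cov_Zbar[OF p] cov_Zbar_Z[OF p] cconj_cscale cnj_hess)

text \<open>One minus the square length of \<open>\<partial>\<psi>\<close> with respect to \<open>P\<close> (\<open>dpot_norm\<close>).\<close>
definition ratio where "ratio p = rad2 a p / drho_norm2 a p"
text \<open>This is \<open>- \<lambda> bar Z\<^sub>\<beta> (Z\<^sub>\<alpha> log \<lambda>)\<close>. All second derivatives of \<open>\<lambda>\<close> in the curvature can be collected in it.\<close>
definition hess_lam where "hess_lam \<alpha> \<beta> p = L \<alpha> p * Lb \<beta> p / lam p - dir (bar Z \<beta> p) (L \<alpha>) p"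

lemma dpot_norm: "p \<in> V \<Longrightarrow> (\<Sum>\<tau>\<in>UNIV. cnj (dpot_up \<tau> p) * cnj (dpot a \<tau> p)) = 1 - ratio p"
proof -
  assume p: "p \<in> V"
  have "cnj (dpot_up \<tau> p) * cnj (dpot a \<tau> p) = drho a \<tau> p * cnj (drho a \<tau> p) / drho_norm2 a p" for \<tau>
    using rad2_nz[OF p] by (simp add: dpot_up_def dpot_def)
  then have "(\<Sum>\<tau>\<in>UNIV. cnj (dpot_up \<tau> p) * cnj (dpot a \<tau> p)) = (drho_norm2 a p - rad2 a p) / drho_norm2 a p"
    by (simp add: drho_norm2_def flip: sum_divide_distrib)
  then show ?thesis using drho_norm2_nz[OF p] by (simp add: ratio_def diff_divide_distrib)
qed

lemma levi_cov_grad_pot: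
  assumes p: "p \<in> M \<inter> U"
  shows "levi \<theta> p (cov \<Gamma> (Z \<alpha>) (Z \<gamma>) p) (cconj (grad_pot p)) =
    lam p * (2 * dpot a \<alpha> p * dpot a \<gamma> p + pot20 a \<alpha> \<gamma> p * (1 - ratio p)) + L \<alpha> p * dpot a \<gamma> p + L \<gamma> p * dpot a \<alpha> p"
proof -
  note d = theta_diff_U[OF p] and pv = in_V[OF p]
  have s: "(\<Sum>\<tau>\<in>UNIV. cnj (dpot_up \<tau> p) * P \<sigma> \<tau> p) = dpot a \<sigma> p" for \<sigma>
    using arg_cong[OF dpot_up_P[of p \<sigma>], of cnj] pv by (simp add: cnj_hess)
  have "cconj (grad_pot p) = (\<Sum>\<tau>\<in>UNIV. cscale (cnj (dpot_up \<tau> p)) (bar Z \<tau> p))"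
    by (simp add: grad_pot_def cconj_sum cconj_cscale bar_def)
  then have "levi \<theta> p (cov \<Gamma> (Z \<alpha>) (Z \<gamma>) p) (cconj (grad_pot p)) = (\<Sum>\<tau>\<in>UNIV. cnj (dpot_up \<tau> p) * conn_low \<alpha> \<gamma> \<tau> p)"
    by (simp add: levi_sum_right[OF d] levi_cscale_right[OF d] levi_cov_Z_Z[OF p])
  also have "\<dots> = lam p * (dpot a \<alpha> p * (\<Sum>\<tau>\<in>UNIV. cnj (dpot_up \<tau> p) * P \<gamma> \<tau> p) + dpot a \<gamma> p * (\<Sum>\<tau>\<in>UNIV. cnj (dpot_up \<tau> p) * P \<alpha> \<tau> p)
       + pot20 a \<alpha> \<gamma> p * (\<Sum>\<tau>\<in>UNIV. cnj (dpot_up \<tau> p) * cnj (dpot a \<tau> p)))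
     + L \<alpha> p * (\<Sum>\<tau>\<in>UNIV. cnj (dpot_up \<tau> p) * P \<gamma> \<tau> p) + L \<gamma> p * (\<Sum>\<tau>\<in>UNIV. cnj (dpot_up \<tau> p) * P \<alpha> \<tau> p)"
    by (simp add: conn_low_def sum_2 algebra_simps)
  also have "\<dots> = lam p * (2 * dpot a \<alpha> p * dpot a \<gamma> p + pot20 a \<alpha> \<gamma> p * (1 - ratio p)) + L \<alpha> p * dpot a \<gamma> p + L \<gamma> p * dpot a \<alpha> p"
    unfolding s using pv by (subst dpot_norm) (simp_all add: algebra_simps)
  finally show ?thesis .
qed

lemma dir_Zbar_conn_low:
  assumes p: "p \<in> M \<inter> U"
  shows "dir (bar Z \<beta> p) (conn_low \<alpha> \<gamma> \<sigma>) p =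
    Lb \<beta> p * (dpot a \<alpha> p * P \<gamma> \<sigma> p + dpot a \<gamma> p * P \<alpha> \<sigma> p + pot20 a \<alpha> \<gamma> p * cnj (dpot a \<sigma> p))
    + lam p * (P \<alpha> \<beta> p * P \<gamma> \<sigma> p + dpot a \<alpha> p * (cnj (dpot a \<beta> p) * P \<gamma> \<sigma> p + cnj (dpot a \<sigma> p) * P \<gamma> \<beta> p + pot20 a \<sigma> \<beta> p * dpot a \<gamma> p)
       + P \<gamma> \<beta> p * P \<alpha> \<sigma> p + dpot a \<gamma> p * (cnj (dpot a \<beta> p) * P \<alpha> \<sigma> p + cnj (dpot a \<sigma> p) * P \<alpha> \<beta> p + pot20 a \<sigma> \<beta> p * dpot a \<alpha> p)
       + pot20 a \<alpha> \<gamma> p * cnj (dpot a \<beta> p) * cnj (dpot a \<sigma> p) + pot20 a \<alpha> \<gamma> p * (pot20 a \<sigma> \<beta> p + cnj (dpot a \<sigma> p) * cnj (dpot a \<beta> p)))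
    + dir (bar Z \<beta> p) (L \<alpha>) p * P \<gamma> \<sigma> p + L \<alpha> p * (cnj (dpot a \<beta> p) * P \<gamma> \<sigma> p + cnj (dpot a \<sigma> p) * P \<gamma> \<beta> p + pot20 a \<sigma> \<beta> p * dpot a \<gamma> p)
    + dir (bar Z \<beta> p) (L \<gamma>) p * P \<alpha> \<sigma> p + L \<gamma> p * (cnj (dpot a \<beta> p) * P \<alpha> \<sigma> p + cnj (dpot a \<sigma> p) * P \<alpha> \<beta> p + pot20 a \<sigma> \<beta> p * dpot a \<alpha> p)"
proof -
  have nz: "rad2 a p \<noteq> 0" using p in_V rad2_nz by blast
  have l: "has_dir (cconj (Z \<beta> p)) p lam (Lb \<beta> p)"
    using has_dir_dir[OF lam_differentiable, of p "bar Z \<beta> p"] in_V[OF p] by (simp add: bar_def)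
  have L: "has_dir (cconj (Z \<beta> p)) p (L \<alpha>) (dir (bar Z \<beta> p) (L \<alpha>) p)" for \<alpha>
    using has_dir_dir[OF smooth_on_imp_differentiable[OF smooth_L(1)], of p "bar Z \<beta> p"] p by (simp add: bar_def)
  have ps: "has_dir (cconj (Z \<beta> p)) p (\<lambda>q. cnj (dpot a \<sigma> q)) (pot20 a \<sigma> \<beta> p + cnj (dpot a \<sigma> p) * cnj (dpot a \<beta> p))"
    using has_dir_cnj[of "cconj (Z \<beta> p)" p "dpot a \<sigma>"] has_dir_frame_dpot[OF nz, of a \<beta> \<sigma>]
    by (fastforce simp: mult.commute)
  have "has_dir (cconj (Z \<beta> p)) p (conn_low \<alpha> \<gamma> \<sigma>) (dir (bar Z \<beta> p) (conn_low \<alpha> \<gamma> \<sigma>) p)"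
    using has_dir_dir[OF smooth_on_imp_differentiable[OF smooth_conn_low], of p "bar Z \<beta> p"] p by (simp add: bar_def)
  moreover have "has_dir (cconj (Z \<beta> p)) p (conn_low \<alpha> \<gamma> \<sigma>) (
    Lb \<beta> p * (dpot a \<alpha> p * P \<gamma> \<sigma> p + dpot a \<gamma> p * P \<alpha> \<sigma> p + pot20 a \<alpha> \<gamma> p * cnj (dpot a \<sigma> p))
    + lam p * (P \<alpha> \<beta> p * P \<gamma> \<sigma> p + dpot a \<alpha> p * (cnj (dpot a \<beta> p) * P \<gamma> \<sigma> p + cnj (dpot a \<sigma> p) * P \<gamma> \<beta> p + pot20 a \<sigma> \<beta> p * dpot a \<gamma> p)
       + P \<gamma> \<beta> p * P \<alpha> \<sigma> p + dpot a \<gamma> p * (cnj (dpot a \<beta> p) * P \<alpha> \<sigma> p + cnj (dpot a \<sigma> p) * P \<alpha> \<beta> p + pot20 a \<sigma> \<beta> p * dpot a \<alpha> p)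
       + pot20 a \<alpha> \<gamma> p * cnj (dpot a \<beta> p) * cnj (dpot a \<sigma> p) + pot20 a \<alpha> \<gamma> p * (pot20 a \<sigma> \<beta> p + cnj (dpot a \<sigma> p) * cnj (dpot a \<beta> p)))
    + dir (bar Z \<beta> p) (L \<alpha>) p * P \<gamma> \<sigma> p + L \<alpha> p * (cnj (dpot a \<beta> p) * P \<gamma> \<sigma> p + cnj (dpot a \<sigma> p) * P \<gamma> \<beta> p + pot20 a \<sigma> \<beta> p * dpot a \<gamma> p)
    + dir (bar Z \<beta> p) (L \<gamma>) p * P \<alpha> \<sigma> p + L \<gamma> p * (cnj (dpot a \<beta> p) * P \<alpha> \<sigma> p + cnj (dpot a \<sigma> p) * P \<alpha> \<beta> p + pot20 a \<sigma> \<beta> p * dpot a \<alpha> p))"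
    unfolding conn_low_def[abs_def]
    by (rule has_dir_eq, (rule has_dir_add has_dir_mult l L ps has_dir_framebar_dpot[OF nz] has_dir_framebar_hess[OF nz] has_dir_framebar_pot20[OF nz])+)
       (simp only: ring_distribs mult_ac add_ac)
  ultimately show ?thesis by (simp add: has_dir_def)
qed

text \<open>Each term of the curvature is rewritten by \<open>levi_parallel\<close> as a derivative of a known Levi product minus
  a Levi product of known fields. Second derivatives of \<open>\<lambda>\<close> occur in different orders; by
  \<open>commutator_lam\<close> the difference is a multiple of \<open>P\<close>, which gives all of them the fully symmetric
  shape. The quadratic terms in \<open>\<psi>\<^sub>\<alpha>\<close> cancel, and the defect leaves the first summand.\<close>
theorem Rm_eq:
  assumes p: "p \<in> M \<inter> U"
  shows "Rm \<theta> \<Gamma> Z \<alpha> \<beta> \<gamma> \<sigma> p = - (lam p * ratio p * pot20 a \<alpha> \<gamma> p * pot20 a \<beta> \<sigma> p)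
    + (hess_lam \<alpha> \<beta> p * P \<gamma> \<sigma> p + hess_lam \<gamma> \<beta> p * P \<alpha> \<sigma> p + hess_lam \<alpha> \<sigma> p * P \<gamma> \<beta> p + hess_lam \<gamma> \<sigma> p * P \<alpha> \<beta> p)
    + (\<i> * dir (rot p) lam p - lam p - gradlam_norm2 p) * (P \<alpha> \<beta> p * P \<gamma> \<sigma> p + P \<alpha> \<sigma> p * P \<gamma> \<beta> p)"
proof -
  note d = theta_diff_U[OF p] and pv = in_V[OF p]
  have nz: "rad2 a p \<noteq> 0" using pv rad2_nz by blast
  have sm: "smooth_on U (\<lambda>q. - P \<gamma> \<beta> q * Lb \<sigma> q)"
    using open_U smooth_explicit smooth_L by (intro smooth_on_mult smooth_on_uminus)
  have t1: "dir (Z \<alpha> p) (\<lambda>q. - P \<gamma> \<beta> q * Lb \<sigma> q) p =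
      levi \<theta> p (cov \<Gamma> (Z \<alpha>) (cov \<Gamma> (bar Z \<beta>) (Z \<gamma>)) p) (bar Z \<sigma> p)
      + levi \<theta> p (cov \<Gamma> (bar Z \<beta>) (Z \<gamma>) p) (cov \<Gamma> (Z \<alpha>) (bar Z \<sigma>) p)"
    by (intro levi_parallel[OF tangent_Z(1) tangent_cov[OF tangent_Z(2) tangent_Z(1)] tangent_Z(2) p sm])
       (simp add: cov_Zbar_Z levi_cscale_left theta_diff_U levi_gradlam)
  have D1: "has_dir (Z \<alpha> p) p (Lb \<sigma>) (dir (Z \<alpha> p) (Lb \<sigma>) p)" for \<alpha> \<sigma>
    using smooth_on_imp_differentiable[OF smooth_L(2)] p by (intro has_dir_dir) auto
  have b: "dir (Z \<alpha> p) (\<lambda>q. - P \<gamma> \<beta> q * Lb \<sigma> q) p = - P \<gamma> \<beta> p * dir (Z \<alpha> p) (Lb \<sigma>) p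
      - (dpot a \<alpha> p * P \<gamma> \<beta> p + dpot a \<gamma> p * P \<alpha> \<beta> p + pot20 a \<alpha> \<gamma> p * cnj (dpot a \<beta> p)) * Lb \<sigma> p"
    by (rule has_dir_imp_dir, rule has_dir_eq, (rule dir_intros D1 nz)+) (simp add: pot20_sym ring_distribs)
  have w1: "levi \<theta> p (cov \<Gamma> (bar Z \<beta>) (Z \<gamma>) p) (cov \<Gamma> (Z \<alpha>) (bar Z \<sigma>) p) = P \<gamma> \<beta> p * P \<alpha> \<sigma> p * gradlam_norm2 p"
    by (simp add: cov_Zbar_Z[OF p] cov_Z_Zbar[OF p] levi_cscale_left[OF d] levi_cscale_right[OF d] levi_cconj_gradlam[OF p])
  have t2: "dir (bar Z \<beta> p) (conn_low \<alpha> \<gamma> \<sigma>) p =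
      levi \<theta> p (cov \<Gamma> (bar Z \<beta>) (cov \<Gamma> (Z \<alpha>) (Z \<gamma>)) p) (bar Z \<sigma> p)
      + levi \<theta> p (cov \<Gamma> (Z \<alpha>) (Z \<gamma>) p) (cov \<Gamma> (bar Z \<beta>) (bar Z \<sigma>) p)"
    by (intro levi_parallel[OF tangent_Z(2) tangent_cov[OF tangent_Z(1) tangent_Z(1)] tangent_Z(2) p smooth_conn_low])
       (rule levi_cov_Z_Z)
  have w2: "levi \<theta> p (cov \<Gamma> (Z \<alpha>) (Z \<gamma>) p) (cov \<Gamma> (bar Z \<beta>) (bar Z \<sigma>) p) =
      cnj (dlog \<beta> p) * conn_low \<alpha> \<gamma> \<sigma> p + cnj (dlog \<sigma> p) * conn_low \<alpha> \<gamma> \<beta> p + pot20 a \<beta> \<sigma> p *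
      (lam p * (2 * dpot a \<alpha> p * dpot a \<gamma> p + pot20 a \<alpha> \<gamma> p * (1 - ratio p)) + L \<alpha> p * dpot a \<gamma> p + L \<gamma> p * dpot a \<alpha> p)"
  proof -
    have c: "cov \<Gamma> (bar Z \<beta>) (bar Z \<sigma>) p = cscale (cnj (dlog \<beta> p)) (bar Z \<sigma> p) + cscale (cnj (dlog \<sigma> p)) (bar Z \<beta> p)
        + cscale (pot20 a \<beta> \<sigma> p) (cconj (grad_pot p))"
      unfolding cov_Zbar(1)[OF p] cov_Z_Z[OF p, of \<beta> \<sigma>] cconj_add cconj_cscale bar_def by simp
    show ?thesis
      unfolding c levi_add_right[OF d] levi_cscale_right[OF d] levi_cov_grad_pot[OF p] levi_cov_Z_Z[OF p] ..
  qed
  have t3: "levi \<theta> p (cov \<Gamma> (bracket (Z \<alpha>) (bar Z \<beta>)) (Z \<gamma>) p) (bar Z \<sigma> p) =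
      P \<alpha> \<beta> p * (dir (Z \<gamma> p) (Lb \<sigma>) p + P \<gamma> \<sigma> p * gradlam_norm2 p)"
  proof -
    have "cov \<Gamma> (bracket (Z \<alpha>) (bar Z \<beta>)) (Z \<gamma>) p = cscale (- \<i> * P \<alpha> \<beta> p) (cov \<Gamma> rot (Z \<gamma>) p)"
      using p U_subset_W by (intro cov_cscale_left bilinear_Gamma bracket_frame_framebar[OF nz]) auto
    then show ?thesis
      by (simp add: levi_cscale_left[OF d] levi_cov_rot_Z[OF p] ring_distribs mult_ac i_times_i_times)
  qed
  \<comment> \<open>in terms of the logarithmic derivatives \<open>v\<close> of \<open>\<lambda>\<close> the claim is a polynomial identity\<close>
  define l where "l = lam p"
  define v where "v = (\<lambda>\<alpha>. L \<alpha> p / lam p)"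
  have lnz: "l \<noteq> 0" using lam_nz_U[OF p] by (simp add: l_def)
  have Lv: "L \<alpha> p = l * v \<alpha>" for \<alpha> using lnz by (simp add: l_def v_def)
  have Lbv: "Lb \<alpha> p = l * cnj (v \<alpha>)" for \<alpha>
    using pv lnz by (simp add: dir_Zbar_lam v_def l_def)
  have omv: "dlog \<alpha> p = dpot a \<alpha> p + v \<alpha>" for \<alpha> by (simp add: dlog_def v_def)
  have HHv: "hess_lam \<alpha> \<beta> p = l * v \<alpha> * cnj (v \<beta>) - dir (bar Z \<beta> p) (L \<alpha>) p" for \<alpha> \<beta>
    using lnz by (simp add: hess_lam_def Lv Lbv flip: l_def)
  have "Rm \<theta> \<Gamma> Z \<alpha> \<beta> \<gamma> \<sigma> p =
      levi \<theta> p (cov \<Gamma> (Z \<alpha>) (cov \<Gamma> (bar Z \<beta>) (Z \<gamma>)) p) (bar Z \<sigma> p)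
      - levi \<theta> p (cov \<Gamma> (bar Z \<beta>) (cov \<Gamma> (Z \<alpha>) (Z \<gamma>)) p) (bar Z \<sigma> p)
      - levi \<theta> p (cov \<Gamma> (bracket (Z \<alpha>) (bar Z \<beta>)) (Z \<gamma>) p) (bar Z \<sigma> p)"
    unfolding Rm_def curvature_def levi_diff_left[OF d] ..
  also have "\<dots> = (dir (Z \<alpha> p) (\<lambda>q. - P \<gamma> \<beta> q * Lb \<sigma> q) p - P \<gamma> \<beta> p * P \<alpha> \<sigma> p * gradlam_norm2 p)
      - (dir (bar Z \<beta> p) (conn_low \<alpha> \<gamma> \<sigma>) p - levi \<theta> p (cov \<Gamma> (Z \<alpha>) (Z \<gamma>) p) (cov \<Gamma> (bar Z \<beta>) (bar Z \<sigma>) p))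
      - P \<alpha> \<beta> p * (dir (Z \<gamma> p) (Lb \<sigma>) p + P \<gamma> \<sigma> p * gradlam_norm2 p)"
    unfolding t1 t2 t3 w1 by simp
  also have "\<dots> = - (lam p * ratio p * pot20 a \<alpha> \<gamma> p * pot20 a \<beta> \<sigma> p)
    + (hess_lam \<alpha> \<beta> p * P \<gamma> \<sigma> p + hess_lam \<gamma> \<beta> p * P \<alpha> \<sigma> p + hess_lam \<alpha> \<sigma> p * P \<gamma> \<beta> p + hess_lam \<gamma> \<sigma> p * P \<alpha> \<beta> p)
    + (\<i> * dir (rot p) lam p - lam p - gradlam_norm2 p) * (P \<alpha> \<beta> p * P \<gamma> \<sigma> p + P \<alpha> \<sigma> p * P \<gamma> \<beta> p)"
    unfolding b w2 dir_Zbar_conn_low[OF p] commutator_lam[OF p] conn_low_def HHv omv Lv Lbv pot20_sym[of a \<sigma> \<beta>] l_def[symmetric]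
    by (simp add: ring_distribs)
  finally show ?thesis .
qed

end

section \<open>The Chern-Moser-Weyl tensor\<close>

context tw_ellipsoid
begin

lemma h_low_eq: "p \<in> M \<inter> U \<Longrightarrow> h_low \<theta> Z \<alpha> \<beta> p = lam p * P \<alpha> \<beta> p"
  unfolding h_low_def by (rule levi_Z_Zbar[OF in_V])

lemma P_hess_inv: "p \<in> V \<Longrightarrow> (\<Sum>\<beta>\<in>UNIV. P \<gamma> \<beta> p * hess_inv a \<alpha> \<beta> p) = delta \<gamma> \<alpha>"
  and hess_inv_P: "p \<in> V \<Longrightarrow> (\<Sum>\<alpha>\<in>UNIV. hess_inv a \<alpha> \<beta> p * P \<alpha> \<gamma> p) = delta \<beta> \<gamma>"
  by (simp_all add: hess_hess_inv hess_inv_hess rad2_nz drho_norm2_nz)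

lemma hess_inv_P_trace:
  assumes "p \<in> V"
  shows "(\<Sum>\<alpha>\<in>UNIV. \<Sum>\<beta>\<in>UNIV. hess_inv a \<alpha> \<beta> p * P \<alpha> \<beta> p) = 2"
proof -
  have "(\<Sum>\<alpha>\<in>UNIV. \<Sum>\<beta>\<in>UNIV. hess_inv a \<alpha> \<beta> p * P \<alpha> \<beta> p) = (\<Sum>\<beta>\<in>UNIV. \<Sum>\<alpha>\<in>UNIV. hess_inv a \<alpha> \<beta> p * P \<alpha> \<beta> p)"
    by (rule sum.swap)
  then show ?thesis by (simp add: hess_inv_P[OF assms])
qed

lemma h_up_eq:
  assumes p: "p \<in> M \<inter> U"
  shows "h_up \<theta> Z \<alpha> \<beta> p = hess_inv a \<alpha> \<beta> p / lam p"
proof -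
  have pv: "p \<in> V" using in_V[OF p] by simp
  have "matrix_inv (\<chi> \<mu> \<nu>. h_low \<theta> Z \<mu> \<nu> p) = (\<chi> \<beta> \<alpha>. hess_inv a \<alpha> \<beta> p / lam p)"
  proof (rule matrix_inv_eqI)
    show "(\<chi> \<mu> \<nu>. h_low \<theta> Z \<mu> \<nu> p) ** (\<chi> \<beta> \<alpha>. hess_inv a \<alpha> \<beta> p / lam p) = mat 1"
      using P_hess_inv[OF pv] lam_nz_U[OF p] by (simp add: matrix_matrix_mult_def mat_def vec_eq_iff h_low_eq[OF p] delta_def)
    show "(\<chi> \<beta> \<alpha>. hess_inv a \<alpha> \<beta> p / lam p) ** (\<chi> \<mu> \<nu>. h_low \<theta> Z \<mu> \<nu> p) = mat 1"
      using hess_inv_P[OF pv] lam_nz_U[OF p] by (simp add: matrix_matrix_mult_def mat_def vec_eq_iff h_low_eq[OF p] delta_def)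
  qed
  then show ?thesis by (simp add: h_up_def)
qed

text \<open>The factor \<open>\<kappa> = a\<^sup>2 / (q g)\<close>, the square length of \<open>dw\<close> with respect to \<open>P\<close>, and the trace-free part of
  \<open>- \<lambda> \<kappa> \<xi>\<^sub>\<alpha> \<xi>\<^sub>\<beta> \<xi>\<^sub>\<gamma> \<xi>\<^sub>\<sigma>\<close>. The factors \<open>\<lambda>\<close> of the Levi form cancel against those of its inverse.\<close>
definition weyl_size where "weyl_size p = (of_real a)\<^sup>2 / (rad2 a p * drho_norm2 a p)"
definition dw_norm2 where "dw_norm2 p = hess_inv a 1 1 p"

definition weyl where "weyl \<alpha> \<beta> \<gamma> \<sigma> p = - (lam p * weyl_size p * (dw \<alpha> * dw \<beta> * dw \<gamma> * dw \<sigma>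
    - dw_norm2 p / 4 * (dw \<alpha> * dw \<beta> * P \<gamma> \<sigma> p + dw \<gamma> * dw \<beta> * P \<alpha> \<sigma> p + dw \<alpha> * dw \<sigma> * P \<gamma> \<beta> p + dw \<gamma> * dw \<sigma> * P \<alpha> \<beta> p)
    + dw_norm2 p * dw_norm2 p / 12 * (P \<alpha> \<beta> p * P \<gamma> \<sigma> p + P \<alpha> \<sigma> p * P \<gamma> \<beta> p)))"

lemma Ric_eq:
  assumes p: "p \<in> M \<inter> U"
  shows "lam p * Ric \<theta> \<Gamma> Z \<gamma> \<sigma> p = - (lam p * weyl_size p * dw_norm2 p * dw \<gamma> * dw \<sigma>)
    + (\<Sum>\<alpha>\<in>UNIV. \<Sum>\<beta>\<in>UNIV. hess_inv a \<alpha> \<beta> p * hess_lam \<alpha> \<beta> p) * P \<gamma> \<sigma> p + 4 * hess_lam \<gamma> \<sigma> p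
    + 3 * (\<i> * dir (rot p) lam p - lam p - gradlam_norm2 p) * P \<gamma> \<sigma> p"
proof -
  have pv: "p \<in> V" using in_V[OF p] by simp
  define c where "c = \<i> * dir (rot p) lam p - lam p - gradlam_norm2 p"
  have k: "lam p * ratio p * pot20 a \<alpha> \<gamma> p * pot20 a \<beta> \<sigma> p = lam p * weyl_size p * dw \<alpha> * dw \<gamma> * dw \<beta> * dw \<sigma>" for \<alpha> \<beta>
    using rad2_nz[OF pv] drho_norm2_nz[OF pv] by (simp add: ratio_def pot20_def weyl_size_def power2_eq_square field_simps)
  have 1: "(\<Sum>\<alpha>\<in>UNIV. \<Sum>\<beta>\<in>UNIV. hess_inv a \<alpha> \<beta> p * (lam p * ratio p * pot20 a \<alpha> \<gamma> p * pot20 a \<beta> \<sigma> p)) = lam p * weyl_size p * dw_norm2 p * dw \<gamma> * dw \<sigma>"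
    unfolding k by (simp add: sum_2 dw_norm2_def)
  \<comment> \<open>contracting with a factor \<open>P\<close> in the curvature just renames an index\<close>
  have r1: "(\<Sum>\<alpha>\<in>UNIV. \<Sum>\<beta>\<in>UNIV. hess_inv a \<alpha> \<beta> p * (F \<beta> * P \<alpha> \<sigma> p)) = F \<sigma>" for F \<sigma>
  proof -
    have "(\<Sum>\<alpha>\<in>UNIV. \<Sum>\<beta>\<in>UNIV. hess_inv a \<alpha> \<beta> p * (F \<beta> * P \<alpha> \<sigma> p)) = (\<Sum>\<beta>\<in>UNIV. F \<beta> * (\<Sum>\<alpha>\<in>UNIV. hess_inv a \<alpha> \<beta> p * P \<alpha> \<sigma> p))"
      by (simp add: sum_2 algebra_simps)
    then show ?thesis using exhaust_2[of \<sigma>] by (auto simp: hess_inv_P[OF pv] sum_2)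
  qed
  have r2: "(\<Sum>\<alpha>\<in>UNIV. \<Sum>\<beta>\<in>UNIV. hess_inv a \<alpha> \<beta> p * (F \<alpha> * P \<gamma> \<beta> p)) = F \<gamma>" for F \<gamma>
  proof -
    have "(\<Sum>\<alpha>\<in>UNIV. \<Sum>\<beta>\<in>UNIV. hess_inv a \<alpha> \<beta> p * (F \<alpha> * P \<gamma> \<beta> p)) = (\<Sum>\<alpha>\<in>UNIV. F \<alpha> * (\<Sum>\<beta>\<in>UNIV. P \<gamma> \<beta> p * hess_inv a \<alpha> \<beta> p))"
      by (simp add: sum_2 algebra_simps)
    then show ?thesis using exhaust_2[of \<gamma>] by (auto simp: P_hess_inv[OF pv] sum_2)
  qed
  have "lam p * Ric \<theta> \<Gamma> Z \<gamma> \<sigma> p = (\<Sum>\<alpha>\<in>UNIV. \<Sum>\<beta>\<in>UNIV. hess_inv a \<alpha> \<beta> p * Rm \<theta> \<Gamma> Z \<alpha> \<beta> \<gamma> \<sigma> p)"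
    using lam_nz_U[OF p] by (simp add: Ric_def h_up_eq[OF p] sum_distrib_left)
  also have "\<dots> = - (\<Sum>\<alpha>\<in>UNIV. \<Sum>\<beta>\<in>UNIV. hess_inv a \<alpha> \<beta> p * (lam p * ratio p * pot20 a \<alpha> \<gamma> p * pot20 a \<beta> \<sigma> p))
     + (\<Sum>\<alpha>\<in>UNIV. \<Sum>\<beta>\<in>UNIV. hess_inv a \<alpha> \<beta> p * hess_lam \<alpha> \<beta> p) * P \<gamma> \<sigma> p
     + (\<Sum>\<alpha>\<in>UNIV. \<Sum>\<beta>\<in>UNIV. hess_inv a \<alpha> \<beta> p * (hess_lam \<gamma> \<beta> p * P \<alpha> \<sigma> p))
     + (\<Sum>\<alpha>\<in>UNIV. \<Sum>\<beta>\<in>UNIV. hess_inv a \<alpha> \<beta> p * (hess_lam \<alpha> \<sigma> p * P \<gamma> \<beta> p))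
     + hess_lam \<gamma> \<sigma> p * (\<Sum>\<alpha>\<in>UNIV. \<Sum>\<beta>\<in>UNIV. hess_inv a \<alpha> \<beta> p * P \<alpha> \<beta> p)
     + c * ((\<Sum>\<alpha>\<in>UNIV. \<Sum>\<beta>\<in>UNIV. hess_inv a \<alpha> \<beta> p * P \<alpha> \<beta> p) * P \<gamma> \<sigma> p
          + (\<Sum>\<alpha>\<in>UNIV. \<Sum>\<beta>\<in>UNIV. hess_inv a \<alpha> \<beta> p * (P \<gamma> \<beta> p * P \<alpha> \<sigma> p)))"
    unfolding Rm_eq[OF p] c_def[symmetric] sum_2 by (simp add: algebra_simps)
  also have "\<dots> = - (lam p * weyl_size p * dw_norm2 p * dw \<gamma> * dw \<sigma>)
    + (\<Sum>\<alpha>\<in>UNIV. \<Sum>\<beta>\<in>UNIV. hess_inv a \<alpha> \<beta> p * hess_lam \<alpha> \<beta> p) * P \<gamma> \<sigma> p + 4 * hess_lam \<gamma> \<sigma> p + 3 * c * P \<gamma> \<sigma> p"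
    unfolding 1 r1 r2 hess_inv_P_trace[OF pv] by (simp add: algebra_simps)
  finally show ?thesis by (simp only: c_def)
qed

lemma Scal_eq:
  assumes p: "p \<in> M \<inter> U"
  shows "lam p * lam p * Scal \<theta> \<Gamma> Z p = - (lam p * weyl_size p * dw_norm2 p * dw_norm2 p)
    + 6 * (\<Sum>\<alpha>\<in>UNIV. \<Sum>\<beta>\<in>UNIV. hess_inv a \<alpha> \<beta> p * hess_lam \<alpha> \<beta> p)
    + 6 * (\<i> * dir (rot p) lam p - lam p - gradlam_norm2 p)"
proof -
  have pv: "p \<in> V" using in_V[OF p] by simp
  define c where "c = \<i> * dir (rot p) lam p - lam p - gradlam_norm2 p"
  define t where "t = (\<Sum>\<alpha>\<in>UNIV. \<Sum>\<beta>\<in>UNIV. hess_inv a \<alpha> \<beta> p * hess_lam \<alpha> \<beta> p)"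
  have Ric: "lam p * Ric \<theta> \<Gamma> Z \<gamma> \<sigma> p = - (lam p * weyl_size p * dw_norm2 p * dw \<gamma> * dw \<sigma>)
      + t * P \<gamma> \<sigma> p + 4 * hess_lam \<gamma> \<sigma> p + 3 * c * P \<gamma> \<sigma> p" for \<gamma> \<sigma>
    by (simp only: Ric_eq[OF p] c_def t_def)
  have "lam p * lam p * Scal \<theta> \<Gamma> Z p = (\<Sum>\<gamma>\<in>UNIV. \<Sum>\<sigma>\<in>UNIV. hess_inv a \<gamma> \<sigma> p * (lam p * Ric \<theta> \<Gamma> Z \<gamma> \<sigma> p))"
    using lam_nz_U[OF p] by (simp add: Scal_def h_up_eq[OF p] sum_distrib_left mult_ac)
  also have "\<dots> = - (lam p * weyl_size p * dw_norm2 p * dw_norm2 p)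
      + t * (\<Sum>\<alpha>\<in>UNIV. \<Sum>\<beta>\<in>UNIV. hess_inv a \<alpha> \<beta> p * P \<alpha> \<beta> p) + 4 * (\<Sum>\<alpha>\<in>UNIV. \<Sum>\<beta>\<in>UNIV. hess_inv a \<alpha> \<beta> p * hess_lam \<alpha> \<beta> p)
      + 3 * c * (\<Sum>\<alpha>\<in>UNIV. \<Sum>\<beta>\<in>UNIV. hess_inv a \<alpha> \<beta> p * P \<alpha> \<beta> p)"
    unfolding Ric sum_2 by (simp add: dw_norm2_def algebra_simps)
  finally show ?thesis unfolding hess_inv_P_trace[OF pv] c_def t_def by simp
qed

text \<open>The tensor formed from the curvature removes all symmetrised products with the Levi form, so the
  second derivatives of \<open>\<lambda>\<close> in \<open>Rm_eq\<close> disappear.\<close>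
theorem S_low_eq:
  assumes p: "p \<in> M \<inter> U"
  shows "S_low \<theta> \<Gamma> Z \<alpha> \<beta> \<gamma> \<sigma> p = weyl \<alpha> \<beta> \<gamma> \<sigma> p"
proof -
  have pv: "p \<in> V" using in_V[OF p] by simp
  have k: "lam p * ratio p * pot20 a \<alpha> \<gamma> p * pot20 a \<beta> \<sigma> p = lam p * weyl_size p * (dw \<alpha> * dw \<beta> * dw \<gamma> * dw \<sigma>)"
    using rad2_nz[OF pv] drho_norm2_nz[OF pv] by (simp add: ratio_def pot20_def weyl_size_def power2_eq_square field_simps)
  define R where "R = (\<lambda>\<gamma> \<sigma>. lam p * Ric \<theta> \<Gamma> Z \<gamma> \<sigma> p)"
  define C where "C = lam p * lam p * Scal \<theta> \<Gamma> Z p"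
  have "S_low \<theta> \<Gamma> Z \<alpha> \<beta> \<gamma> \<sigma> p = Rm \<theta> \<Gamma> Z \<alpha> \<beta> \<gamma> \<sigma> p
     - (R \<alpha> \<beta> * P \<gamma> \<sigma> p + R \<gamma> \<beta> * P \<alpha> \<sigma> p + R \<alpha> \<sigma> * P \<gamma> \<beta> p + R \<gamma> \<sigma> * P \<alpha> \<beta> p) / 4
     + C * (P \<alpha> \<beta> p * P \<gamma> \<sigma> p + P \<alpha> \<sigma> p * P \<gamma> \<beta> p) / 12"
    unfolding S_low_def h_low_eq[OF p] R_def C_def by (simp add: algebra_simps)
  then show ?thesis
    unfolding R_def C_def Ric_eq[OF p] Scal_eq[OF p] Rm_eq[OF p] k weyl_def by (simp add: field_simps)
qed

end

section \<open>The one-form of Case and Gover on the slice\<close>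

context tw_ellipsoid
begin

text \<open>Off the ellipsoid the Levi form of the frame has no reason to be \<open>\<lambda> P\<close>. The set \<open>U_inv\<close> of
  points where it is invertible is a neighbourhood of \<open>M \<inter> U\<close> on which the ambient extensions of the
  curvature tensors are smooth, as is required for differentiating them along \<open>M\<close>.\<close>
definition h_det where
  "h_det q = h_low \<theta> Z 1 1 q * h_low \<theta> Z 2 2 q - h_low \<theta> Z 1 2 q * h_low \<theta> Z 2 1 q"

definition U_inv where "U_inv = {q \<in> U. h_det q \<noteq> 0}"

lemma smooth_h_low: "smooth_on U (h_low \<theta> Z \<alpha> \<beta>)"
  unfolding h_low_def[abs_def]
  using open_U smooth_on_subset[OF smooth_theta U_subset_W] smooth_Z[OF open_U U_subset_V] smooth_Zbar[OF open_U U_subset_V]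
  by (intro smooth_levi)

lemma smooth_h_det: "smooth_on U h_det"
  unfolding h_det_def[abs_def] using open_U smooth_h_low by (intro smooth_on_diff smooth_on_mult)

lemma open_U_inv: "open U_inv"
proof -
  have "continuous_on U h_det" using smooth_h_det unfolding smooth_on_def by (metis Ck_on.simps(1))
  then have "open (h_det -` (- {0}) \<inter> U)"
    using continuous_on_open_vimage[OF open_U] by blast
  moreover have "h_det -` (- {0}) \<inter> U = U_inv" by (auto simp: U_inv_def)
  ultimately show ?thesis by simp
qed

lemma U_inv_subset_U: "U_inv \<subseteq> U" by (auto simp: U_inv_def)

lemma M_in_U_inv: "p \<in> M \<inter> U \<Longrightarrow> p \<in> U_inv"
proof -
  assume p: "p \<in> M \<inter> U"
  have pv: "p \<in> V" using in_V[OF p] by simp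
  have "P 1 1 p * hess_inv a 1 1 p + P 1 2 p * hess_inv a 1 2 p = 1" "P 1 1 p * hess_inv a 2 1 p + P 1 2 p * hess_inv a 2 2 p = 0"
    "P 2 1 p * hess_inv a 1 1 p + P 2 2 p * hess_inv a 1 2 p = 0" "P 2 1 p * hess_inv a 2 1 p + P 2 2 p * hess_inv a 2 2 p = 1"
    using P_hess_inv[OF pv, of 1 1] P_hess_inv[OF pv, of 1 2] P_hess_inv[OF pv, of 2 1] P_hess_inv[OF pv, of 2 2]
    by (simp_all add: sum_2)
  then have "(P 1 1 p * P 2 2 p - P 1 2 p * P 2 1 p) * (hess_inv a 1 1 p * hess_inv a 2 2 p - hess_inv a 1 2 p * hess_inv a 2 1 p) = 1"
    by algebra
  then have "P 1 1 p * P 2 2 p - P 1 2 p * P 2 1 p \<noteq> 0" by auto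
  moreover have "h_det p = lam p * lam p * (P 1 1 p * P 2 2 p - P 1 2 p * P 2 1 p)"
    by (simp add: h_det_def h_low_eq[OF p] algebra_simps)
  ultimately show "p \<in> U_inv" using p lam_nz_U[OF p] by (simp add: U_inv_def)
qed

lemma h_up_explicit:
  assumes "h_det q \<noteq> 0"
  shows "h_up \<theta> Z \<alpha> \<beta> q =
    (if \<alpha> = \<beta> then if \<alpha> = 1 then h_low \<theta> Z 2 2 q else h_low \<theta> Z 1 1 q else - h_low \<theta> Z \<beta> \<alpha> q) / h_det q"
proof -
  have "matrix_inv (\<chi> \<mu> \<nu>. h_low \<theta> Z \<mu> \<nu> q) = (\<chi> \<beta> \<alpha>.
    (if \<alpha> = \<beta> then if \<alpha> = 1 then h_low \<theta> Z 2 2 q else h_low \<theta> Z 1 1 q else - h_low \<theta> Z \<beta> \<alpha> q) / h_det q)"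
    using assms
    by (intro matrix_inv_eqI)
       (auto simp: matrix_matrix_mult_def mat_def vec_eq_iff forall_2 sum_2 add_divide_distrib[symmetric]
          diff_divide_distrib[symmetric], simp_all add: h_det_def algebra_simps)
  then show ?thesis by (simp add: h_up_def)
qed

lemma smooth_h_up: "smooth_on U_inv (h_up \<theta> Z \<alpha> \<beta>)"
proof -
  have "smooth_on U_inv (\<lambda>q. (if \<alpha> = \<beta> then if \<alpha> = 1 then h_low \<theta> Z 2 2 q else h_low \<theta> Z 1 1 q else - h_low \<theta> Z \<beta> \<alpha> q) / h_det q)"
    using open_U_inv smooth_on_subset[OF smooth_h_low U_inv_subset_U] smooth_on_subset[OF smooth_h_det U_inv_subset_U]
    by (cases "\<alpha> = \<beta>"; cases "\<alpha> = 1") (auto intro!: smooth_on_divide smooth_on_uminus simp: U_inv_def)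
  then show ?thesis
    by (rule smooth_on_cong[OF open_U_inv, rotated]) (simp add: U_inv_def h_up_explicit)
qed

lemma smooth_cov_U: "smooth_on U X \<Longrightarrow> smooth_on U Y \<Longrightarrow> smooth_on U (cov \<Gamma> X Y)"
  using smooth_on_subset[OF smooth_Gamma U_subset_W] bilinear_Gamma U_subset_W
  by (intro smooth_cov open_U) auto

lemma smooth_Rm: "smooth_on U (Rm \<theta> \<Gamma> Z \<alpha> \<beta> \<gamma> \<sigma>)"
  unfolding Rm_def[abs_def] curvature_def
  using open_U smooth_on_subset[OF smooth_theta U_subset_W] smooth_Z[OF open_U U_subset_V] smooth_Zbar[OF open_U U_subset_V]
  by (intro smooth_levi smooth_on_diff smooth_cov_U smooth_bracket)

lemma smooth_Ric: "smooth_on U_inv (Ric \<theta> \<Gamma> Z \<gamma> \<sigma>)"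
  unfolding Ric_def[abs_def] using open_U_inv smooth_h_up smooth_on_subset[OF smooth_Rm U_inv_subset_U]
  by (intro smooth_on_sum smooth_on_mult)

lemma smooth_Scal: "smooth_on U_inv (Scal \<theta> \<Gamma> Z)"
  unfolding Scal_def[abs_def] using open_U_inv smooth_h_up smooth_Ric
  by (intro smooth_on_sum smooth_on_mult)

lemma smooth_S_low: "smooth_on U_inv (S_low \<theta> \<Gamma> Z \<alpha> \<beta> \<gamma> \<sigma>)"
  unfolding S_low_def[abs_def] divide_inverse
  using open_U_inv smooth_on_subset[OF smooth_h_low U_inv_subset_U] smooth_Ric smooth_Scal smooth_on_subset[OF smooth_Rm U_inv_subset_U]
  by (intro smooth_on_add smooth_on_diff smooth_on_mult smooth_on_const)

lemma smooth_S_norm2: "smooth_on U_inv (S_norm2 \<theta> \<Gamma> Z)"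
  unfolding S_norm2_def[abs_def]
  using open_U_inv smooth_S_low smooth_h_up by (intro smooth_on_sum smooth_on_mult)

lemma dir_S_low:
  assumes p: "p \<in> M \<inter> U" and X: "X \<in> CT (ellipsoid_fun a) p" and S: "has_dir X p (weyl \<alpha> \<beta> \<gamma> \<sigma>) d"
  shows "dir X (S_low \<theta> \<Gamma> Z \<alpha> \<beta> \<gamma> \<sigma>) p = d"
proof -
  have "dir X (S_low \<theta> \<Gamma> Z \<alpha> \<beta> \<gamma> \<sigma>) p = dir X (weyl \<alpha> \<beta> \<gamma> \<sigma>) p"
    using p S smooth_on_imp_differentiable[OF smooth_S_low] M_in_U_inv U_inv_subset_U U_subset_V S_low_eq
    by (intro dir_cong[OF X _ open_U_inv]) (auto simp: has_dir_def subset_iff)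
  then show ?thesis using S by (simp add: has_dir_def)
qed

lemma has_dir_drho_norm2: "has_dir (Z \<gamma> p) p (drho_norm2 a) (of_real a * dw \<gamma> * cnj (drho a 1 p))"
proof -
  have "has_dir (Z \<gamma> p) p (drho_norm2 a) (- drho a \<gamma> p + (\<Sum>\<alpha>\<in>UNIV. drho a \<alpha> p * cnj (delta \<alpha> \<gamma>) + of_real a * dw \<alpha> * dw \<gamma> * cnj (drho a \<alpha> p)))"
    unfolding drho_norm2_def by (rule dir_intros)+
  then show ?thesis by (rule has_dir_eq) (use exhaust_2[of \<gamma>] in \<open>auto simp: sum_2\<close>)
qed

text \<open>On the slice \<open>z\<^sub>2 = 0\<close> the gradient of \<open>q\<close> points in the \<open>w\<close>-direction, so that the Hessian is diagonal.\<close>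
lemma slice_values:
  assumes p: "p \<in> V" and p2: "p $ 2 = 0"
  shows "drho a 2 p = 0" "dpot a 2 p = 0" "drho_norm2 a p = rad2 a p + drho a 1 p * cnj (drho a 1 p)"
    "dw_norm2 p = (rad2 a p)\<^sup>2 / drho_norm2 a p" "dw_norm2 p \<noteq> 0"
    "P 1 1 p = 1 / dw_norm2 p" "P 1 2 p = 0" "P 2 1 p = 0" "P 2 2 p = 1 / rad2 a p"
    "hess_inv a 1 1 p = dw_norm2 p" "hess_inv a 1 2 p = 0" "hess_inv a 2 1 p = 0" "hess_inv a 2 2 p = rad2 a p"
proof -
  show r: "drho a 2 p = 0" and s: "dpot a 2 p = 0" using p2 by (simp_all add: drho_def dpot_def)
  show g: "drho_norm2 a p = rad2 a p + drho a 1 p * cnj (drho a 1 p)" by (simp add: drho_norm2_def sum_2 r)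
  note nz = rad2_nz[OF p] drho_norm2_nz[OF p]
  show e: "dw_norm2 p = (rad2 a p)\<^sup>2 / drho_norm2 a p"
    using nz unfolding dw_norm2_def hess_inv_def by (simp add: g power2_eq_square field_simps)
  show "dw_norm2 p \<noteq> 0" using nz by (simp add: e)
  show "P 1 1 p = 1 / dw_norm2 p" using nz unfolding e by (simp add: hess_def dpot_def g power2_eq_square field_simps)
  show "P 1 2 p = 0" "P 2 1 p = 0" "P 2 2 p = 1 / rad2 a p" by (simp_all add: hess_def s)
  show "hess_inv a 1 1 p = dw_norm2 p" by (simp add: dw_norm2_def)
  show "hess_inv a 1 2 p = 0" "hess_inv a 2 1 p = 0" "hess_inv a 2 2 p = rad2 a p" by (simp_all add: hess_inv_def r)
qed

text \<open>In a unitary frame the trace-free part of the fourth power of a unit covector has the entry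
  \<open>1/6\<close> at \<open>1111\<close> and \<open>2222\<close> and \<open>- 1/6\<close> at the four mixed places, so its square norm is \<open>6/36\<close>.\<close>
lemma S_norm2_slice:
  assumes p: "p \<in> M \<inter> U" and p2: "p $ 2 = 0"
  shows "S_norm2 \<theta> \<Gamma> Z p = (weyl_size p)\<^sup>2 * dw_norm2 p ^ 4 / (6 * (lam p)\<^sup>2)"
proof -
  have pv: "p \<in> V" using in_V[OF p] by simp
  note sv = slice_values(1,2,6-)[OF pv p2]
  have h: "h_up \<theta> Z 1 1 p = dw_norm2 p / lam p" "h_up \<theta> Z 1 2 p = 0" "h_up \<theta> Z 2 1 p = 0" "h_up \<theta> Z 2 2 p = rad2 a p / lam p"
    by (simp_all add: h_up_eq[OF p] sv)
  note nz = slice_values(5)[OF pv p2] rad2_nz[OF pv] lam_nz_U[OF p]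
  define s where "s = - (lam p * weyl_size p)"
  have S: "weyl 1 1 1 1 p = s / 6" "weyl 1 1 2 2 p = - (s * dw_norm2 p / (6 * rad2 a p))" "weyl 1 2 2 1 p = - (s * dw_norm2 p / (6 * rad2 a p))"
    "weyl 2 1 1 2 p = - (s * dw_norm2 p / (6 * rad2 a p))" "weyl 2 2 1 1 p = - (s * dw_norm2 p / (6 * rad2 a p))"
    "weyl 2 2 2 2 p = s * (dw_norm2 p)\<^sup>2 / (6 * (rad2 a p)\<^sup>2)"
    using nz by (simp_all add: weyl_def sv s_def field_simps power2_eq_square)
  have "S_norm2 \<theta> \<Gamma> Z p = (weyl 1 1 1 1 p)\<^sup>2 * (dw_norm2 p / lam p) ^ 4
     + (weyl 1 1 2 2 p * weyl 1 1 2 2 p + weyl 1 2 2 1 p * weyl 2 1 1 2 p + weyl 2 1 1 2 p * weyl 1 2 2 1 p + weyl 2 2 1 1 p * weyl 2 2 1 1 p)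
         * (dw_norm2 p / lam p)\<^sup>2 * (rad2 a p / lam p)\<^sup>2
     + (weyl 2 2 2 2 p)\<^sup>2 * (rad2 a p / lam p) ^ 4"
    unfolding S_norm2_def S_low_eq[OF p] sum_2 h
    by (simp add: weyl_def sv power2_eq_square power4_eq_xxxx algebra_simps)
  also have "\<dots> = s\<^sup>2 * dw_norm2 p ^ 4 / (6 * (lam p) ^ 4)"
    unfolding S using nz by (simp add: field_simps power2_eq_square power4_eq_xxxx)
  also have "\<dots> = (weyl_size p)\<^sup>2 * dw_norm2 p ^ 4 / (6 * (lam p)\<^sup>2)"
    using nz by (simp add: s_def field_simps power2_eq_square power4_eq_xxxx)
  finally show ?thesis .
qed

text \<open>\<open>Z\<^sub>1\<close> is tangent to the slice \<open>z\<^sub>2 = 0\<close>, so the values of the norm on the slice are enough.\<close>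
lemma dir_S_norm2:
  assumes p: "p \<in> M \<inter> U" and p2: "p $ 2 = 0"
    and d: "has_dir (Z 1 p) p (\<lambda>q. (weyl_size q)\<^sup>2 * dw_norm2 q ^ 4 / (6 * (lam q)\<^sup>2)) d"
  shows "dir (Z 1 p) (S_norm2 \<theta> \<Gamma> Z) p = d"
proof -
  define s where "s z = z - axis 2 (z $ 2)" for z :: "complex^3"
  have p1: "p $ 1 \<noteq> 0" using p by (auto simp: U_def V_def)
  have s2: "s z = z" if "z $ 2 = 0" for z using that by (simp add: s_def axis_def vec_eq_iff)
  have "bounded_linear s"
    unfolding s_def by (rule linear_conv_bounded_linear[THEN iffD1], rule linearI) (auto simp: axis_def vec_eq_iff algebra_simps)
  moreover have "s (axis 1 c) = axis 1 c" "s (s z) = s z" for c z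
    by (auto simp: s_def axis_def vec_eq_iff)
  moreover have "s p = p" "s (re_vec (Z 1 p)) = re_vec (Z 1 p)" "s (im_vec (Z 1 p)) = im_vec (Z 1 p)"
    using p2 by (intro s2; simp add: re_vec_def im_vec_def)+
  moreover have "S_norm2 \<theta> \<Gamma> Z z = (weyl_size z)\<^sup>2 * dw_norm2 z ^ 4 / (6 * (lam z)\<^sup>2)"
    if "z \<in> M" "z \<in> U_inv" "s z = z" for z
  proof (rule S_norm2_slice)
    show "z \<in> M \<inter> U" using that U_inv_subset_U by auto
    have "s z $ 2 = 0" by (simp add: s_def)
    then show "z $ 2 = 0" using that by simp
  qed
  ultimately have "dir (Z 1 p) (S_norm2 \<theta> \<Gamma> Z) p = dir (Z 1 p) (\<lambda>q. (weyl_size q)\<^sup>2 * dw_norm2 q ^ 4 / (6 * (lam q)\<^sup>2)) p"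
    using p1 M_in_U_inv[OF p] Z_CT[OF in_V[OF p]] smooth_on_imp_differentiable[OF smooth_S_norm2] d p
    by (intro dir_cong_on_ellipsoid_slice[OF _ _ _ open_U_inv, where s = s]) (auto simp: has_dir_def)
  then show ?thesis using d by (simp add: has_dir_def)
qed

text \<open>At a point of the slice only the \<open>w\<close>-direction contributes. Half of the logarithmic derivative of
  \<open>\<kappa>\<close> and that of \<open>|dw|\<^sup>2\<close> add up to a multiple of \<open>\<psi>\<^sub>1 + b\<close>, the factor that decides whether the
  one-form vanishes.\<close>
lemma has_dir_slice:
  assumes p: "p \<in> V" and p2: "p $ 2 = 0"
  defines "b \<equiv> of_real a * cnj (drho a 1 p) / drho_norm2 a p"
  shows "has_dir (Z \<gamma> p) p weyl_size (weyl_size p * (dpot a 1 p - b) * dw \<gamma>)"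
    "has_dir (Z \<gamma> p) p dw_norm2 (- dw_norm2 p * (2 * dpot a 1 p + b) * dw \<gamma>)"
    "pot20 a 1 1 p * cnj (dpot a 1 p) = b / dw_norm2 p"
proof -
  note sv = slice_values(1,2,3)[OF p p2] and nz = rad2_nz[OF p] drho_norm2_nz[OF p]
  note g = slice_values(3)[OF p p2]
  have r: "drho a \<gamma> p = dw \<gamma> * drho a 1 p" using exhaust_2[of \<gamma>] slice_values(1)[OF p p2] by auto
  have "has_dir (Z \<gamma> p) p (\<lambda>q. (of_real a)\<^sup>2 / (rad2 a q * drho_norm2 a q)) (weyl_size p * (dpot a 1 p - b) * dw \<gamma>)"
    by (rule has_dir_eq, (rule dir_intros has_dir_drho_norm2)+)
       (use nz in \<open>simp_all add: r weyl_size_def dpot_def b_def power2_eq_square field_simps\<close>)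
  then show "has_dir (Z \<gamma> p) p weyl_size (weyl_size p * (dpot a 1 p - b) * dw \<gamma>)"
    by (simp add: weyl_size_def[abs_def])
  have 1: "dw_norm2 = (\<lambda>q. rad2 a q - rad2 a q * (cnj (drho a 1 q) * drho a 1 q) / drho_norm2 a q)"
    by (simp add: dw_norm2_def hess_inv_def fun_eq_iff algebra_simps)
  have e: "dw_norm2 p = (rad2 a p)\<^sup>2 / drho_norm2 a p" by (rule slice_values[OF p p2])
  have c: "cnj (drho a 1 p) * drho a 1 p = drho_norm2 a p - rad2 a p" using g by simp
  have "has_dir (Z \<gamma> p) p dw_norm2 (- drho a \<gamma> p - ((rad2 a p * (cnj (drho a 1 p) * (of_real a * dw 1 * dw \<gamma>) + delta 1 \<gamma> * drho a 1 p)
      + - drho a \<gamma> p * (drho_norm2 a p - rad2 a p)) * drho_norm2 a p - rad2 a p * (drho_norm2 a p - rad2 a p) * (of_real a * dw \<gamma> * cnj (drho a 1 p))) / (drho_norm2 a p)\<^sup>2)"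
    unfolding 1
    by (rule has_dir_eq, (rule dir_intros has_dir_drho_norm2 nz)+) (simp add: c)
  then show "has_dir (Z \<gamma> p) p dw_norm2 (- dw_norm2 p * (2 * dpot a 1 p + b) * dw \<gamma>)"
    by (rule has_dir_eq)
       (use nz exhaust_2[of \<gamma>] in \<open>auto simp: r e dpot_def b_def power2_eq_square divide_simps, simp_all add: algebra_simps\<close>)
  show "pot20 a 1 1 p * cnj (dpot a 1 p) = b / dw_norm2 p"
    using nz by (simp add: pot20_def dpot_def b_def e power2_eq_square)
qed

lemma conn_eq:
  assumes p: "p \<in> M \<inter> U"
  shows "conn \<theta> \<Gamma> Z \<kappa> \<mu> \<tau> p = (\<Sum>\<sigma>\<in>UNIV. hess_inv a \<tau> \<sigma> p / lam p * conn_low \<kappa> \<mu> \<sigma> p)"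
  by (simp add: conn_def h_up_eq[OF p] levi_cov_Z_Z[OF p])

lemma conn_bar_eq:
  assumes p: "p \<in> M \<inter> U"
  shows "conn_bar \<theta> \<Gamma> Z \<kappa> \<nu> \<tau> p = (\<Sum>\<sigma>\<in>UNIV. hess_inv a \<sigma> \<tau> p / lam p * (- P \<kappa> \<nu> p * L \<sigma> p))"
  by (simp add: conn_bar_def h_up_eq[OF p] cov_Z_Zbar[OF p] levi_cscale_right[OF theta_diff_U[OF p]] levi_cconj_gradlam(4)[OF p])

text \<open>The Levi form is diagonal at \<open>p\<close>, which collapses the contraction to the six covariant derivatives
  \<open>N1\<close> to \<open>N6\<close>. The derivative of \<open>S\<close> in the \<open>z\<^sub>2\<close>-direction involves the off-diagonal entries of the Hessian,
  whose first derivatives do not vanish on the slice. The terms with \<open>v1 = Z\<^sub>1 log \<lambda>\<close> cancel between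
  the divergence term and the derivative of the norm.\<close>
theorem X_form_slice:
  assumes p: "p \<in> M \<inter> U" and p2: "p $ 2 = 0"
  shows "X_form \<theta> \<Gamma> Z 1 p = - (3 / 8) * (weyl_size p)\<^sup>2 * (dw_norm2 p) ^ 4 / (lam p)\<^sup>2 *
    (dpot a 1 p + of_real a * cnj (drho a 1 p) / drho_norm2 a p)"
proof -
  have pv: "p \<in> V" using in_V[OF p] by simp
  define l where "l = lam p"
  define k where "k = weyl_size p"
  define e where "e = dw_norm2 p"
  define Q where "Q = rad2 a p"
  define \<psi> where "\<psi> = dpot a 1 p"
  define b where "b = of_real a * cnj (drho a 1 p) / drho_norm2 a p"
  define v1 where "v1 = L 1 p / l"
  define v2 where "v2 = L 2 p / l"
  have nz: "l \<noteq> 0" "e \<noteq> 0" "Q \<noteq> 0"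
    using lam_nz_U[OF p] slice_values(5)[OF pv p2] rad2_nz[OF pv] by (simp_all add: l_def e_def Q_def)
  have L: "L 1 p = l * v1" "L 2 p = l * v2" using nz by (simp_all add: v1_def v2_def)
  note sv = slice_values(2,6-)[OF pv p2, folded e_def Q_def]
  have pot20: "pot20 a 1 2 p = 0" "pot20 a 2 1 p = 0" "pot20 a 2 2 p = 0" by (simp_all add: pot20_def)
  have AAb: "pot20 a 1 1 p * cnj \<psi> = b / e"
    unfolding b_def e_def \<psi>_def by (rule has_dir_slice(3)[OF pv p2])
  have h: "h_up \<theta> Z 1 1 p = e / l" "h_up \<theta> Z 1 2 p = 0" "h_up \<theta> Z 2 1 p = 0" "h_up \<theta> Z 2 2 p = Q / l"
    by (simp_all add: h_up_eq[OF p] sv l_def)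
  have conn_low: "conn_low 1 1 1 p = l * (2 * \<psi> + b + 2 * v1) / e" "conn_low 1 1 2 p = 0"
     "conn_low 1 2 1 p = l * v2 / e" "conn_low 2 1 1 p = l * v2 / e" "conn_low 1 2 2 p = l * (\<psi> + v1) / Q" "conn_low 2 1 2 p = l * (\<psi> + v1) / Q"
     "conn_low 2 2 1 p = 0" "conn_low 2 2 2 p = 2 * l * v2 / Q"
    using nz by (simp_all add: conn_low_def sv pot20 AAb L \<psi>_def[symmetric] l_def[symmetric] add_divide_distrib ring_distribs)
  have C: "conn \<theta> \<Gamma> Z 1 1 1 p = 2 * \<psi> + b + 2 * v1" "conn \<theta> \<Gamma> Z 1 1 2 p = 0"
    "conn \<theta> \<Gamma> Z 1 2 1 p = v2" "conn \<theta> \<Gamma> Z 2 1 1 p = v2" "conn \<theta> \<Gamma> Z 1 2 2 p = \<psi> + v1" "conn \<theta> \<Gamma> Z 2 1 2 p = \<psi> + v1"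
    "conn \<theta> \<Gamma> Z 2 2 1 p = 0" "conn \<theta> \<Gamma> Z 2 2 2 p = 2 * v2"
    using nz by (simp_all add: conn_eq[OF p] sum_2 conn_low sv l_def[symmetric])
  have Cb: "conn_bar \<theta> \<Gamma> Z 1 1 1 p = - v1" "conn_bar \<theta> \<Gamma> Z 1 1 2 p = - (Q * v2 / e)"
    "conn_bar \<theta> \<Gamma> Z 1 2 \<tau> p = 0" "conn_bar \<theta> \<Gamma> Z 2 1 \<tau> p = 0"
    "conn_bar \<theta> \<Gamma> Z 2 2 1 p = - (e * v1 / Q)" "conn_bar \<theta> \<Gamma> Z 2 2 2 p = - v2" for \<tau>
    using nz exhaust_2[of \<tau>] by (auto simp: conn_bar_eq[OF p] sum_2 sv L l_def[symmetric] field_simps)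
  define s where "s = - (l * k)"
  have S: "weyl 1 1 1 1 p = s / 6" "weyl 1 1 2 2 p = - (s * e / (6 * Q))" "weyl 1 2 2 1 p = - (s * e / (6 * Q))"
    "weyl 2 1 1 2 p = - (s * e / (6 * Q))" "weyl 2 2 1 1 p = - (s * e / (6 * Q))" "weyl 2 2 2 2 p = s * e\<^sup>2 / (6 * Q\<^sup>2)"
    "weyl 1 1 1 2 p = 0" "weyl 1 1 2 1 p = 0" "weyl 1 2 1 1 p = 0" "weyl 2 1 1 1 p = 0" "weyl 1 2 1 2 p = 0" "weyl 2 1 2 1 p = 0"
    "weyl 1 2 2 2 p = 0" "weyl 2 1 2 2 p = 0" "weyl 2 2 1 2 p = 0" "weyl 2 2 2 1 p = 0"
    using nz by (simp_all add: weyl_def sv s_def e_def[symmetric] l_def[symmetric] k_def[symmetric] field_simps power2_eq_square)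
  have qn: "rad2 a p \<noteq> 0" using nz by (simp add: Q_def)
  have dl: "has_dir (Z 1 p) p lam (l * v1)" "has_dir (Z 2 p) p lam (l * v2)"
    using has_dir_dir[OF lam_differentiable[OF pv]] by (simp_all flip: L)
  have dk: "has_dir (Z 1 p) p weyl_size (k * (\<psi> - b))" "has_dir (Z 2 p) p weyl_size 0"
    and de: "has_dir (Z 1 p) p dw_norm2 (- e * (2 * \<psi> + b))" "has_dir (Z 2 p) p dw_norm2 0"
    using has_dir_slice(1,2)[OF pv p2, of 1] has_dir_slice(1,2)[OF pv p2, of 2]
    by (simp_all add: k_def \<psi>_def b_def e_def)
  have dP: "has_dir (Z 1 p) p (P 1 1) ((2 * \<psi> + b) / e)" "has_dir (Z 1 p) p (P 1 2) 0" "has_dir (Z 1 p) p (P 2 1) 0"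
     "has_dir (Z 1 p) p (P 2 2) (\<psi> / Q)"
     "has_dir (Z 2 p) p (P 1 1) 0" "has_dir (Z 2 p) p (P 1 2) (\<psi> / Q)" "has_dir (Z 2 p) p (P 2 1) 0" "has_dir (Z 2 p) p (P 2 2) 0"
    by (rule has_dir_eq[OF has_dir_frame_hess[OF qn]]; simp add: sv pot20 AAb \<psi>_def[symmetric] add_divide_distrib)+
  note rules = has_dir_const has_dir_add has_dir_diff has_dir_mult has_dir_uminus dl dk de dP
  have dc: "has_dir X p (\<lambda>z. f z / c) (d / c)" if "has_dir X p f d" for X f d c
    using has_dir_mult[OF that has_dir_const[of X p "inverse c"]] by (simp add: divide_inverse)
  have dS1: "has_dir (Z 1 p) p (weyl 1 1 1 1) (s / 6 * (v1 + \<psi> - b))"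
    unfolding weyl_def[abs_def]
    by (rule has_dir_eq, (rule dc rules)+)
       (use nz in \<open>simp add: sv s_def e_def[symmetric] l_def[symmetric] k_def[symmetric] field_simps\<close>)
  have dS2: "has_dir (Z 1 p) p (weyl 1 2 2 1) (- (s * e / (6 * Q)) * (v1 - 2 * b))"
    unfolding weyl_def[abs_def]
    by (rule has_dir_eq, (rule dc rules)+)
       (use nz in \<open>simp add: sv s_def e_def[symmetric] l_def[symmetric] k_def[symmetric] field_simps\<close>)
  have dS3: "has_dir (Z 1 p) p (weyl 2 2 1 1) (- (s * e / (6 * Q)) * (v1 - 2 * b))"
    unfolding weyl_def[abs_def]
    by (rule has_dir_eq, (rule dc rules)+)
       (use nz in \<open>simp add: sv s_def e_def[symmetric] l_def[symmetric] k_def[symmetric] field_simps\<close>)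
  have dS4: "has_dir (Z 2 p) p (weyl 1 1 1 2) (- (s * e * \<psi> / (3 * Q)))"
    unfolding weyl_def[abs_def]
    by (rule has_dir_eq, (rule dc rules)+)
       (use nz in \<open>simp add: sv s_def e_def[symmetric] l_def[symmetric] k_def[symmetric] field_simps\<close>)
  have dS5: "has_dir (Z 2 p) p (weyl 1 2 2 2) (s * e\<^sup>2 * \<psi> / (6 * Q\<^sup>2))"
    unfolding weyl_def[abs_def]
    by (rule has_dir_eq, (rule dc rules)+)
       (use nz in \<open>simp add: sv s_def e_def[symmetric] l_def[symmetric] k_def[symmetric] field_simps power2_eq_square\<close>)
  have dS6: "has_dir (Z 2 p) p (weyl 2 2 1 2) (s * e\<^sup>2 * \<psi> / (6 * Q\<^sup>2))"
    unfolding weyl_def[abs_def]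
    by (rule has_dir_eq, (rule dc rules)+)
       (use nz in \<open>simp add: sv s_def e_def[symmetric] l_def[symmetric] k_def[symmetric] field_simps power2_eq_square\<close>)
  note ZC = Z_CT[OF in_V[OF p]]
  note dd = dir_S_low[OF p ZC dS1] dir_S_low[OF p ZC dS2] dir_S_low[OF p ZC dS3]
    dir_S_low[OF p ZC dS4] dir_S_low[OF p ZC dS5] dir_S_low[OF p ZC dS6]
  have N1: "nabla_S \<theta> \<Gamma> Z 1 1 1 1 1 p = s / 6 * (- 3 * \<psi> - 3 * b - v1)"
    unfolding nabla_S_def sum_2 dd S_low_eq[OF p] S C Cb by (simp add: field_simps)
  have N2: "nabla_S \<theta> \<Gamma> Z 1 1 2 2 1 p = - (s * e / (6 * Q)) * (- 3 * \<psi> - 3 * b - v1)"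
    unfolding nabla_S_def sum_2 dd S_low_eq[OF p] S C Cb using nz by (simp add: field_simps)
  have N3: "nabla_S \<theta> \<Gamma> Z 1 2 2 1 1 p = - (s * e / (6 * Q)) * (- 3 * \<psi> - 3 * b - v1)"
    unfolding nabla_S_def sum_2 dd S_low_eq[OF p] S C Cb using nz by (simp add: field_simps)
  have N4: "nabla_S \<theta> \<Gamma> Z 2 1 1 1 2 p = s * e * v1 / (2 * Q)"
    unfolding nabla_S_def sum_2 dd S_low_eq[OF p] S C Cb using nz by (simp add: field_simps)
  have N5: "nabla_S \<theta> \<Gamma> Z 2 1 2 2 2 p = - (s * e\<^sup>2 * v1 / (2 * Q\<^sup>2))"
    unfolding nabla_S_def sum_2 dd S_low_eq[OF p] S C Cb using nz by (simp add: field_simps power2_eq_square)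
  have N6: "nabla_S \<theta> \<Gamma> Z 2 2 2 1 2 p = - (s * e\<^sup>2 * v1 / (2 * Q\<^sup>2))"
    unfolding nabla_S_def sum_2 dd S_low_eq[OF p] S C Cb using nz by (simp add: field_simps power2_eq_square)
  have "dir (Z 1 p) (S_norm2 \<theta> \<Gamma> Z) p = k\<^sup>2 * e ^ 4 / (6 * l\<^sup>2) * (2 * (\<psi> - b) - 4 * (2 * \<psi> + b) - 2 * v1)"
  proof (rule dir_S_norm2[OF p p2])
    have 4: "x ^ 4 = (x\<^sup>2)\<^sup>2" for x :: complex by simp
    show "has_dir (Z 1 p) p (\<lambda>q. (weyl_size q)\<^sup>2 * dw_norm2 q ^ 4 / (6 * (lam q)\<^sup>2))
       (k\<^sup>2 * e ^ 4 / (6 * l\<^sup>2) * (2 * (\<psi> - b) - 4 * (2 * \<psi> + b) - 2 * v1))"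
      unfolding 4
      by (rule has_dir_eq, (rule has_dir_divide has_dir_power2 rules)+)
         (use nz in \<open>simp_all add: e_def[symmetric] l_def[symmetric] k_def[symmetric] field_simps power2_eq_square\<close>)
  qed
  note dn = this
  have "X_form \<theta> \<Gamma> Z 1 p = 1/2 * (
      weyl 1 1 1 1 p * (e / l) ^ 3 * (e / l * nabla_S \<theta> \<Gamma> Z 1 1 1 1 1 p + Q / l * nabla_S \<theta> \<Gamma> Z 2 1 1 1 2 p)
      + weyl 1 1 2 2 p * (e / l) * (Q / l)\<^sup>2 * (e / l * nabla_S \<theta> \<Gamma> Z 1 1 2 2 1 p + Q / l * nabla_S \<theta> \<Gamma> Z 2 1 2 2 2 p)
      + weyl 1 2 2 1 p * (e / l) * (Q / l)\<^sup>2 * (e / l * nabla_S \<theta> \<Gamma> Z 1 2 2 1 1 p + Q / l * nabla_S \<theta> \<Gamma> Z 2 2 2 1 2 p))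
      + 1/4 * dir (Z 1 p) (S_norm2 \<theta> \<Gamma> Z) p"
    unfolding X_form_def S_low_eq[OF p] sum_2 h
    by (simp add: S(7-) power2_eq_square power3_eq_cube ring_distribs mult_ac)
  also have "\<dots> = - (3 / 8) * k\<^sup>2 * e ^ 4 / l\<^sup>2 * (\<psi> + b)"
    unfolding dn N1 N2 N3 N4 N5 N6 S using nz
    by (simp add: s_def field_simps power2_eq_square power3_eq_cube power4_eq_xxxx)
  finally show ?thesis by (simp add: l_def k_def e_def \<psi>_def b_def)
qed

end

section \<open>A point where the one-form does not vanish\<close>

text \<open>The choice of \<open>w = e/(1+|a|)\<close>, \<open>e = 1\<close> or \<open>e = \<i>\<close> according to the sign of \<open>a\<close>, is made for
  \<open>a e = |a| (cnj e)\<close>: then \<open>a w\<^sup>2\<close> is positive and the two summands have the same argument.\<close>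
lemma ellipsoid_point:
  fixes a :: real
  assumes "a \<noteq> 0"
  obtains p where "p \<in> hypersurface (ellipsoid_fun a)" "p $ 1 \<noteq> 0" "p $ 2 = 0"
    "dpot a 1 p + of_real a * cnj (drho a 1 p) / drho_norm2 a p \<noteq> 0"
proof -
  define c where "c = \<bar>a\<bar>"
  define q where "q = c / (1 + c)"
  have c: "c > 0" using assms by (simp add: c_def)
  have q: "q > 0" using c by (simp add: q_def)
  define e :: complex where "e = (if a > 0 then 1 else \<i>)"
  define p :: "complex^3" where
    "p = (\<chi> j. if j = 1 then of_real (sqrt q) else if j = 2 then 0 else e / of_real (1 + c))"
  have p: "p $ 1 = of_real (sqrt q)" "p $ 2 = 0" "p $ 3 = e / of_real (1 + c)"
    by (simp_all add: p_def)
  have e2: "e * cnj e = 1" by (simp add: e_def)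
  have ae: "of_real a * e = of_real c * cnj e"
    using assms by (auto simp: e_def c_def)
  have c1: "1 + complex_of_real c \<noteq> 0"
    using c by (metis add_pos_pos less_numeral_extra(1) less_numeral_extra(3) of_real_1 of_real_add of_real_eq_0_iff)
  have r: "drho a 1 p = cnj e"
  proof -
    have "drho a 1 p = (cnj e + of_real a * e) / of_real (1 + c)"
      by (simp add: drho_def p add_divide_distrib)
    also have "\<dots> = cnj e * (1 + of_real c) / (1 + of_real c)"
      by (simp only: ae) (simp add: algebra_simps)
    finally show ?thesis using c1 by simp
  qed
  have w: "of_real a * (p $ 3)\<^sup>2 = of_real c * (e * cnj e) / (of_real (1 + c))\<^sup>2"
    using ae by (simp add: p power2_eq_square)
  have w': "of_real a * (cnj (p $ 3))\<^sup>2 = of_real c * (e * cnj e) / (of_real (1 + c))\<^sup>2"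
    using arg_cong[OF w, of cnj] by (simp add: mult.commute)
  have n: "p $ 3 * cnj (p $ 3) = e * cnj e / (of_real (1 + c))\<^sup>2"
    by (simp add: p power2_eq_square)
  have "rad2 a p = 1 - p $ 3 * cnj (p $ 3) - (of_real a * (p $ 3)\<^sup>2 + of_real a * (cnj (p $ 3))\<^sup>2) / 2"
    by (simp add: rad2_def p(2) ring_distribs)
  also have "\<dots> = 1 - (e * cnj e) / (of_real (1 + c))\<^sup>2 - of_real c * (e * cnj e) / (of_real (1 + c))\<^sup>2"
    unfolding w w' n by simp
  also have "\<dots> = of_real q"
    using c1 by (simp add: e2 q_def power2_eq_square divide_simps) (simp add: algebra_simps)
  finally have rad2: "rad2 a p = of_real q" .
  have g: "drho_norm2 a p = of_real (q + 1)"
    using e2 by (simp add: drho_norm2_def sum_2 r rad2 mult.commute) (simp add: drho_def p)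
  have "dpot a 1 p + of_real a * cnj (drho a 1 p) / drho_norm2 a p = cnj e * of_real (1 / q + c / (q + 1))"
    unfolding dpot_def r rad2 g complex_cnj_cnj ae by (simp add: algebra_simps)
  moreover have "1 / q + c / (q + 1) > 0" using c q by (simp add: add_pos_pos)
  moreover have "cnj e \<noteq> 0" by (simp add: e_def)
  ultimately have "dpot a 1 p + of_real a * cnj (drho a 1 p) / drho_norm2 a p \<noteq> 0"
    by (metis less_numeral_extra(3) mult_eq_0_iff of_real_eq_0_iff)
  moreover have "p \<in> hypersurface (ellipsoid_fun a)"
    using q by (simp add: hypersurface_iff rad2 p flip: of_real_mult)
  moreover have "p $ 1 \<noteq> 0" using q by (simp add: p)
  ultimately show ?thesis using that p(2) by blast
qed

theorem theorem1p2:
  fixes a :: real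
    and \<theta> :: "complex^3 \<Rightarrow> complex^3"
    and \<Gamma> :: "complex^3 \<Rightarrow> cvec \<Rightarrow> cvec \<Rightarrow> cvec"
  assumes "a \<noteq> 0"
    and "pseudohermitian (ellipsoid_fun a) \<theta>"
    and "tanaka_webster (ellipsoid_fun a) \<theta> \<Gamma>"
  shows "\<exists>U Z p \<alpha>. CR_frame (ellipsoid_fun a) U Z \<and> p \<in> hypersurface (ellipsoid_fun a) \<inter> U \<and>
           X_form \<theta> \<Gamma> Z \<alpha> p \<noteq> 0"
proof -
  obtain W1 where W1: "open W1" "hypersurface (ellipsoid_fun a) \<subseteq> W1" "smooth_on W1 \<theta>"
    using assms(2) unfolding pseudohermitian_def by blast
  have "linear_connection (ellipsoid_fun a) \<Gamma>"
    using assms(3) by (simp add: tanaka_webster_def)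
  then obtain W2 where W2: "open W2" "hypersurface (ellipsoid_fun a) \<subseteq> W2"
    "\<And>X Y. smooth_on W2 (\<lambda>p. \<Gamma> p X Y)" "\<And>p. p \<in> W2 \<Longrightarrow> cbilinear (\<Gamma> p)"
    "\<And>p X Y. p \<in> W2 \<Longrightarrow> \<Gamma> p (cconj X) (cconj Y) = cconj (\<Gamma> p X Y)"
    unfolding linear_connection_def by metis
  interpret tw_ellipsoid a \<theta> \<Gamma> "W1 \<inter> W2"
    using W1 W2 assms smooth_on_subset[OF W1(3)] smooth_on_subset[OF W2(3)]
    by unfold_locales (auto simp: open_Int)
  obtain p where p: "p \<in> hypersurface (ellipsoid_fun a)" "p $ 1 \<noteq> 0" "p $ 2 = 0"
    and nz: "dpot a 1 p + of_real a * cnj (drho a 1 p) / drho_norm2 a p \<noteq> 0"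
    using ellipsoid_point[OF assms(1)] by blast
  have pU: "p \<in> M \<inter> U" using M_in_U p by simp
  have pv: "p \<in> V" using in_V[OF pU] by simp
  have "weyl_size p \<noteq> 0" using rad2_nz[OF pv] drho_norm2_nz[OF pv] assms(1) by (simp add: weyl_size_def)
  then have "X_form \<theta> \<Gamma> Z 1 p \<noteq> 0"
    using X_form_slice[OF pU p(3)] nz slice_values(5)[OF pv p(3)] lam_nz_U[OF pU] by simp
  then show ?thesis using CR_frame_Z pU by blast
qed

end
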